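(* Consider the scheme which, given $\phi^n,U^n,u^n$ and $\phi^{n-1},U^{n-1},u^{n-1}$, determines $\phi^{n+1},U^{n+1},u^{n+1}$ from the linear coupled system $$\tau(\phi^{\star})\frac{3\phi^{n+1}-4\phi^n+\phi^{n-1}}{2\delta t}+\frac{S_1}{\epsilon^2}(\phi^{n+1}-2\phi^n+\phi^{n-1})-S_2\Delta(\phi^{n+1}-2\phi^n+\phi^{n-1})=-Z^{\star}U^{n+1}-\frac{\lambda}{\epsilon}p'(\phi^{\star})u^{n+1},$$ $$3U^{n+1}-4U^n+U^{n-1}=\frac12Z^{\star}(3\phi^{n+1}-4\phi^n+\phi^{n-1}),$$ $$\frac{3u^{n+1}-4u^n+u^{n-1}}{2\delta t}-D\Delta u^{n+1}=Kp'(\phi^{\star})\frac{3\phi^{n+1}-4\phi^n+\phi^{n-1}}{2\delta t},$$ where $\phi^{\star}=2\phi^n-\phi^{n-1}$ and $Z^{\star}=Z(\phi^{\star})$. This scheme is unconditionally energy stable (no restriction on $\delta t>0$): it satisfies the discrete energy dissipation law $$\frac{1}{\delta t}\big(E^{n+1}_{bdf2}-E^{n}_{bdf2}\big)\le-\Big\|\sqrt{\tau(\phi^{\star})}\,\frac{3\phi^{n+1}-4\phi^n+\phi^{n-1}}{2\delta t}\Big\|^2-\frac{\lambda D}{\epsilon K}\|\nabla u^{n+1}\|^2\le0,$$ where $$E^{n+1}_{bdf2}=\frac{\|U^{n+1}\|^2+\|2U^{n+1}-U^n\|^2}{2}+\frac{\lambda}{2\epsilon K}\Big(\frac{\|u^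{n+1}\|^2+\|2u^{n+1}-u^n\|^2}{2}\Big)+\frac{S_1}{\epsilon^2}\frac{\|\phi^{n+1}-\phi^n\|^2}{2}+S_2\frac{\|\nabla\phi^{n+1}-\nabla\phi^n\|^2}{2}.$$
   Context: $\Omega$ is a smooth, open, bounded, connected domain in $\mathbb{R}^d$, $d=2,3$; the boundary conditions are either periodic for all variables, or no-flux, $\frac{\partial\phi}{\partial\mathbf n}=\frac{\partial u}{\partial\mathbf n}=0$ on $\partial\Omega$ with $\mathbf n$ the outward normal. $\|\cdot\|$ is the $L^2(\Omega)$ norm. The superscript $n$ denotes the numerical approximation at time $t^n=n\delta t$, with $\delta t>0$ the time step; $E^n_{bdf2}$ is the expression for $E^{n+1}_{bdf2}$ with $n+1,n$ replaced by $n,n-1$. $\epsilon,\lambda,K>0$ are model parameters, $D>0$ is the diffusion rate of the temperature $u$, and $S_1,S_2>0$ are stabilizing parameters. The mobility $\tau(\cdot)>0$ is a constant or a function of $\phi$. The function $p$ has two common choices: $p(\phi)=\frac15\phi^5-\frac23\phi^3+\phi$ with $p'(\phi)=(1-\phi^2)^2$, or $p(\phi)=\phi-\frac13\phi^3$ with $p'(\phi)=1-\phi^2$. With $F(\phi)=(\phi^2-1)^2$, $f(\phi)=\frac14F'(\phi)=\phi^3-\phi$, and $B$ a constant ensuring that the radicand below is positive, set $$Z(\phi)=\frac{-\nabla\cdot\big(\kappa^2(\nabla\phi)\nabla\phi+\kappa(\nabla\phi)|\nabla\phi|^2\boldsymbol{H}(\phi)\big)+\frac{1}{\epsilon^2}f(\phi)}{\sqrt{\frac12|\kappa(\nabla\phi)\nabla\phi|^2+\frac{1}{4\epsilon^2}F(\phi)+B}}.$$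 The unknown $U$ approximates the auxiliary variable given by the square root in the denominator. Here $\kappa(\nabla\phi)$ is the anisotropy coefficient. In 2D it is usually $\kappa(\nabla\phi)=1+\epsilon_4\cos(m\Theta)$ with $\Theta=\arctan(\phi_y/\phi_x)$, $m$ the number of folds and $\epsilon_4$ the anisotropy strength; for $m=4$ this is $(1-3\epsilon_4)\big(1+\frac{4\epsilon_4}{1-3\epsilon_4}\frac{\phi_x^4+\phi_y^4}{|\nabla\phi|^4}\big)$. In 3D (fourfold), $\kappa(\nabla\phi)=(1-3\epsilon_4)\big(1+\frac{4\epsilon_4}{1-3\epsilon_4}\frac{\phi_x^4+\phi_y^4+\phi_z^4}{|\nabla\phi|^4}\big)$. $\boldsymbol{H}(\phi)$ is the variational derivative of $\kappa(\nabla\phi)$, i.e. the gradient of $\kappa$ with respect to its argument $\nabla\phi$; for the fourfold case in 2D, $\boldsymbol{H}(\phi)=\frac{16\epsilon_4}{|\nabla\phi|^6}\big(\phi_x(\phi_x^2\phi_y^2-\phi_y^4),\ \phi_y(\phi_x^2\phi_y^2-\phi_x^4)\big)$, and in 3D $\boldsymbol{H}(\phi)=\frac{16\epsilon_4}{|\nabla\phi|^6}\big(\phi_x(\phi_x^2\phi_y^2+\phi_x^2\phi_z^2-\phi_y^4-\phi_z^4),\ \phi_y(\phi_y^2\phi_z^2+\phi_x^2\phi_y^2-\phi_x^4-\phi_z^4),\ \phi_z(\phi_x^2\phi_z^2+\phi_y^2\phi_z^2-\phi_x^4-\phi_y^4)\big)$. *)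

theory Defs
  imports "HOL-Analysis.Analysis"
begin

definition grad :: "(real^'n \<Rightarrow> real) \<Rightarrow> real^'n \<Rightarrow> real^'n" where
  "grad f x = (\<chi> i. frechet_derivative f (at x) (axis i 1))"

lemma GDERIV_grad:
  assumes "f differentiable (at x)"
  shows "GDERIV f x :> grad f x"
proof -
  have d: "(f has_derivative frechet_derivative f (at x)) (at x)"
    using assms by (simp add: frechet_derivative_works)
  then interpret bounded_linear "frechet_derivative f (at x)"
    by (rule has_derivative_bounded_linear)
  have "frechet_derivative f (at x) h = h \<bullet> grad f x" for h
  proof -
    have "frechet_derivative f (at x) h
        = frechet_derivative f (at x) (\<Sum>i\<in>UNIV. (h $ i) *\<^sub>R axis i 1)"
      by (simp add: basis_expansion scalar_mult_eq_scaleR[symmetric])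
    then show ?thesis
      by (simp add: sum scaleR grad_def inner_vec_def)
  qed
  then have "frechet_derivative f (at x) = (\<lambda>h. h \<bullet> grad f x)"
    by blast
  then show ?thesis
    using d by (simp add: gderiv_def)
qed

text \<open>Meant for open \<open>V\<close> only.\<close>

primrec Ck_on :: "nat \<Rightarrow> (real^'n) set \<Rightarrow> (real^'n \<Rightarrow> real) \<Rightarrow> bool" where
  "Ck_on 0 V f \<longleftrightarrow> continuous_on V f"
| "Ck_on (Suc k) V f \<longleftrightarrow>
     (\<forall>x\<in>V. f differentiable (at x)) \<and> (\<forall>i. Ck_on k V (\<lambda>x. grad f x $ i))"

definition smooth_on :: "(real^'n) set \<Rightarrow> (real^'n \<Rightarrow> real) \<Rightarrow> bool" where
  "smooth_on V f \<longleftrightarrow> (\<forall>k. Ck_on k V f)"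

definition C1_up_to_boundary :: "(real^'n) set \<Rightarrow> (real^'n \<Rightarrow> real) \<Rightarrow> bool" where
  "C1_up_to_boundary \<Omega> v \<longleftrightarrow> (\<exists>W. open W \<and> closure \<Omega> \<subseteq> W \<and> Ck_on 1 W v)"

definition boundary_chart :: "(real^'n) set \<Rightarrow> (real^'n) set \<Rightarrow> (real^'n \<Rightarrow> real) \<Rightarrow> bool" where
  "boundary_chart \<Omega> V \<rho> \<longleftrightarrow>
     open V \<and> smooth_on V \<rho> \<and> (\<forall>x\<in>V. grad \<rho> x \<noteq> 0) \<and> \<Omega> \<inter> V = {x\<in>V. \<rho> x < 0}"

definition smooth_bounded_domain :: "(real^'n) set \<Rightarrow> bool" where
  "smooth_bounded_domain \<Omega> \<longleftrightarrow>
     open \<Omega> \<and> bounded \<Omega> \<and> connected \<Omega> \<and> \<Omega> \<noteq> {} \<and>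
     (\<forall>x\<in>frontier \<Omega>. \<exists>V \<rho>. x \<in> V \<and> boundary_chart \<Omega> V \<rho>)"

definition is_outward_normal :: "(real^'n) set \<Rightarrow> real^'n \<Rightarrow> real^'n \<Rightarrow> bool" where
  "is_outward_normal \<Omega> x \<nu> \<longleftrightarrow>
     (\<exists>V \<rho>. x \<in> V \<and> boundary_chart \<Omega> V \<rho> \<and> \<nu> = grad \<rho> x /\<^sub>R norm (grad \<rho> x))"

definition no_flux :: "(real^'n) set \<Rightarrow> (real^'n \<Rightarrow> real) \<Rightarrow> bool" where
  "no_flux \<Omega> v \<longleftrightarrow>
     (\<forall>x\<in>frontier \<Omega>. \<forall>\<nu>. is_outward_normal \<Omega> x \<nu> \<longrightarrow> grad v x \<bullet> \<nu> = 0)"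

text \<open>Periodicity with respect to the cell \<open>box a b\<close>. Functions on the torus are represented
  by periodic functions on the whole space.\<close>

definition periodic :: "real^'n \<Rightarrow> real^'n \<Rightarrow> (real^'n \<Rightarrow> real) \<Rightarrow> bool" where
  "periodic a b v \<longleftrightarrow> (\<forall>x i. v (x + (b $ i - a $ i) *\<^sub>R axis i 1) = v x)"

text \<open>Periodic conditions go with a rectangular cell, which is smooth as a torus but not as a subset
  of space; no-flux conditions go with a smooth bounded domain. The set \<open>\<V>\<close> collects the
  functions the conditions are imposed on.\<close>

definition domain_with_bc :: "(real^'n) set \<Rightarrow> (real^'n \<Rightarrow> real) set \<Rightarrow> bool" where
  "domain_with_bc \<Omega> \<V> \<longleftrightarrow>
     (\<exists>a b. (\<forall>i. a $ i < b $ i) \<and> \<Omega> = box a b \<and> (\<forall>v\<in>\<V>. periodic a b v))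
   \<or> (smooth_bounded_domain \<Omega> \<and> (\<forall>v\<in>\<V>. no_flux \<Omega> v))"

definition square_integrable :: "(real^'n) set \<Rightarrow> (real^'n \<Rightarrow> real) \<Rightarrow> bool" where
  "square_integrable \<Omega> v \<longleftrightarrow>
     v \<in> borel_measurable (lebesgue_on \<Omega>) \<and> integrable (lebesgue_on \<Omega>) (\<lambda>x. (v x)\<^sup>2)"

definition L2_norm :: "(real^'n) set \<Rightarrow> (real^'n \<Rightarrow> 'b::real_normed_vector) \<Rightarrow> real" where
  "L2_norm \<Omega> v = sqrt (LINT x|lebesgue_on \<Omega>. (norm (v x))\<^sup>2)"

definition locally_integrable ::
    "(real^'n) set \<Rightarrow> (real^'n \<Rightarrow> 'b::{banach, second_countable_topology}) \<Rightarrow> bool" where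
  "locally_integrable \<Omega> v \<longleftrightarrow> (\<forall>C. compact C \<and> C \<subseteq> \<Omega> \<longrightarrow> set_integrable lebesgue C v)"

definition test_function :: "(real^'n) set \<Rightarrow> (real^'n \<Rightarrow> real) \<Rightarrow> bool" where
  "test_function \<Omega> \<psi> \<longleftrightarrow>
     Ck_on 1 UNIV \<psi> \<and> compact (closure {x. \<psi> x \<noteq> 0}) \<and> closure {x. \<psi> x \<noteq> 0} \<subseteq> \<Omega>"

definition is_weak_div ::
    "(real^'n) set \<Rightarrow> (real^'n \<Rightarrow> real^'n) \<Rightarrow> (real^'n \<Rightarrow> real) \<Rightarrow> bool" where
  "is_weak_div \<Omega> G g \<longleftrightarrow>
     locally_integrable \<Omega> G \<and> locally_integrable \<Omega> g \<and>
     (\<forall>\<psi>. test_function \<Omega> \<psi> \<longrightarrow>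
        (LINT x|lebesgue_on \<Omega>. G x \<bullet> grad \<psi> x) = - (LINT x|lebesgue_on \<Omega>. g x * \<psi> x))"

text \<open>Divergence and Laplacian are taken in the weak sense, because the anisotropic flux below is in
  general not differentiable where the gradient vanishes. They are determined up to null sets and
  agree with the classical ones for fields of class \<open>C\<^sup>1\<close>, respectively functions of
  class \<open>C\<^sup>2\<close>. Test functions are supported inside \<open>\<Omega>\<close>, so nothing about
  boundary values is built in.\<close>

definition weak_div :: "(real^'n) set \<Rightarrow> (real^'n \<Rightarrow> real^'n) \<Rightarrow> real^'n \<Rightarrow> real" where
  "weak_div \<Omega> G = (SOME g. is_weak_div \<Omega> G g)"

definition laplacian :: "(real^'n) set \<Rightarrow> (real^'n \<Rightarrow> real) \<Rightarrow> real^'n \<Rightarrow> real" where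
  "laplacian \<Omega> v = weak_div \<Omega> (grad v)"

definition regular :: "(real^'n) set \<Rightarrow> (real^'n \<Rightarrow> real) \<Rightarrow> bool" where
  "regular \<Omega> v \<longleftrightarrow>
     C1_up_to_boundary \<Omega> v \<and> (\<exists>g. is_weak_div \<Omega> (grad v) g \<and> square_integrable \<Omega> g)"

definition double_well :: "real \<Rightarrow> real" where
  "double_well s = (s\<^sup>2 - 1)\<^sup>2"

definition double_well_force :: "real \<Rightarrow> real" where
  "double_well_force s = s ^ 3 - s"

lemma double_well_force_eq: "double_well_force s = deriv double_well s / 4"
proof -
  have "(double_well has_field_derivative 4 * (s ^ 3 - s)) (at s)"
    unfolding double_well_def
    by (rule derivative_eq_intros refl | simp add: power2_eq_square power3_eq_cube algebra_simps)+
  then show ?thesis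
    by (simp add: double_well_force_def DERIV_imp_deriv)
qed

text \<open>\<open>\<kappa>\<close> is a function of the vector \<open>\<nabla>\<phi>\<close> and the variational derivative
  \<open>H(\<phi>)\<close> is \<open>grad \<kappa>\<close> at \<open>\<nabla>\<phi>\<close>. The usual choices of \<open>\<kappa>\<close> are singular at \<open>0\<close>; the value of
  \<open>grad \<kappa> 0\<close> is irrelevant, since it is multiplied by \<open>(norm 0)\<^sup>2 = 0\<close>.\<close>

definition anisotropic_flux ::
    "(real^'n \<Rightarrow> real) \<Rightarrow> (real^'n \<Rightarrow> real) \<Rightarrow> real^'n \<Rightarrow> real^'n" where
  "anisotropic_flux \<kappa> v x =
     (\<kappa> (grad v x))\<^sup>2 *\<^sub>R grad v x
     + (\<kappa> (grad v x) * (norm (grad v x))\<^sup>2) *\<^sub>R grad \<kappa> (grad v x)"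

definition radicand ::
    "(real^'n \<Rightarrow> real) \<Rightarrow> real \<Rightarrow> real \<Rightarrow> (real^'n \<Rightarrow> real) \<Rightarrow> real^'n \<Rightarrow> real" where
  "radicand \<kappa> \<epsilon> B v x =
     1/2 * (norm (\<kappa> (grad v x) *\<^sub>R grad v x))\<^sup>2 + 1 / (4 * \<epsilon>\<^sup>2) * double_well (v x) + B"

definition Z ::
    "(real^'n) set \<Rightarrow> (real^'n \<Rightarrow> real) \<Rightarrow> real \<Rightarrow> real \<Rightarrow> (real^'n \<Rightarrow> real) \<Rightarrow> real^'n \<Rightarrow> real"
  where
  "Z \<Omega> \<kappa> \<epsilon> B v x =
     (- weak_div \<Omega> (anisotropic_flux \<kappa> v) x + 1 / \<epsilon>\<^sup>2 * double_well_force (v x))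
     / sqrt (radicand \<kappa> \<epsilon> B v x)"

text \<open>The two usual choices of \<open>p\<close>; the scheme uses \<open>deriv p\<close> only.\<close>

lemma deriv_p_quintic: "deriv (\<lambda>s::real. 1/5 * s^5 - 2/3 * s^3 + s) s = (1 - s\<^sup>2)\<^sup>2"
  by (rule DERIV_imp_deriv)
    (rule derivative_eq_intros refl | simp add: power2_eq_square power4_eq_xxxx algebra_simps)+

lemma deriv_p_cubic: "deriv (\<lambda>s::real. s - 1/3 * s^3) s = 1 - s\<^sup>2"
  by (rule DERIV_imp_deriv) (rule derivative_eq_intros refl | simp)+

text \<open>Arguments: the new and the old value of each of \<open>\<phi>\<close>, \<open>U\<close> and \<open>u\<close>.\<close>

definition E_bdf2 ::
    "(real^'n) set \<Rightarrow> real \<Rightarrow> real \<Rightarrow> real \<Rightarrow> real \<Rightarrow> real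
     \<Rightarrow> (real^'n \<Rightarrow> real) \<Rightarrow> (real^'n \<Rightarrow> real) \<Rightarrow> (real^'n \<Rightarrow> real) \<Rightarrow> (real^'n \<Rightarrow> real)
     \<Rightarrow> (real^'n \<Rightarrow> real) \<Rightarrow> (real^'n \<Rightarrow> real) \<Rightarrow> real" where
  "E_bdf2 \<Omega> \<epsilon> lam K S\<^sub>1 S\<^sub>2 \<phi>\<^sub>1 \<phi>\<^sub>0 U\<^sub>1 U\<^sub>0 u\<^sub>1 u\<^sub>0 =
     ((L2_norm \<Omega> U\<^sub>1)\<^sup>2 + (L2_norm \<Omega> (\<lambda>x. 2 * U\<^sub>1 x - U\<^sub>0 x))\<^sup>2) / 2
     + lam / (2 * \<epsilon> * K) * (((L2_norm \<Omega> u\<^sub>1)\<^sup>2 + (L2_norm \<Omega> (\<lambda>x. 2 * u\<^sub>1 x - u\<^sub>0 x))\<^sup>2) / 2)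
     + S\<^sub>1 / \<epsilon>\<^sup>2 * ((L2_norm \<Omega> (\<lambda>x. \<phi>\<^sub>1 x - \<phi>\<^sub>0 x))\<^sup>2 / 2)
     + S\<^sub>2 * ((L2_norm \<Omega> (\<lambda>x. grad \<phi>\<^sub>1 x - grad \<phi>\<^sub>0 x))\<^sup>2 / 2)"

end

theory Submission
  imports Defs
begin

text \<open>Testing the phase equation with \<open>(3\<phi>\<^sup>n\<^sup>+\<^sup>1 - 4\<phi>\<^sup>n + \<phi>\<^sup>n\<^sup>-\<^sup>1) / 2\<delta>t\<close> and the heat equation with
  \<open>u\<^sup>n\<^sup>+\<^sup>1\<close> cancels the coupling terms, and the identity
  \<open>2x(3x - 4y + z) = x\<^sup>2 + (2x - y)\<^sup>2 - y\<^sup>2 - (2y - z)\<^sup>2 + (x - 2y + z)\<^sup>2\<close> turns the rest into energy differences.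
  The analytic content is Green's identity for a \<open>C\<^sup>1\<close> function whose Laplacian is only a weak one, so that
  it is known on test functions supported inside the domain. Cut-off functions \<open>\<psi>\<^sub>k\<close> rising to \<open>1\<close> leave
  the boundary layer term \<open>\<integral> v G \<bullet> \<nabla>\<psi>\<^sub>k\<close>. The mass of the layer is bounded by an integration by parts; the
  flux through it tends to zero with the normal component of \<open>G\<close> (no-flux), or because opposite faces
  cancel (periodic).\<close>

section \<open>Calculus of continuously differentiable functions\<close>

text \<open>Two obstacles shape the development. \<open>laplacian\<close> is a \<open>SOME\<close>
  choice, pinned down only almost everywhere, so the square-integrable weak divergence promised by
  \<open>regular\<close> must first be shown to agree with it; hence the fundamental lemma of the
  calculus of variations. And boundary terms are never written as surface integrals:
  \<open>defect\<close> measures by how much the divergence theorem fails, it is additive, and its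
  vanishing is a local matter that bump functions can isolate. Test functions have to be C1 only, so
  all cut-offs come from one rational profile, \<open>step\<close>. In the scheme, no boundedness or
  global integrability is assumed of \<open>Zs\<close>, \<open>\<tau> (\<phi>s x)\<close> and
  \<open>deriv p (\<phi>s x)\<close>. Products with them are therefore not integrated one by one:
  the couplings cancel pointwise almost everywhere, and the dissipation density inherits its
  integrability from what remains, namely products of square-integrable functions and the integrands
  of Green's identity.\<close>

definition C1_on :: "(real^'n) set \<Rightarrow> (real^'n \<Rightarrow> real) \<Rightarrow> bool" where
  "C1_on V f \<longleftrightarrow> (\<forall>x\<in>V. f differentiable (at x)) \<and> continuous_on V (grad f)"

text \<open>The \<open>GDERIV\<close> rules produce whole gradient vectors, while
  \<open>Ck_on\<close> recurses through components; this equivalence lets everything below work with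
  vectors.\<close>

lemma Ck_on_1_iff: "Ck_on 1 V f \<longleftrightarrow> C1_on V f"
proof -
  have "continuous_on V (grad f) \<longleftrightarrow> (\<forall>i. continuous_on V (\<lambda>x. grad f x $ i))"
  proof
    assume "\<forall>i. continuous_on V (\<lambda>x. grad f x $ i)"
    then have "continuous_on V (\<lambda>x. \<chi> i. grad f x $ i)"
      by (intro continuous_on_vec_lambda) auto
    then show "continuous_on V (grad f)"
      by simp
  qed (auto intro: continuous_intros)
  then show ?thesis
    by (simp add: C1_on_def)
qed

lemma GDERIV_unique:
  assumes "GDERIV f x :> D" "GDERIV f x :> E"
  shows "D = E"
proof -
  have "(\<lambda>h. h \<bullet> D) = (\<lambda>h. h \<bullet> E)"
    using assms unfolding gderiv_def by (rule has_derivative_unique)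
  then show ?thesis
    unfolding fun_eq_iff vector_eq_ldot .
qed

text \<open>A continuous candidate gradient settles both questions at once, because gradients are
  unique. Most closure properties below are read off from the matching \<open>GDERIV\<close> rule in
  this way.\<close>

lemma C1_onI:
  assumes "\<And>x. x \<in> V \<Longrightarrow> GDERIV f x :> D x" and "continuous_on V D"
  shows "C1_on V f" and "\<And>x. x \<in> V \<Longrightarrow> grad f x = D x"
proof -
  have d: "f differentiable (at x)" if "x \<in> V" for x
    using assms(1)[OF that] by (auto simp: gderiv_def differentiable_def)
  show g: "grad f x = D x" if "x \<in> V" for x
    using GDERIV_grad[OF d[OF that]] assms(1)[OF that] by (rule GDERIV_unique)
  have "continuous_on V (grad f)"
    using assms(2) g by (simp cong: continuous_on_cong)
  with d show "C1_on V f"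
    unfolding C1_on_def by blast
qed

lemma C1_on_GDERIV:
  assumes "C1_on V f" and "x \<in> V"
  shows "GDERIV f x :> grad f x"
  using assms GDERIV_grad unfolding C1_on_def by blast

lemma grad_eqI: "GDERIV f x :> D \<Longrightarrow> grad f x = D"
  by (rule GDERIV_unique[OF GDERIV_grad]) (auto simp: gderiv_def differentiable_def)

lemma C1_on_continuous:
  assumes "C1_on V f"
  shows "continuous_on V f" and "continuous_on V (grad f)"
proof -
  show "continuous_on V f"
    using assms unfolding C1_on_def
    by (meson continuous_at_imp_continuous_on differentiable_imp_continuous_within)
  show "continuous_on V (grad f)"
    using assms unfolding C1_on_def by blast
qed

lemma C1_on_subset: "C1_on V f \<Longrightarrow> W \<subseteq> V \<Longrightarrow> C1_on W f"
  unfolding C1_on_def by (meson continuous_on_subset subsetD)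

lemma grad_const [simp]: "grad (\<lambda>x. c) x = 0"
  by (rule grad_eqI) (rule GDERIV_const)

lemma C1_on_const [simp]: "C1_on V (\<lambda>x. c)"
  by (rule C1_onI(1)[OF GDERIV_const]) simp

lemma grad_add:
  assumes "C1_on V f" "C1_on V g" "x \<in> V"
  shows "grad (\<lambda>x. f x + g x) x = grad f x + grad g x"
  by (intro grad_eqI GDERIV_add C1_on_GDERIV[of V] assms)

lemma C1_on_add:
  assumes "C1_on V f" "C1_on V g"
  shows "C1_on V (\<lambda>x. f x + g x)"
proof (rule C1_onI(1))
  show "continuous_on V (\<lambda>x. grad f x + grad g x)"
    by (intro continuous_intros C1_on_continuous assms)
qed (intro GDERIV_add C1_on_GDERIV[of V] assms)

lemma C1_on_diff:
  assumes "C1_on V f" "C1_on V g"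
  shows "C1_on V (\<lambda>x. f x - g x)"
proof (rule C1_onI(1))
  show "continuous_on V (\<lambda>x. grad f x - grad g x)"
    by (intro continuous_intros C1_on_continuous assms)
qed (intro GDERIV_diff C1_on_GDERIV[of V] assms)

lemma grad_mult:
  assumes "C1_on V f" "C1_on V g" "x \<in> V"
  shows "grad (\<lambda>x. f x * g x) x = f x *\<^sub>R grad g x + g x *\<^sub>R grad f x"
  by (intro grad_eqI GDERIV_mult C1_on_GDERIV[of V] assms)

lemma C1_on_mult:
  assumes "C1_on V f" "C1_on V g"
  shows "C1_on V (\<lambda>x. f x * g x)"
proof (rule C1_onI(1))
  show "continuous_on V (\<lambda>x. f x *\<^sub>R grad g x + g x *\<^sub>R grad f x)"
    by (intro continuous_intros C1_on_continuous assms)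
qed (intro GDERIV_mult C1_on_GDERIV[of V] assms)

lemma grad_cmult:
  assumes "C1_on V f" "x \<in> V"
  shows "grad (\<lambda>x. c * f x) x = c *\<^sub>R grad f x"
  using grad_mult[OF C1_on_const assms] by simp

lemma grad_compose:
  assumes "C1_on V f" "x \<in> V" "(h has_real_derivative h') (at (f x))"
  shows "grad (\<lambda>x. h (f x)) x = h' *\<^sub>R grad f x"
  by (intro grad_eqI GDERIV_DERIV_compose C1_on_GDERIV[of V] assms)

lemma C1_on_compose:
  assumes f: "C1_on V f" and h: "\<And>s. (h has_real_derivative h' s) (at s)"
    and c: "continuous_on UNIV h'"
  shows "C1_on V (\<lambda>x. h (f x))"
proof (rule C1_onI(1))
  have "continuous_on V (\<lambda>x. h' (f x))"
    by (rule continuous_on_compose2[OF c C1_on_continuous(1)[OF f]]) auto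
  then show "continuous_on V (\<lambda>x. h' (f x) *\<^sub>R grad f x)"
    by (intro continuous_on_scaleR C1_on_continuous(2) f)
  show "GDERIV (\<lambda>x. h (f x)) x :> h' (f x) *\<^sub>R grad f x" if "x \<in> V" for x
    by (rule GDERIV_DERIV_compose[OF C1_on_GDERIV[OF f that] h])
qed

lemma GDERIV_component: "GDERIV (\<lambda>x::real^'n. x $ i) x :> axis i 1"
  unfolding gderiv_def inner_axis by (simp add: bounded_linear.has_derivative[OF bounded_linear_vec_nth])

lemma C1_on_component: "C1_on V (\<lambda>x::real^'n. x $ i)"
  by (rule C1_onI(1)[OF GDERIV_component]) simp

lemma grad_component [simp]: "grad (\<lambda>x::real^'n. x $ i) x = axis i 1"
  by (rule grad_eqI[OF GDERIV_component])

section \<open>Functions that vanish off a closed set\<close>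

lemma GDERIV_0_off_closed:
  assumes "closed S" and "\<And>y. y \<notin> S \<Longrightarrow> f y = 0" and "x \<notin> S"
  shows "GDERIV f x :> 0"
proof -
  have "((\<lambda>_. 0) has_derivative (\<lambda>h. h \<bullet> 0)) (at x)"
    by simp
  then show ?thesis
    unfolding gderiv_def
    by (rule has_derivative_transform_within_open[of _ _ _ "UNIV" "-S"]) (use assms in auto)
qed

text \<open>\<open>V\<close> and the complement of \<open>S\<close> are open and cover the space,
  and on the second one \<open>f\<close> is zero. Expressions that are regular only inside a chart
  become global C1 functions this way once they are multiplied by a cut-off.\<close>

lemma C1_on_zero_extension:
  assumes f: "C1_on V f" and "open V" "closed S" "S \<subseteq> V" and z: "\<And>x. x \<notin> S \<Longrightarrow> f x = 0"
  shows "C1_on UNIV f"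
proof -
  have 1: "f differentiable (at x)" for x
  proof (cases "x \<in> V")
    case True
    then show ?thesis using f unfolding C1_on_def by blast
  next
    case False
    then have "GDERIV f x :> 0"
      using assms by (intro GDERIV_0_off_closed[of S]) auto
    then show ?thesis
      by (auto simp: gderiv_def differentiable_def)
  qed
  have "continuous_on (-S) (grad f) \<longleftrightarrow> continuous_on (-S) (\<lambda>x. 0::real^'a)"
    by (rule continuous_on_cong)
      (use grad_eqI[OF GDERIV_0_off_closed[OF assms(3) z]] in auto)
  then have "continuous_on (-S \<union> V) (grad f)"
    using assms C1_on_continuous(2)[OF f]
    by (intro continuous_on_open_Un) auto
  moreover have "-S \<union> V = UNIV"
    using assms by auto
  ultimately show ?thesis
    using 1 unfolding C1_on_def by auto
qed

text \<open>A C1 switch a^2 / (a^2 + b^2) built from two positive parts. The rise sits in [1, 2]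
  rather than [0, 1], so that for \<open>t > 0\<close> the function \<open>step (t * s)\<close>
  vanishes already for \<open>s < 1 / t\<close>; this keeps the supports of the cut-offs away from
  the boundary.\<close>

definition step :: "real \<Rightarrow> real" where
  "step s = (max 0 (s - 1))\<^sup>2 / ((max 0 (s - 1))\<^sup>2 + (max 0 (2 - s))\<^sup>2)"

text \<open>The numerator of the quotient rule after its cubes have cancelled, so that its sign is
  visible. The boundary layer weights owe their nonnegativity to this form.\<close>

definition step' :: "real \<Rightarrow> real" where
  "step' s = (2 * max 0 (s - 1) * (max 0 (2 - s))\<^sup>2 + (max 0 (s - 1))\<^sup>2 * (2 * max 0 (2 - s)))
     / ((max 0 (s - 1))\<^sup>2 + (max 0 (2 - s))\<^sup>2)\<^sup>2"

text \<open>Squaring smooths the kink of the positive part: at 0 the difference quotient is bounded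
  by \<open>\<bar>h\<bar>\<close>.\<close>

lemma DERIV_max_square: "((\<lambda>s::real. (max 0 s)\<^sup>2) has_real_derivative 2 * max 0 s) (at s)"
proof -
  consider "s < 0" | "s > 0" | "s = 0"
    by linarith
  then show ?thesis
  proof cases
    case 1
    have "((\<lambda>s::real. 0) has_real_derivative 0) (at s)"
      by simp
    then have "((\<lambda>s::real. (max 0 s)\<^sup>2) has_real_derivative 0) (at s)"
      by (rule has_field_derivative_transform_within_open[of _ _ _ "{..<0}"]) (use 1 in auto)
    with 1 show ?thesis by simp
  next
    case 2
    have "((\<lambda>s::real. s\<^sup>2) has_real_derivative 2 * s) (at s)"
      by (auto intro!: derivative_eq_intros)
    then have "((\<lambda>s::real. (max 0 s)\<^sup>2) has_real_derivative 2 * s) (at s)"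
      by (rule has_field_derivative_transform_within_open[of _ _ _ "{0<..}"]) (use 2 in auto)
    with 2 show ?thesis by simp
  next
    case 3
    have "(\<lambda>h::real. (max 0 h)\<^sup>2 / h) \<midarrow>0\<rightarrow> 0"
    proof (rule tendsto_rabs_zero_cancel, rule Lim_null_comparison)
      show "\<forall>\<^sub>F h::real in at 0. norm \<bar>(max 0 h)\<^sup>2 / h\<bar> \<le> \<bar>h\<bar>"
        by (intro always_eventually allI) (auto simp: max_def power2_eq_square)
      show "(\<lambda>h::real. \<bar>h\<bar>) \<midarrow>0\<rightarrow> 0"
        by (intro tendsto_rabs_zero tendsto_ident_at)
    qed
    with 3 show ?thesis
      by (simp add: DERIV_def)
  qed
qed

lemma step_denominator_pos: "(max 0 (s - 1))\<^sup>2 + (max 0 (2 - s))\<^sup>2 > (0::real)"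
proof (cases "s > 1")
  case True
  then have "(max 0 (s - 1))\<^sup>2 > 0" by simp
  then show ?thesis by (simp add: add_pos_nonneg)
next
  case False
  then have "(max 0 (2 - s))\<^sup>2 > 0" by simp
  then show ?thesis by (simp add: add_nonneg_pos)
qed

lemma DERIV_step: "(step has_real_derivative step' s) (at s)"
proof -
  define a b where "a = max 0 (s - 1)" and "b = max 0 (2 - s)"
  have "((\<lambda>s. s - 1) has_real_derivative 1) (at s)" "((\<lambda>s. 2 - s) has_real_derivative - 1) (at s)"
    by (auto intro!: derivative_eq_intros)
  note chain = this[THEN DERIV_chain'[where g = "\<lambda>s::real. (max 0 s)\<^sup>2", OF _ DERIV_max_square]]
  have 1: "((\<lambda>s::real. (max 0 (s - 1))\<^sup>2) has_real_derivative 2 * a) (at s)"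
    using chain(1) unfolding a_def by (simp only: mult_1_right)
  have 2: "((\<lambda>s::real. (max 0 (2 - s))\<^sup>2) has_real_derivative - 2 * b) (at s)"
    using chain(2) unfolding b_def by (simp only: mult_minus_left mult_minus_right mult_1_right)
  have nz: "a\<^sup>2 + b\<^sup>2 \<noteq> 0"
    using step_denominator_pos[of s] unfolding a_def b_def by (rule less_imp_neq[THEN not_sym])
  have eq: "2 * a * (a\<^sup>2 + b\<^sup>2) - a\<^sup>2 * (2 * a + - 2 * b) = 2 * a * b\<^sup>2 + a\<^sup>2 * (2 * b)"
    by algebra
  show ?thesis
    using DERIV_divide[OF 1 DERIV_add[OF 1 2]] nz
    unfolding step_def[abs_def] step'_def a_def[symmetric] b_def[symmetric] eq
    by (simp only: power2_eq_square simp_thms)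
qed

lemma step_eq_0: "s \<le> 1 \<Longrightarrow> step s = 0"
  by (simp add: step_def max_def)

lemma step_eq_1: "s \<ge> 2 \<Longrightarrow> step s = 1"
  by (auto simp add: step_def max_def)

lemma step_nonneg: "0 \<le> step s"
  by (simp add: step_def)

lemma step_le_1: "step s \<le> 1"
  using step_denominator_pos[of s] by (simp add: step_def divide_le_eq_1)

lemma step'_eq_0: "s \<le> 1 \<or> 2 \<le> s \<Longrightarrow> step' s = 0"
  by (auto simp: step'_def max_def)

lemma step'_nonneg: "0 \<le> step' s"
  by (simp add: step'_def)

lemma continuous_on_step': "continuous_on V step'"
  unfolding step'_def[abs_def]
  by (intro continuous_intros ballI) (use step_denominator_pos in \<open>auto simp: less_le\<close>)

lemma C1_on_step: "C1_on V f \<Longrightarrow> C1_on V (\<lambda>x. step (f x))"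
  by (rule C1_on_compose[OF _ DERIV_step continuous_on_step'])

lemma grad_step:
  "C1_on V f \<Longrightarrow> x \<in> V \<Longrightarrow> grad (\<lambda>x. step (f x)) x = step' (f x) *\<^sub>R grad f x"
  by (rule grad_compose[OF _ _ DERIV_step])

text \<open>The squared distance is differentiable at the centre too. On \<open>cball p r\<close>
  the argument of \<open>step\<close> is at least 2; it has fallen to 1 at distance sqrt 2 times
  \<open>r\<close>, so the ball of radius \<open>2 * r\<close> contains the support.\<close>

definition bump :: "'a::real_inner \<Rightarrow> real \<Rightarrow> 'a \<Rightarrow> real" where
  "bump p r x = step (3 - ((x - p) \<bullet> (x - p)) / r\<^sup>2)"

lemma bump_eq_1:
  assumes "r > 0" "x \<in> cball p r"
  shows "bump p r x = 1"
  unfolding bump_def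
proof (rule step_eq_1)
  have "(norm (x - p))\<^sup>2 \<le> r\<^sup>2"
    using assms by (intro power_mono) (auto simp: dist_norm norm_minus_commute)
  then have "((x - p) \<bullet> (x - p)) / r\<^sup>2 \<le> 1"
    using assms by (simp add: dot_square_norm)
  then show "2 \<le> 3 - ((x - p) \<bullet> (x - p)) / r\<^sup>2"
    by linarith
qed

lemma bump_eq_0:
  assumes "r > 0" "x \<notin> cball p (2 * r)"
  shows "bump p r x = 0"
  unfolding bump_def
proof (rule step_eq_0)
  have four: "2\<^sup>2 = (4::real)"
    by simp
  have "2 * r \<le> norm (x - p)"
    using assms(2) dist_norm[of x p] dist_commute[of x p] unfolding mem_cball by linarith
  then have "(2 * r)\<^sup>2 \<le> (norm (x - p))\<^sup>2"
    using assms(1) by (intro power_mono) simp_all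
  then have "2 * r\<^sup>2 \<le> (x - p) \<bullet> (x - p)"
    using zero_le_power2[of r] unfolding dot_square_norm power_mult_distrib four by linarith
  then have "2 \<le> ((x - p) \<bullet> (x - p)) / r\<^sup>2"
    using assms(1) by (subst pos_le_divide_eq) simp_all
  then show "3 - ((x - p) \<bullet> (x - p)) / r\<^sup>2 \<le> 1"
    by linarith
qed

lemma C1_on_bump: "C1_on V (bump (p::real^'n) r)"
proof -
  have "C1_on V (\<lambda>x::real^'n. (x - p) \<bullet> (x - p))"
  proof (rule C1_onI(1))
    show "GDERIV (\<lambda>x. (x - p) \<bullet> (x - p)) x :> 2 *\<^sub>R (x - p)" for x :: "real^'n"
      unfolding gderiv_def
      by (auto intro!: derivative_eq_intros simp: inner_commute)
  qed (intro continuous_intros)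
  then have "C1_on V (\<lambda>x::real^'n. 3 - inverse (r\<^sup>2) * ((x - p) \<bullet> (x - p)))"
    by (intro C1_on_diff C1_on_mult C1_on_const)
  then show ?thesis
    unfolding bump_def[abs_def] divide_inverse mult.commute[of _ "inverse (r\<^sup>2)"] by (rule C1_on_step)
qed

section \<open>Uniqueness of weak divergences\<close>

lemma borel_measurable_lebesgue_continuous:
  fixes f :: "'a::euclidean_space \<Rightarrow> 'b::euclidean_space"
  assumes "continuous_on UNIV f"
  shows "f \<in> borel_measurable lebesgue"
  using borel_measurable_continuous_onI[OF assms] by (intro measurable_completion) simp

lemma integrable_continuous_compact_support:
  fixes f :: "'a::euclidean_space \<Rightarrow> 'b::euclidean_space"
  assumes "continuous_on UNIV f" "compact S" "\<And>x. x \<notin> S \<Longrightarrow> f x = 0"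
  shows "integrable lebesgue f"
proof -
  have "(\<lambda>x. indicator S x *\<^sub>R f x) = f"
    using assms(3) by (auto simp: indicator_def)
  then have "integrable lborel f"
    using borel_integrable_compact[OF assms(2) continuous_on_subset[OF assms(1)]] by simp
  then show ?thesis
    by (simp add: integrable_completion)
qed

text \<open>Translation invariance is a property of \<open>lborel\<close>; continuity makes
  \<open>f\<close> Borel measurable, so that integrals against \<open>lborel\<close> and against its
  completion agree.\<close>

lemma lebesgue_integral_translation:
  fixes f :: "'a::euclidean_space \<Rightarrow> real"
  assumes "continuous_on UNIV f"
  shows "(LINT x|lebesgue. f (x + c)) = (LINT x|lebesgue. f x)"
proof -
  have m: "f \<in> borel_measurable borel"
    using assms by (rule borel_measurable_continuous_onI)
  have "continuous_on UNIV (\<lambda>x. f (x + c))"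
    by (rule continuous_on_compose2[OF assms]) (auto intro: continuous_intros)
  then have m': "(\<lambda>x. f (x + c)) \<in> borel_measurable borel"
    by (rule borel_measurable_continuous_onI)
  have "(LINT x|lborel. f x) = (LINT x|distr lborel borel ((+) c). f x)"
    by (simp add: lborel_distr_plus)
  also have "\<dots> = (LINT x|lborel. f (c + x))"
    using m by (intro integral_distr) auto
  finally show ?thesis
    using m m' by (simp add: integral_completion add.commute)
qed

lemma C1_on_directional_DERIV:
  assumes "C1_on UNIV f"
  shows "((\<lambda>t. f (x + t *\<^sub>R e)) has_real_derivative grad f (x + t *\<^sub>R e) \<bullet> e) (at t)"
proof -
  have "(f has_derivative (\<lambda>h. h \<bullet> grad f (x + t *\<^sub>R e))) (at (x + t *\<^sub>R e))"
    using C1_on_GDERIV[OF assms] by (simp add: gderiv_def)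
  moreover have "((\<lambda>t. x + t *\<^sub>R e) has_derivative (\<lambda>t. t *\<^sub>R e)) (at t)"
    by (auto intro!: derivative_eq_intros)
  ultimately have "((\<lambda>t. f (x + t *\<^sub>R e)) has_derivative (\<lambda>s. (s *\<^sub>R e) \<bullet> grad f (x + t *\<^sub>R e))) (at t)"
    by (rule has_derivative_compose[rotated])
  moreover have "(\<lambda>s. (s *\<^sub>R e) \<bullet> grad f (x + t *\<^sub>R e)) = (*) (grad f (x + t *\<^sub>R e) \<bullet> e)"
    by (simp add: fun_eq_iff inner_commute)
  ultimately show ?thesis
    by (simp only: has_field_derivative_def)
qed

text \<open>The difference quotients of \<open>f\<close> have integral zero by translation invariance.\<close>

lemma integral_grad_compact_support:
  assumes f: "C1_on UNIV f" and S: "compact S" and z: "\<And>x. x \<notin> S \<Longrightarrow> f x = 0"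
  shows "(LINT x|lebesgue. grad f x \<bullet> e) = 0"
proof -
  define s where "s k x = real (Suc k) * (f (x + (1 / real (Suc k)) *\<^sub>R e) - f x)" for k x
  have cf: "continuous_on UNIV f" and cg: "continuous_on UNIV (grad f)"
    using C1_on_continuous[OF f] by auto
  have cft: "continuous_on UNIV (\<lambda>x. f (x + c))" for c
    by (rule continuous_on_compose2[OF cf]) (auto intro: continuous_intros)
  have gz: "grad f x = 0" if "x \<notin> S" for x
    using grad_eqI[OF GDERIV_0_off_closed[OF compact_imp_closed[OF S] z that]] .
  obtain M where M: "M > 0" "\<And>x. norm (grad f x) \<le> M"
  proof -
    have "bounded (grad f ` S)"
      using S cg by (intro compact_imp_bounded compact_continuous_image) (auto intro: continuous_on_subset)
    then obtain M where "M > 0" and "\<forall>y\<in>grad f ` S. norm y \<le> M"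
      unfolding bounded_pos by blast
    then show ?thesis
      using that[of M] gz by (metis UNIV_I image_eqI less_imp_le norm_zero)
  qed
  obtain R where R: "S \<subseteq> cball 0 R"
    using compact_imp_bounded[OF S] unfolding bounded_any_center[of S 0] by (auto simp: subset_eq)
  \<comment> \<open>A majorant independent of \<open>k\<close>: the shift length \<open>h\<close> is
    at most 1, so no quotient lives beyond radius \<open>R + norm e\<close>, and the mean value
    theorem bounds it by \<open>M * norm e\<close>.\<close>
  have sb: "norm (s k x) \<le> indicator (cball 0 (R + norm e)) x * (M * norm e)" for k x
  proof -
    define h where "h = 1 / real (Suc k)"
    have h: "0 < h" "h \<le> 1"
      by (auto simp: h_def)
    show ?thesis
    proof (cases "x \<in> cball 0 (R + norm e)")
      case True
      have "\<exists>t. 0 < t \<and> t < h \<and> f (x + h *\<^sub>R e) - f (x + 0 *\<^sub>R e) = (h - 0) * (grad f (x + t *\<^sub>R e) \<bullet> e)"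
        by (rule MVT2[OF h(1)]) (rule C1_on_directional_DERIV[OF f])
      then obtain t where "f (x + h *\<^sub>R e) - f x = h * (grad f (x + t *\<^sub>R e) \<bullet> e)"
        by auto
      then have "s k x = grad f (x + t *\<^sub>R e) \<bullet> e"
        unfolding s_def h_def by (simp add: field_simps del: of_nat_Suc)
      moreover have "\<bar>grad f (x + t *\<^sub>R e) \<bullet> e\<bar> \<le> norm (grad f (x + t *\<^sub>R e)) * norm e"
        by (rule Cauchy_Schwarz_ineq2)
      moreover have "norm (grad f (x + t *\<^sub>R e)) * norm e \<le> M * norm e"
        by (intro mult_right_mono M) auto
      ultimately show ?thesis
        using True by simp
    next
      case False
      have "x \<notin> S"
      proof
        assume "x \<in> S"
        then have "norm x \<le> R"
          using R by auto
        then show False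
          using False norm_ge_zero[of e] by (simp del: norm_ge_zero)
      qed
      moreover have "x + h *\<^sub>R e \<notin> S"
      proof
        assume "x + h *\<^sub>R e \<in> S"
        then have "norm (x + h *\<^sub>R e) \<le> R"
          using R by auto
        moreover have "norm x \<le> norm (x + h *\<^sub>R e) + norm (h *\<^sub>R e)"
          by (metis add_diff_cancel_right' norm_triangle_ineq4)
        moreover have "norm (h *\<^sub>R e) \<le> norm e"
          using h by (simp add: mult_left_le_one_le)
        ultimately show False
          using False by simp
      qed
      ultimately show ?thesis
        using z M False by (simp add: s_def h_def)
    qed
  qed
  have "(\<lambda>k. LINT x|lebesgue. s k x) \<longlonglongrightarrow> (LINT x|lebesgue. grad f x \<bullet> e)"
  proof (rule integral_dominated_convergence)
    show "(\<lambda>x. grad f x \<bullet> e) \<in> borel_measurable lebesgue"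
      by (intro borel_measurable_lebesgue_continuous continuous_intros cg)
    show "s k \<in> borel_measurable lebesgue" for k
      unfolding s_def
      by (intro borel_measurable_lebesgue_continuous continuous_on_mult continuous_on_diff continuous_on_const cf cft)
    have "integrable lebesgue (indicator (cball 0 (R + norm e)) :: _ \<Rightarrow> real)"
      by (simp add: integrable_indicator_iff emeasure_lborel_cball_finite[simplified])
    then show "integrable lebesgue (\<lambda>x. indicator (cball 0 (R + norm e)) x * (M * norm e))"
      by (rule integrable_mult_left)
    show "AE x in lebesgue. (\<lambda>k. s k x) \<longlonglongrightarrow> grad f x \<bullet> e"
    proof (rule AE_I2)
      fix x
      have "((\<lambda>t. f (x + t *\<^sub>R e)) has_real_derivative grad f x \<bullet> e) (at 0)"
        using C1_on_directional_DERIV[OF f, of x e 0] by simp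
      then have "((\<lambda>h. (f (x + (0 + h) *\<^sub>R e) - f (x + 0 *\<^sub>R e)) / h) \<longlongrightarrow> grad f x \<bullet> e) (at 0)"
        unfolding DERIV_def .
      moreover have "filterlim (\<lambda>k. 1 / real (Suc k)) (at 0) sequentially"
        unfolding filterlim_at using LIMSEQ_Suc[OF lim_inverse_n'] by auto
      ultimately have "(\<lambda>k. (f (x + (0 + 1 / real (Suc k)) *\<^sub>R e) - f (x + 0 *\<^sub>R e)) / (1 / real (Suc k)))
          \<longlonglongrightarrow> grad f x \<bullet> e"
        by (rule filterlim_compose)
      then show "(\<lambda>k. s k x) \<longlonglongrightarrow> grad f x \<bullet> e"
        unfolding s_def by (simp add: mult.commute del: of_nat_Suc)
    qed
    show "AE x in lebesgue. norm (s k x) \<le> indicator (cball 0 (R + norm e)) x * (M * norm e)" for k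
      using sb by simp
  qed
  moreover have "(LINT x|lebesgue. s k x) = 0" for k
  proof -
    have "(LINT x|lebesgue. f (x + (1 / real (Suc k)) *\<^sub>R e) - f x) = 0"
    proof -
      have i: "integrable lebesgue f"
        by (rule integrable_continuous_compact_support[OF cf S z])
      have "integrable lebesgue (\<lambda>x. f (x + (1 / real (Suc k)) *\<^sub>R e))"
      proof (rule integrable_continuous_compact_support)
        show "continuous_on UNIV (\<lambda>x. f (x + (1 / real (Suc k)) *\<^sub>R e))"
          by (rule cft)
        show "compact ((\<lambda>y. y - (1 / real (Suc k)) *\<^sub>R e) ` S)"
          using S by (intro compact_continuous_image continuous_intros)
        show "f (x + (1 / real (Suc k)) *\<^sub>R e) = 0"
          if "x \<notin> (\<lambda>y. y - (1 / real (Suc k)) *\<^sub>R e) ` S" for x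
        proof (rule z)
          show "x + (1 / real (Suc k)) *\<^sub>R e \<notin> S"
            using that by (metis add_diff_cancel_right' imageI)
        qed
      qed
      then show ?thesis
        using i lebesgue_integral_translation[OF cf] by simp
    qed
    then show ?thesis
      unfolding s_def by (simp del: of_nat_Suc)
  qed
  ultimately show ?thesis
    by (simp add: LIMSEQ_const_iff)
qed

section \<open>C1 cut-off functions with compact support\<close>

lemma C1_on_prod:
  assumes "finite F" "\<And>p. p \<in> F \<Longrightarrow> C1_on V (f p)"
  shows "C1_on V (\<lambda>x. \<Prod>p\<in>F. f p x)"
  using assms by (induction F) (auto intro!: C1_on_mult)

lemma test_functionI:
  assumes "C1_on UNIV \<psi>" "compact S" "S \<subseteq> \<Omega>" "\<And>x. x \<notin> S \<Longrightarrow> \<psi> x = 0"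
  shows "test_function \<Omega> \<psi>"
proof -
  have "closure {x. \<psi> x \<noteq> 0} \<subseteq> S"
    using assms by (intro closure_minimal) (auto simp: compact_imp_closed)
  then show ?thesis
    using compact_Int_closed[OF assms(2) closed_closure[of "{x. \<psi> x \<noteq> 0}"]] assms(1,3)
    unfolding test_function_def Ck_on_1_iff by (simp add: Int_absorb1)
qed

text \<open>One minus the product of all \<open>1 - bump\<close> is 1 as soon as a single bump is 1,
  and 0 where all of them vanish. Unlike a sum of bumps it stays in [0, 1] without
  normalisation.\<close>

lemma C1_urysohn:
  fixes C U :: "(real^'n) set"
  assumes "compact C" "open U" "C \<subseteq> U"
  obtains \<psi> S where "C1_on UNIV \<psi>" "compact S" "S \<subseteq> U" "\<And>x. x \<notin> S \<Longrightarrow> \<psi> x = 0"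
    "\<And>x. x \<in> C \<Longrightarrow> \<psi> x = 1" "\<And>x. 0 \<le> \<psi> x" "\<And>x. \<psi> x \<le> 1"
proof -
  have "\<exists>r>0. cball p (2 * r) \<subseteq> U" if p: "p \<in> C" for p
  proof -
    obtain e where "e > 0" "cball p e \<subseteq> U"
      using assms p open_contains_cball by blast
    then show ?thesis
      by (intro exI[of _ "e / 2"]) auto
  qed
  then obtain r where r: "\<And>p. p \<in> C \<Longrightarrow> r p > 0 \<and> cball p (2 * r p) \<subseteq> U"
    by metis
  have "C \<subseteq> (\<Union>p\<in>C. ball p (r p))"
    using r by fastforce
  then obtain F where F: "F \<subseteq> C" "finite F" "C \<subseteq> (\<Union>p\<in>F. ball p (r p))"
    using compactE_image[OF \<open>compact C\<close>, of C "\<lambda>p. ball p (r p)"] by auto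
  define \<psi> where "\<psi> x = 1 - (\<Prod>p\<in>F. 1 - bump p (r p) x)" for x
  have b: "0 \<le> 1 - bump p s x" "1 - bump p s x \<le> 1" for p s and x :: "real^'n"
    using step_le_1 step_nonneg by (auto simp: bump_def)
  show ?thesis
  proof
    show "C1_on UNIV \<psi>"
      unfolding \<psi>_def by (intro C1_on_diff C1_on_const C1_on_prod C1_on_bump F)
    show "compact (\<Union>p\<in>F. cball p (2 * r p))"
      using F by (intro compact_UN) auto
    show "(\<Union>p\<in>F. cball p (2 * r p)) \<subseteq> U"
      using F r by blast
    show "\<psi> x = 0" if "x \<notin> (\<Union>p\<in>F. cball p (2 * r p))" for x
    proof -
      have "bump p (r p) x = 0" if "p \<in> F" for p
        using bump_eq_0[of "r p" x p] r F that \<open>x \<notin> _\<close> by blast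
      then show ?thesis
        by (simp add: \<psi>_def)
    qed
    show "\<psi> x = 1" if x: "x \<in> C" for x
    proof -
      obtain p where "p \<in> F" "x \<in> ball p (r p)"
        using F(3) x by blast
      then have "bump p (r p) x = 1"
        using r F by (intro bump_eq_1) auto
      then have "(\<Prod>p\<in>F. 1 - bump p (r p) x) = 0"
        using F \<open>p \<in> F\<close> by (intro prod_zero) auto
      then show ?thesis
        by (simp add: \<psi>_def)
    qed
    show "0 \<le> \<psi> x" for x
      using b prod_le_1[of F "\<lambda>p. 1 - bump p (r p) x"] by (simp add: \<psi>_def)
    show "\<psi> x \<le> 1" for x
      using b prod_nonneg[of F "\<lambda>p. 1 - bump p (r p) x"] by (simp add: \<psi>_def)
  qed
qed

text \<open>Integrability of \<open>h\<close> is available on compact sets only, so the product is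
  cut to \<open>S\<close>, where \<open>\<psi>\<close> is bounded. The second form keeps
  \<open>S\<close> fixed, so that a sequence of functions \<open>\<psi>\<close> supported in a
  common \<open>S\<close> shares one majorant.\<close>

lemma integrable_on_compact_support:
  fixes h :: "real^'n \<Rightarrow> real"
  assumes "locally_integrable \<Omega> h" "open \<Omega>" "compact S" "S \<subseteq> \<Omega>" and c: "continuous_on UNIV \<psi>"
    and z: "\<And>x. x \<notin> S \<Longrightarrow> \<psi> x = 0"
  shows "integrable (lebesgue_on \<Omega>) (\<lambda>x. h x * \<psi> x)"
    and "(LINT x|lebesgue_on \<Omega>. h x * \<psi> x) = (LINT x|lebesgue. (indicator S x * h x) * \<psi> x)"
proof -
  have i: "integrable lebesgue (\<lambda>x. indicator S x * h x)"
    using assms(1,3,4) by (auto simp: locally_integrable_def set_integrable_def)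
  have "bounded (\<psi> ` S)"
    using assms c by (intro compact_imp_bounded compact_continuous_image) (auto intro: continuous_on_subset)
  then obtain M where "M > 0" and "\<forall>y\<in>\<psi> ` S. norm y \<le> M"
    unfolding bounded_pos by blast
  then have M: "\<bar>indicator S x * h x * \<psi> x\<bar> \<le> \<bar>M * (indicator S x * h x)\<bar>" for x
    by (cases "x \<in> S") (auto simp: abs_mult mult.commute[of M] intro!: mult_left_mono)
  have "integrable lebesgue (\<lambda>x. (indicator S x * h x) * \<psi> x)"
  proof (rule Bochner_Integration.integrable_bound)
    show "integrable lebesgue (\<lambda>x. M * (indicator S x * h x))"
      using i by (rule integrable_mult_right)
    show "(\<lambda>x. (indicator S x * h x) * \<psi> x) \<in> borel_measurable lebesgue"
      by (intro borel_measurable_times borel_measurable_integrable[OF i] borel_measurable_lebesgue_continuous c)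
    show "AE x in lebesgue. norm (indicator S x * h x * \<psi> x) \<le> norm (M * (indicator S x * h x))"
      using M by simp
  qed
  moreover have "(\<lambda>x. indicator \<Omega> x *\<^sub>R (h x * \<psi> x)) = (\<lambda>x. (indicator S x * h x) * \<psi> x)"
    using z assms(4) by (force simp: indicator_def)
  ultimately show "integrable (lebesgue_on \<Omega>) (\<lambda>x. h x * \<psi> x)"
    and "(LINT x|lebesgue_on \<Omega>. h x * \<psi> x) = (LINT x|lebesgue. (indicator S x * h x) * \<psi> x)"
    using \<open>open \<Omega>\<close> by (simp_all add: integrable_restrict_space integral_restrict_space)
qed

text \<open>Cut-offs that are 1 on \<open>C\<close> and supported in shrinking neighbourhoods of it
  converge to the indicator of \<open>C\<close>, and the products with \<open>h\<close> are
  dominated on one fixed compact set.\<close>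

lemma test_function_integral_eq_0_imp_compact_integral_eq_0:
  fixes h :: "real^'n \<Rightarrow> real"
  assumes "open \<Omega>" "locally_integrable \<Omega> h" and C: "compact C" "C \<subseteq> \<Omega>"
    and 0: "\<And>\<psi>. test_function \<Omega> \<psi> \<Longrightarrow> (LINT x|lebesgue_on \<Omega>. h x * \<psi> x) = 0"
  shows "(LINT x|lebesgue. indicator C x * h x) = 0"
proof (cases "C = {}")
  \<comment> \<open>The empty set is treated apart: \<open>infdist\<close> to it is 0 by convention,
    so the neighbourhoods \<open>U k\<close> would not shrink to it.\<close>
  case False
  \<comment> \<open>This first cut-off only supplies a compact set \<open>S0\<close> in which all
    later supports lie.\<close>
  obtain \<psi>0 S0 where S0: "C1_on UNIV \<psi>0" "compact S0" "S0 \<subseteq> \<Omega>" "\<And>x. x \<notin> S0 \<Longrightarrow> \<psi>0 x = 0"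
    "\<And>x. x \<in> C \<Longrightarrow> \<psi>0 x = (1::real)"
    using C1_urysohn[OF C(1) \<open>open \<Omega>\<close> C(2)] by metis
  define U where "U k = {x. \<psi>0 x > 0} \<inter> {x. infdist x C < 1 / real (Suc k)}" for k
  have U: "open (U k)" "C \<subseteq> U k" "U k \<subseteq> S0" for k
  proof -
    show "open (U k)"
      unfolding U_def
      by (intro open_Int open_Collect_less continuous_intros C1_on_continuous S0)
    show "C \<subseteq> U k"
      using S0(5) by (auto simp: U_def)
    show "U k \<subseteq> S0"
      using S0(4) by (force simp: U_def)
  qed
  have "\<exists>\<psi> S. C1_on UNIV \<psi> \<and> compact S \<and> S \<subseteq> U k \<and> (\<forall>x. x \<notin> S \<longrightarrow> \<psi> x = 0) \<and>
      (\<forall>x\<in>C. \<psi> x = 1) \<and> (\<forall>x. 0 \<le> \<psi> x) \<and> (\<forall>x. \<psi> x \<le> 1)" for k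
    by (rule C1_urysohn[OF C(1) U(1,2)[of k]]) blast
  then obtain \<psi> S where \<psi>: "\<And>k. C1_on UNIV (\<psi> k)" "\<And>k. compact (S k)" "\<And>k. S k \<subseteq> U k"
    "\<And>k x. x \<notin> S k \<Longrightarrow> \<psi> k x = 0" "\<And>k x. x \<in> C \<Longrightarrow> \<psi> k x = (1::real)" "\<And>k x. 0 \<le> \<psi> k x" "\<And>k x. \<psi> k x \<le> 1"
    by metis
  have S0z: "\<psi> k x = 0" if "x \<notin> S0" for k x
    using \<psi> U that by blast
  have i0: "integrable lebesgue (\<lambda>x. indicator S0 x * h x)"
    using assms(2) S0 by (auto simp: locally_integrable_def set_integrable_def)
  have e: "(LINT x|lebesgue. (indicator S0 x * h x) * \<psi> k x) = 0" for k
  proof -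
    have "test_function \<Omega> (\<psi> k)"
      by (rule test_functionI[OF \<psi>(1) S0(2,3) S0z])
    then show ?thesis
      using 0 integrable_on_compact_support(2)[OF assms(2,1) S0(2,3) C1_on_continuous(1)[OF \<psi>(1)] S0z, of k]
      by simp
  qed
  have "(\<lambda>k. LINT x|lebesgue. (indicator S0 x * h x) * \<psi> k x) \<longlonglongrightarrow> (LINT x|lebesgue. indicator C x * h x)"
  proof (rule integral_dominated_convergence[where w = "\<lambda>x. \<bar>indicator S0 x * h x\<bar>"])
    show "(\<lambda>x. indicator C x * h x) \<in> borel_measurable lebesgue"
      using assms(2) C by (auto simp: locally_integrable_def set_integrable_def)
    show "(\<lambda>x. (indicator S0 x * h x) * \<psi> k x) \<in> borel_measurable lebesgue" for k
      by (intro borel_measurable_times borel_measurable_integrable[OF i0]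
          borel_measurable_lebesgue_continuous C1_on_continuous \<psi>)
    show "integrable lebesgue (\<lambda>x. \<bar>indicator S0 x * h x\<bar>)"
      using i0 by (rule integrable_abs)
    show "AE x in lebesgue. norm (indicator S0 x * h x * \<psi> k x) \<le> \<bar>indicator S0 x * h x\<bar>" for k
      using \<psi>(6,7) by (auto simp: abs_mult mult_left_le)
    show "AE x in lebesgue. (\<lambda>k. indicator S0 x * h x * \<psi> k x) \<longlonglongrightarrow> indicator C x * h x"
    proof (rule AE_I2)
      fix x
      show "(\<lambda>k. indicator S0 x * h x * \<psi> k x) \<longlonglongrightarrow> indicator C x * h x"
      proof (cases "x \<in> C")
        case True
        then have "x \<in> S0" using U by blast
        with True show ?thesis using \<psi>(5) by simp
      next
        case False
        then have "infdist x C > 0"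
          using C \<open>C \<noteq> {}\<close> by (metis compact_imp_closed in_closed_iff_infdist_zero infdist_nonneg less_eq_real_def)
        then obtain N where N: "1 / real (Suc N) < infdist x C"
          using nat_approx_posE by blast
        have "\<psi> k x = 0" if "k \<ge> N" for k
        proof -
          have "1 / real (Suc k) \<le> 1 / real (Suc N)"
            using that by (intro divide_left_mono) auto
          then have "x \<notin> U k"
            using N by (auto simp: U_def)
          then show ?thesis
            using \<psi> by blast
        qed
        then have "\<forall>\<^sub>F k in sequentially. indicator C x * h x = indicator S0 x * h x * \<psi> k x"
          unfolding eventually_sequentially using False by (intro exI[of _ N]) auto
        then show ?thesis
          by (rule tendsto_eventually[OF eventually_mono]) auto
      qed
    qed
  qed
  then show ?thesis
    unfolding e by (simp add: LIMSEQ_const_iff)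
qed simp

text \<open>Up to a null set, the set where \<open>h\<close> is positive on \<open>K\<close> is a
  countable union of closed sets. Each of them is compact inside \<open>K\<close>, so a positive
  integrand has integral 0 on it, and it is null.\<close>

lemma compact_integral_eq_0_imp_pos_null:
  fixes h :: "real^'n \<Rightarrow> real"
  assumes "compact K" and i: "integrable lebesgue (\<lambda>x. indicator K x * h x)"
    and 0: "\<And>C. compact C \<Longrightarrow> C \<subseteq> K \<Longrightarrow> (LINT x|lebesgue. indicator C x * h x) = 0"
  shows "AE x in lebesgue. x \<in> K \<longrightarrow> h x \<le> 0"
proof -
  define A where "A = {x \<in> space lebesgue. indicator K x * h x > 0}"
  have "A \<in> sets lebesgue"
    using i unfolding A_def by measurable
  then obtain C T where CT: "fsigma C" "T \<in> null_sets lebesgue" "C \<union> T = A"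
    by (rule lebesgue_set_almost_fsigma)
  from CT(1) obtain F :: "nat \<Rightarrow> _" where F: "\<And>n. closed (F n)" "C = (\<Union>n. F n)"
    by (auto simp: fsigma.simps)
  have "F n \<in> null_sets lebesgue" for n
  proof -
    have sub: "F n \<subseteq> A"
      using F CT by blast
    have K: "F n \<subseteq> K"
    proof
      fix x assume "x \<in> F n"
      with sub have "0 < indicator K x * h x"
        unfolding A_def by blast
      then show "x \<in> K"
        by (cases "x \<in> K") simp_all
    qed
    have c: "compact (F n)"
      using compact_Int_closed[OF \<open>compact K\<close> F(1)[of n]] K by (simp add: Int_absorb1)
    show ?thesis
    proof (rule null_if_pos_func_has_zero_int[OF i])
      show "F n \<in> sets lebesgue"
        using F(1) by (simp add: borel_closed sets_completionI_sets)
      show "AE x\<in>F n in lebesgue. 0 < indicator K x * h x"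
        using sub by (auto simp: A_def)
      have "indicator (F n) x *\<^sub>R (indicator K x * h x) = indicator (F n) x * h x" for x
        using K by (auto simp: indicator_def)
      then have "(\<lambda>x. indicator (F n) x *\<^sub>R (indicator K x * h x)) = (\<lambda>x. indicator (F n) x * h x)" ..
      then show "set_lebesgue_integral lebesgue (F n) (\<lambda>x. indicator K x * h x) = 0"
        using 0[OF c K] unfolding set_lebesgue_integral_def by (simp only:)
    qed
  qed
  then have "A \<in> null_sets lebesgue"
    using CT F by (metis null_sets.Un null_sets_UN)
  then have "AE x in lebesgue. x \<notin> A"
    by (rule AE_not_in)
  then show ?thesis
    by eventually_elim (auto simp: A_def indicator_def not_less)
qed

text \<open>The fundamental lemma of the calculus of variations. On a compact set the sign argument
  is applied to \<open>h\<close> and to \<open>- h\<close>; countably many closed boxes exhaust the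
  open set.\<close>

lemma test_function_integral_eq_0_imp_AE_eq_0:
  fixes h :: "real^'n \<Rightarrow> real"
  assumes \<Omega>: "open \<Omega>" and h: "locally_integrable \<Omega> h"
    and 0: "\<And>\<psi>. test_function \<Omega> \<psi> \<Longrightarrow> (LINT x|lebesgue_on \<Omega>. h x * \<psi> x) = 0"
  shows "AE x in lebesgue_on \<Omega>. h x = 0"
proof -
  have K: "AE x in lebesgue. x \<in> K \<longrightarrow> h x = 0" if "compact K" "K \<subseteq> \<Omega>" for K
  proof -
    have C: "(LINT x|lebesgue. indicator C x * h x) = 0" if "compact C" "C \<subseteq> K" for C
      using test_function_integral_eq_0_imp_compact_integral_eq_0[OF \<Omega> h that(1) _ 0] that \<open>K \<subseteq> \<Omega>\<close> by blast
    have i: "integrable lebesgue (\<lambda>x. indicator K x * h x)"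
      using h that by (auto simp: locally_integrable_def set_integrable_def)
    have "AE x in lebesgue. x \<in> K \<longrightarrow> h x \<le> 0"
      by (rule compact_integral_eq_0_imp_pos_null[OF \<open>compact K\<close> i C])
    moreover have "AE x in lebesgue. x \<in> K \<longrightarrow> - h x \<le> 0"
      by (rule compact_integral_eq_0_imp_pos_null[OF \<open>compact K\<close>]) (use i C in simp_all)
    ultimately show ?thesis
      by eventually_elim auto
  qed
  obtain \<D> where D: "countable \<D>" "\<D> \<subseteq> Pow \<Omega>" "\<And>X. X \<in> \<D> \<Longrightarrow> \<exists>a b. X = cbox a b" "\<Union>\<D> = \<Omega>"
    using open_countable_Union_open_cbox[OF \<Omega>] by metis
  have "AE x in lebesgue. \<forall>X\<in>\<D>. x \<in> X \<longrightarrow> h x = 0"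
    using D K by (subst AE_ball_countable) (auto, metis PowD compact_cbox subsetD)
  then have "AE x in lebesgue. x \<in> \<Omega> \<longrightarrow> h x = 0"
    by eventually_elim (use D(4) in blast)
  then show ?thesis
    using \<Omega> by (subst AE_restrict_space_iff) auto
qed

lemma is_weak_div_unique:
  assumes \<Omega>: "open \<Omega>" and g: "is_weak_div \<Omega> G g" and g': "is_weak_div \<Omega> G g'"
  shows "AE x in lebesgue_on \<Omega>. g x = g' x"
proof -
  have l: "locally_integrable \<Omega> g" "locally_integrable \<Omega> g'"
    using g g' by (auto simp: is_weak_div_def)
  then have l': "locally_integrable \<Omega> (\<lambda>x. g x - g' x)"
    unfolding locally_integrable_def by (intro allI impI set_integral_diff) auto
  have "AE x in lebesgue_on \<Omega>. g x - g' x = 0"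
  proof (rule test_function_integral_eq_0_imp_AE_eq_0[OF \<Omega> l'])
    fix \<psi> assume t: "test_function \<Omega> \<psi>"
    then have *: "compact (closure {x. \<psi> x \<noteq> 0})" "closure {x. \<psi> x \<noteq> 0} \<subseteq> \<Omega>" "continuous_on UNIV \<psi>"
      unfolding test_function_def Ck_on_1_iff by (auto intro: C1_on_continuous)
    have "\<psi> x = 0" if "x \<notin> closure {x. \<psi> x \<noteq> 0}" for x
      using that closure_subset[of "{x. \<psi> x \<noteq> 0}"] by auto
    note i = integrable_on_compact_support(1)[OF _ \<Omega> * this]
    have "(LINT x|lebesgue_on \<Omega>. (g x - g' x) * \<psi> x)
        = (LINT x|lebesgue_on \<Omega>. g x * \<psi> x) - (LINT x|lebesgue_on \<Omega>. g' x * \<psi> x)"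
      using i[OF l(1)] i[OF l(2)] by (simp add: left_diff_distrib)
    also have "\<dots> = 0"
    proof -
      have "(LINT x|lebesgue_on \<Omega>. G x \<bullet> grad \<psi> x) = - (LINT x|lebesgue_on \<Omega>. g x * \<psi> x)"
        "(LINT x|lebesgue_on \<Omega>. G x \<bullet> grad \<psi> x) = - (LINT x|lebesgue_on \<Omega>. g' x * \<psi> x)"
        using g g' t unfolding is_weak_div_def by blast+
      then show ?thesis
        by linarith
    qed
    finally show "(LINT x|lebesgue_on \<Omega>. (g x - g' x) * \<psi> x) = 0" .
  qed
  then show ?thesis
    by simp
qed

text \<open>Whatever \<open>SOME\<close> picks is itself a weak divergence, so it can be exchanged
  for any better representative, in particular for the square-integrable one in
  \<open>regular\<close>.\<close>

lemma weak_div_AE_eq: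
  assumes "open \<Omega>" "is_weak_div \<Omega> G g"
  shows "AE x in lebesgue_on \<Omega>. weak_div \<Omega> G x = g x"
  using is_weak_div_unique[OF assms(1) someI[of "is_weak_div \<Omega> G", OF assms(2)] assms(2)]
  unfolding weak_div_def .

section \<open>The defect in the divergence theorem\<close>

text \<open>The setting shared by both kinds of boundary conditions. In the application
  \<open>G\<close> is a gradient and \<open>g\<close> is the square-integrable representative of its
  divergence, not the chosen \<open>laplacian\<close>.\<close>

locale divergence_field =
  fixes \<Omega> :: "(real^'n) set" and G :: "real^'n \<Rightarrow> real^'n" and g :: "real^'n \<Rightarrow> real"
  assumes open_domain: "open \<Omega>" and bounded_domain: "bounded \<Omega>"
    and continuous_field: "continuous_on (closure \<Omega>) G"
    and weak_divergence: "is_weak_div \<Omega> G g"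
    and integrable_divergence: "integrable (lebesgue_on \<Omega>) g"
begin

text \<open>For smooth data this is the integral of div (v G), that is, the flux of v G through the
  boundary. As an integral over the domain it makes sense without any surface measure.\<close>

definition defect :: "(real^'n \<Rightarrow> real) \<Rightarrow> real" where
  "defect v = (LINT x|lebesgue_on \<Omega>. G x \<bullet> grad v x + g x * v x)"

lemma domain_sets: "\<Omega> \<in> sets lebesgue"
  using open_domain by (simp add: borel_open sets_completionI_sets)

lemma compact_closure_domain: "compact (closure \<Omega>)"
  using bounded_domain by (simp add: compact_closure)

lemma continuous_measurable:
  fixes f :: "real^'n \<Rightarrow> 'b::euclidean_space"
  assumes "continuous_on (closure \<Omega>) f"
  shows "f \<in> borel_measurable (lebesgue_on \<Omega>)"
  using assms domain_sets closure_subset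
  by (intro continuous_imp_measurable_on_sets_lebesgue) (auto intro: continuous_on_subset)

lemma continuous_bounded:
  fixes f :: "real^'n \<Rightarrow> 'b::euclidean_space"
  assumes "continuous_on (closure \<Omega>) f"
  obtains M where "M > 0" "\<And>x. x \<in> \<Omega> \<Longrightarrow> norm (f x) \<le> M"
proof -
  have "bounded (f ` closure \<Omega>)"
    using assms compact_closure_domain by (intro compact_imp_bounded compact_continuous_image)
  then obtain M where "M > 0" "\<forall>y\<in>f ` closure \<Omega>. norm y \<le> M"
    unfolding bounded_pos by blast
  then show ?thesis
    using that closure_subset[of \<Omega>] by blast
qed

lemma finite_measure_domain: "finite_measure (lebesgue_on \<Omega>)"
proof
  show "emeasure (lebesgue_on \<Omega>) (space (lebesgue_on \<Omega>)) \<noteq> \<infinity>"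
    using fmeasurableD2[OF lmeasurable_open[OF bounded_domain open_domain]] domain_sets
    by (simp add: emeasure_restrict_space)
qed

lemma integrable_mult_continuous:
  assumes f: "continuous_on (closure \<Omega>) f" and h: "integrable (lebesgue_on \<Omega>) h"
  shows "integrable (lebesgue_on \<Omega>) (\<lambda>x. h x * f x :: real)"
proof -
  obtain M where M: "M > 0" "\<And>x. x \<in> \<Omega> \<Longrightarrow> norm (f x) \<le> M"
    using continuous_bounded[OF f] by blast
  show ?thesis
  proof (rule Bochner_Integration.integrable_bound)
    show "integrable (lebesgue_on \<Omega>) (\<lambda>x. M * h x)"
      using h by (rule integrable_mult_right)
    show "(\<lambda>x. h x * f x) \<in> borel_measurable (lebesgue_on \<Omega>)"
      by (intro borel_measurable_times continuous_measurable f borel_measurable_integrable h)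
    show "AE x in lebesgue_on \<Omega>. norm (h x * f x) \<le> norm (M * h x)"
    proof (rule AE_I2)
      fix x assume "x \<in> space (lebesgue_on \<Omega>)"
      then have "\<bar>f x\<bar> \<le> M"
        using M by simp
      then have "\<bar>f x\<bar> * \<bar>h x\<bar> \<le> M * \<bar>h x\<bar>"
        by (rule mult_right_mono) simp
      then show "norm (h x * f x) \<le> norm (M * h x)"
        using M(1) by (simp add: abs_mult mult.commute)
    qed
  qed
qed

lemma integrable_continuous:
  assumes "continuous_on (closure \<Omega>) f"
  shows "integrable (lebesgue_on \<Omega>) (f :: _ \<Rightarrow> real)"
proof -
  interpret finite_measure "lebesgue_on \<Omega>"
    by (rule finite_measure_domain)
  show ?thesis
    using integrable_mult_continuous[OF assms, of "\<lambda>_. 1"] by simp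
qed

lemma integrable_defect:
  assumes "continuous_on (closure \<Omega>) v" "continuous_on (closure \<Omega>) (grad v)"
  shows "integrable (lebesgue_on \<Omega>) (\<lambda>x. G x \<bullet> grad v x)"
    and "integrable (lebesgue_on \<Omega>) (\<lambda>x. g x * v x)"
    and "integrable (lebesgue_on \<Omega>) (\<lambda>x. G x \<bullet> grad v x + g x * v x)"
proof -
  show 1: "integrable (lebesgue_on \<Omega>) (\<lambda>x. G x \<bullet> grad v x)"
    by (intro integrable_continuous continuous_on_inner continuous_field assms)
  show 2: "integrable (lebesgue_on \<Omega>) (\<lambda>x. g x * v x)"
    by (intro integrable_mult_continuous assms integrable_divergence)
  show "integrable (lebesgue_on \<Omega>) (\<lambda>x. G x \<bullet> grad v x + g x * v x)"
    using 1 2 by (rule Bochner_Integration.integrable_add)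
qed

lemma C1_on_continuous_closure:
  assumes "C1_on W v" "closure \<Omega> \<subseteq> W"
  shows "continuous_on (closure \<Omega>) v" and "continuous_on (closure \<Omega>) (grad v)"
  using C1_on_continuous[OF assms(1)] assms(2) by (auto intro: continuous_on_subset)

lemma defect_add:
  assumes "C1_on W v" "C1_on W w" "closure \<Omega> \<subseteq> W"
  shows "defect (\<lambda>x. v x + w x) = defect v + defect w"
proof -
  note cv = C1_on_continuous_closure[OF assms(1,3)] and cw = C1_on_continuous_closure[OF assms(2,3)]
  have "defect (\<lambda>x. v x + w x)
      = (LINT x|lebesgue_on \<Omega>. (G x \<bullet> grad v x + g x * v x) + (G x \<bullet> grad w x + g x * w x))"
    unfolding defect_def
  proof (rule Bochner_Integration.integral_cong)
    fix x assume "x \<in> space (lebesgue_on \<Omega>)"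
    then have "x \<in> W"
      using assms(3) closure_subset[of \<Omega>] by auto
    then show "G x \<bullet> grad (\<lambda>x. v x + w x) x + g x * (v x + w x)
        = (G x \<bullet> grad v x + g x * v x) + (G x \<bullet> grad w x + g x * w x)"
      by (simp add: grad_add[OF assms(1,2)] inner_add_right distrib_left)
  qed simp
  also have "\<dots> = defect v + defect w"
    unfolding defect_def
    by (rule Bochner_Integration.integral_add[OF integrable_defect(3)[OF cv] integrable_defect(3)[OF cw]])
  finally show ?thesis .
qed

lemma defect_test_function:
  assumes "test_function \<Omega> \<eta>"
  shows "defect \<eta> = 0"
proof -
  have "C1_on UNIV \<eta>"
    using assms by (simp add: test_function_def Ck_on_1_iff del: One_nat_def)
  then have c: "continuous_on (closure \<Omega>) \<eta>" "continuous_on (closure \<Omega>) (grad \<eta>)"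
    by (rule C1_on_continuous_closure; simp)+
  have "defect \<eta> = (LINT x|lebesgue_on \<Omega>. G x \<bullet> grad \<eta> x) + (LINT x|lebesgue_on \<Omega>. g x * \<eta> x)"
    unfolding defect_def
    by (rule Bochner_Integration.integral_add[OF integrable_defect(1)[OF c] integrable_defect(2)[OF c]])
  moreover have "(LINT x|lebesgue_on \<Omega>. G x \<bullet> grad \<eta> x) = - (LINT x|lebesgue_on \<Omega>. g x * \<eta> x)"
    using weak_divergence assms unfolding is_weak_div_def by blast
  ultimately show ?thesis
    by linarith
qed

text \<open>\<open>R k\<close> is the boundary layer term \<open>v\<nabla>\<psi>\<^sub>k\<close> of the cut-off function \<open>\<eta>\<^sub>k = \<psi>\<^sub>k v\<close>.\<close>

lemma defect_eq_0_if_boundary_layer_vanishes: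
  assumes v: "continuous_on (closure \<Omega>) v" "continuous_on (closure \<Omega>) (grad v)"
    and \<eta>: "\<And>k. test_function \<Omega> (\<eta> k)" "\<And>k x. x \<in> \<Omega> \<Longrightarrow> \<eta> k x = \<psi> k x * v x"
    and grad: "\<And>k x. x \<in> \<Omega> \<Longrightarrow> grad (\<eta> k) x = \<psi> k x *\<^sub>R grad v x + R k x"
    and \<psi>: "\<And>k x. x \<in> \<Omega> \<Longrightarrow> 0 \<le> \<psi> k x" "\<And>k x. x \<in> \<Omega> \<Longrightarrow> \<psi> k x \<le> 1"
    and conv: "\<And>x. x \<in> \<Omega> \<Longrightarrow> v x = 0 \<and> grad v x = 0 \<or> (\<lambda>k. \<psi> k x) \<longlonglongrightarrow> 1"
    and R: "\<And>k. integrable (lebesgue_on \<Omega>) (\<lambda>x. G x \<bullet> R k x)"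
      "(\<lambda>k. LINT x|lebesgue_on \<Omega>. G x \<bullet> R k x) \<longlonglongrightarrow> 0"
  shows "defect v = 0"
proof -
  define I where "I x = G x \<bullet> grad v x + g x * v x" for x
  have I: "integrable (lebesgue_on \<Omega>) I"
    unfolding I_def by (rule integrable_defect(3)[OF v])
  have eq: "G x \<bullet> grad (\<eta> k) x + g x * \<eta> k x = \<psi> k x * I x + G x \<bullet> R k x" if "x \<in> \<Omega>" for k x
    using that by (simp add: \<eta> grad I_def inner_add_right algebra_simps)
  have c: "continuous_on (closure \<Omega>) (\<eta> k)" "continuous_on (closure \<Omega>) (grad (\<eta> k))" for k
  proof -
    have "C1_on UNIV (\<eta> k)"
      using \<eta>(1)[of k] by (simp add: test_function_def Ck_on_1_iff del: One_nat_def)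
    then show "continuous_on (closure \<Omega>) (\<eta> k)" "continuous_on (closure \<Omega>) (grad (\<eta> k))"
      by (rule C1_on_continuous_closure; simp)+
  qed
  \<comment> \<open>The cut-offs \<open>\<psi> k\<close> carry no measurability assumption, so
    integrability of the product is recovered from the integrands for \<open>\<eta> k\<close> and
    \<open>R k\<close>.\<close>
  have i: "integrable (lebesgue_on \<Omega>) (\<lambda>x. \<psi> k x * I x)" for k
  proof -
    have "integrable (lebesgue_on \<Omega>) (\<lambda>x. (G x \<bullet> grad (\<eta> k) x + g x * \<eta> k x) - G x \<bullet> R k x)"
      by (rule Bochner_Integration.integrable_diff[OF integrable_defect(3)[OF c] R(1)])
    then show ?thesis
      by (rule Bochner_Integration.integrable_cong[THEN iffD1, rotated 2]) (simp_all add: eq)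
  qed
  have "(LINT x|lebesgue_on \<Omega>. \<psi> k x * I x) = - (LINT x|lebesgue_on \<Omega>. G x \<bullet> R k x)" for k
  proof -
    have "0 = defect (\<eta> k)"
      using defect_test_function[OF \<eta>(1)] by simp
    also have "\<dots> = (LINT x|lebesgue_on \<Omega>. \<psi> k x * I x + G x \<bullet> R k x)"
      unfolding defect_def by (rule Bochner_Integration.integral_cong) (simp_all add: eq)
    also have "\<dots> = (LINT x|lebesgue_on \<Omega>. \<psi> k x * I x) + (LINT x|lebesgue_on \<Omega>. G x \<bullet> R k x)"
      by (rule Bochner_Integration.integral_add[OF i R(1)])
    finally show ?thesis
      by linarith
  qed
  then have 1: "(\<lambda>k. LINT x|lebesgue_on \<Omega>. \<psi> k x * I x) \<longlonglongrightarrow> 0"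
    using tendsto_minus[OF R(2)] by simp
  have "(\<lambda>k. LINT x|lebesgue_on \<Omega>. \<psi> k x * I x) \<longlonglongrightarrow> (LINT x|lebesgue_on \<Omega>. I x)"
  proof (rule integral_dominated_convergence[where w = "\<lambda>x. \<bar>I x\<bar>"])
    show "AE x in lebesgue_on \<Omega>. (\<lambda>k. \<psi> k x * I x) \<longlonglongrightarrow> I x"
    proof (rule AE_I2)
      fix x assume "x \<in> space (lebesgue_on \<Omega>)"
      \<comment> \<open>Outside the support of \<open>v\<close> the cut-offs may fail to converge (a
        chart function means nothing off its chart), but there \<open>v\<close> and its gradient
        vanish, and \<open>I\<close> with them.\<close>
      then have "I x = 0 \<or> (\<lambda>k. \<psi> k x) \<longlonglongrightarrow> 1"
        using conv[of x] by (auto simp: I_def)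
      then show "(\<lambda>k. \<psi> k x * I x) \<longlonglongrightarrow> I x"
        using tendsto_mult_right[of "\<lambda>k. \<psi> k x" 1 sequentially "I x"] by auto
    qed
    show "AE x in lebesgue_on \<Omega>. norm (\<psi> k x * I x) \<le> \<bar>I x\<bar>" for k
      using \<psi>[of _ k] by (intro AE_I2) (simp add: abs_mult mult_left_le_one_le)
  qed (use I i in \<open>auto intro: borel_measurable_integrable\<close>)
  with 1 show ?thesis
    unfolding defect_def I_def by (rule LIMSEQ_unique[rotated])
qed

lemma defect_interior:
  assumes "C1_on UNIV v" "compact C" "C \<subseteq> \<Omega>" "\<And>x. x \<notin> C \<Longrightarrow> v x = 0"
  shows "defect v = 0"
  by (rule defect_test_function[OF test_functionI[OF assms]])

text \<open>The removed part \<open>v x * bump p r x\<close> lives in the ball where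
  \<open>loc\<close> applies, and by zero extension it is C1 everywhere; additivity of
  \<open>defect\<close> does the rest.\<close>

lemma defect_mult_cong:
  assumes v: "C1_on W v" and W: "open W" "closure \<Omega> \<subseteq> W" and p: "r > 0" "cball p (2 * r) \<subseteq> W"
    and loc: "\<And>w. C1_on UNIV w \<Longrightarrow> (\<And>x. x \<notin> cball p (2 * r) \<Longrightarrow> w x = 0) \<Longrightarrow> defect w = 0"
  shows "defect (\<lambda>x. v x * (1 - bump p r x)) = defect v"
proof -
  have z: "v x * bump p r x = 0" if "x \<notin> cball p (2 * r)" for x
    using bump_eq_0[OF p(1) that] by simp
  have "C1_on UNIV (\<lambda>x. v x * bump p r x)"
    by (rule C1_on_zero_extension[OF C1_on_mult[OF v C1_on_bump] W(1) closed_cball p(2) z])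
  then have "defect (\<lambda>x. v x * bump p r x) = 0"
    using z by (rule loc)
  moreover have "defect (\<lambda>x. v x * bump p r x + v x * (1 - bump p r x))
      = defect (\<lambda>x. v x * bump p r x) + defect (\<lambda>x. v x * (1 - bump p r x))"
    by (rule defect_add[OF _ _ W(2)]) (intro C1_on_mult C1_on_diff C1_on_const C1_on_bump v)+
  moreover have "(\<lambda>x. v x * bump p r x + v x * (1 - bump p r x)) = v"
    by (simp add: algebra_simps)
  ultimately show ?thesis
    by simp
qed

text \<open>A partition of unity \<open>1 = b\<^sub>1 + (1 - b\<^sub>1)b\<^sub>2 + (1 - b\<^sub>1)(1 - b\<^sub>2)b\<^sub>3 + \<dots>\<close> without division.\<close>

lemma defect_eq_0_if_local:
  assumes loc: "\<And>p. p \<in> closure \<Omega> \<Longrightarrow>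
      \<exists>r>0. \<forall>w. C1_on UNIV w \<longrightarrow> (\<forall>x. x \<notin> cball p r \<longrightarrow> w x = 0) \<longrightarrow> defect w = 0"
    and v: "C1_on W v" and W: "open W" "closure \<Omega> \<subseteq> W"
  shows "defect v = 0"
proof -
  \<comment> \<open>The radius is halved because a bump of radius \<open>r\<close> reaches out to
    \<open>2 * r\<close>.\<close>
  have "\<exists>r>0. cball p (2 * r) \<subseteq> W \<and>
      (\<forall>w. C1_on UNIV w \<longrightarrow> (\<forall>x. x \<notin> cball p (2 * r) \<longrightarrow> w x = 0) \<longrightarrow> defect w = 0)"
    if p: "p \<in> closure \<Omega>" for p
  proof -
    obtain r1 where r1: "r1 > 0" "\<And>w. C1_on UNIV w \<Longrightarrow> (\<And>x. x \<notin> cball p r1 \<Longrightarrow> w x = 0) \<Longrightarrow> defect w = 0"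
      using loc[OF p] by blast
    obtain r2 where r2: "r2 > 0" "cball p r2 \<subseteq> W"
      using W p unfolding open_contains_cball by blast
    let ?r = "min r1 r2 / 2"
    have sub: "cball p (2 * ?r) \<subseteq> cball p r1" "cball p (2 * ?r) \<subseteq> cball p r2"
      by (auto simp: subset_cball)
    show ?thesis
    proof (intro exI[of _ ?r] conjI allI impI)
      show "?r > 0" using r1 r2 by simp
      show "cball p (2 * ?r) \<subseteq> W" using sub r2 by blast
      fix w assume "C1_on UNIV w" "\<forall>x. x \<notin> cball p (2 * ?r) \<longrightarrow> w x = 0"
      then show "defect w = 0"
        using sub by (intro r1(2)) blast+
    qed
  qed
  then obtain r where r: "\<And>p. p \<in> closure \<Omega> \<Longrightarrow> r p > 0" "\<And>p. p \<in> closure \<Omega> \<Longrightarrow> cball p (2 * r p) \<subseteq> W"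
    "\<And>p w. p \<in> closure \<Omega> \<Longrightarrow> C1_on UNIV w \<Longrightarrow> (\<And>x. x \<notin> cball p (2 * r p) \<Longrightarrow> w x = 0) \<Longrightarrow> defect w = 0"
    by metis
  have "closure \<Omega> \<subseteq> (\<Union>p\<in>closure \<Omega>. ball p (r p))"
    using r(1) by fastforce
  then obtain F where F: "F \<subseteq> closure \<Omega>" "finite F" "closure \<Omega> \<subseteq> (\<Union>p\<in>F. ball p (r p))"
    using compactE_image[OF compact_closure_domain, of "closure \<Omega>" "\<lambda>p. ball p (r p)"] by auto
  define P where "P F x = (\<Prod>p\<in>F. 1 - bump p (r p) x)" for F and x :: "real^'n"
  have C1P: "C1_on W (P F)" if "finite F" for F
    unfolding P_def by (intro C1_on_prod C1_on_diff C1_on_const C1_on_bump that)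
  have "defect (\<lambda>x. v x * P F x) = defect v"
    using F(2,1)
  proof (induction F rule: finite_induct)
    case empty
    then show ?case by (simp add: P_def)
  next
    case (insert p F)
    have "defect (\<lambda>x. (v x * P F x) * (1 - bump p (r p) x)) = defect (\<lambda>x. v x * P F x)"
      using insert.prems
      by (intro defect_mult_cong[of W] C1_on_mult[OF v C1P] insert W r) auto
    moreover have "(\<lambda>x. v x * P (insert p F) x) = (\<lambda>x. (v x * P F x) * (1 - bump p (r p) x))"
      using insert.hyps by (simp add: P_def mult_ac)
    ultimately show ?case
      using insert by simp
  qed
  \<comment> \<open>The open balls cover the closure, and on each of them some factor of
    \<open>P F\<close> is identically 0. So the product vanishes on a neighbourhood of the closure,
    together with its gradient.\<close>
  moreover have "defect (\<lambda>x. v x * P F x) = 0"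
  proof -
    let ?S = "- (\<Union>p\<in>F. ball p (r p))"
    have z: "v x * P F x = 0" if x: "x \<notin> ?S" for x
    proof -
      obtain p where p: "p \<in> F" "x \<in> ball p (r p)"
        using x by blast
      then have "bump p (r p) x = 1"
        using r(1) F(1) by (intro bump_eq_1) auto
      then have "P F x = 0"
        unfolding P_def using F(2) p(1) by (intro prod_zero) auto
      then show ?thesis by simp
    qed
    have "G x \<bullet> grad (\<lambda>x. v x * P F x) x + g x * (v x * P F x) = 0" if x: "x \<in> \<Omega>" for x
    proof -
      have "x \<notin> ?S"
        using F(3) closure_subset x by blast
      moreover have "closed ?S"
        by (intro closed_Compl open_UN) auto
      ultimately have "grad (\<lambda>x. v x * P F x) x = 0"
        by (intro grad_eqI[OF GDERIV_0_off_closed[of ?S]] z) auto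
      then show ?thesis
        using z[OF \<open>x \<notin> ?S\<close>] by simp
    qed
    then have "defect (\<lambda>x. v x * P F x) = (LINT x|lebesgue_on \<Omega>. 0)"
      unfolding defect_def by (intro Bochner_Integration.integral_cong) auto
    then show ?thesis by simp
  qed
  ultimately show ?thesis by simp
qed

end

section \<open>No-flux boundaries\<close>

lemma continuous_on_zero_extension:
  fixes f :: "'a::topological_space \<Rightarrow> 'b::real_normed_vector"
  assumes "continuous_on V f" "open V" "closed S" "S \<subseteq> V" "\<And>x. x \<notin> S \<Longrightarrow> f x = 0"
  shows "continuous_on UNIV f"
proof -
  have "continuous_on (-S) f \<longleftrightarrow> continuous_on (-S) (\<lambda>x. 0::'b)"
    by (rule continuous_on_cong) (use assms(5) in auto)
  then have "continuous_on (-S \<union> V) f"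
    using assms by (intro continuous_on_open_Un) auto
  moreover have "-S \<union> V = UNIV"
    using assms(4) by auto
  ultimately show ?thesis
    by simp
qed

text \<open>The compact set where \<open>\<bar>q x\<bar> \<ge> \<epsilon>\<close> misses the zeros
  of \<open>\<rho>\<close>, so \<open>\<bar>\<rho> x\<bar>\<close> attains a positive minimum there;
  that minimum is \<open>\<delta>\<close>.\<close>

lemma compact_zero_set_estimate:
  fixes \<rho> q :: "'a::topological_space \<Rightarrow> real"
  assumes "compact K" "continuous_on K \<rho>" "continuous_on K q" "\<And>x. x \<in> K \<Longrightarrow> \<rho> x = 0 \<Longrightarrow> q x = 0"
    and "\<epsilon> > 0"
  obtains \<delta> where "\<delta> > 0" "\<And>x. x \<in> K \<Longrightarrow> \<bar>\<rho> x\<bar> < \<delta> \<Longrightarrow> \<bar>q x\<bar> < \<epsilon>"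
proof -
  define L where "L = K \<inter> (\<lambda>x. \<bar>q x\<bar>) -` {\<epsilon>..}"
  have "closedin (top_of_set K) L"
    unfolding L_def by (intro continuous_closedin_preimage continuous_intros assms)
  then have L: "compact L" "L \<subseteq> K"
    using assms(1) closedin_compact by (auto simp: L_def)
  show ?thesis
  proof (cases "L = {}")
    case True
    then show ?thesis
      using that[of 1] by (force simp: L_def)
  next
    case False
    have "continuous_on L (\<lambda>x. \<bar>\<rho> x\<bar>)"
      using assms(2) L by (intro continuous_intros) (auto intro: continuous_on_subset)
    then obtain y where y: "y \<in> L" "\<And>x. x \<in> L \<Longrightarrow> \<bar>\<rho> y\<bar> \<le> \<bar>\<rho> x\<bar>"
      using continuous_attains_inf[OF L(1) False] by blast
    have "\<rho> y \<noteq> 0"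
      using y(1) assms(4)[of y] \<open>\<epsilon> > 0\<close> by (auto simp: L_def)
    show ?thesis
    proof (rule that)
      show "0 < \<bar>\<rho> y\<bar>"
        using \<open>\<rho> y \<noteq> 0\<close> by simp
      fix x assume "x \<in> K" "\<bar>\<rho> x\<bar> < \<bar>\<rho> y\<bar>"
      then have "x \<notin> L"
        using y(2)[of x] by auto
      then show "\<bar>q x\<bar> < \<epsilon>"
        using \<open>x \<in> K\<close> by (auto simp: L_def)
    qed
  qed
qed

text \<open>The divergence theorem for the compactly supported field \<open>step (- t\<rho>) b\<nabla>\<rho>\<close> bounds the mass
  of its boundary layer independently of \<open>t\<close>.\<close>

lemma boundary_layer_mass_bounded:
  fixes \<rho> b :: "real^'n \<Rightarrow> real"
  assumes V: "open V" and \<rho>: "C1_on V \<rho>" "\<And>i. C1_on V (\<lambda>x. grad \<rho> x $ i)" "\<And>x. x \<in> V \<Longrightarrow> grad \<rho> x \<noteq> 0"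
    and b: "C1_on UNIV b" "\<And>x. 0 \<le> b x" "\<And>x. x \<notin> S \<Longrightarrow> b x = 0" and S: "compact S" "S \<subseteq> V"
  obtains Q where "\<And>t. t > 0 \<Longrightarrow> continuous_on UNIV (\<lambda>x. t * step' (t * - \<rho> x) * b x)"
    and "\<And>t. t > 0 \<Longrightarrow> (LINT x|lebesgue. t * step' (t * - \<rho> x) * b x) \<le> Q"
proof -
  have clS: "closed S"
    using S by (simp add: compact_imp_closed)
  have cV: "continuous_on V \<rho>" "continuous_on V (grad \<rho>)" "continuous_on V b"
    using C1_on_continuous[OF \<rho>(1)] C1_on_continuous(1)[OF b(1)] by (auto intro: continuous_on_subset)
  define m where "m t x = t * step' (t * - \<rho> x) * b x" for t x
  have cs: "continuous_on V (\<lambda>x. step' (t * - \<rho> x))" for t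
    by (rule continuous_on_compose2[OF continuous_on_step'[of UNIV]]) (intro continuous_intros cV, simp)
  have cm: "continuous_on UNIV (m t)" for t
  proof (rule continuous_on_zero_extension[OF _ V clS S(2)])
    show "continuous_on V (m t)"
      unfolding m_def by (intro continuous_on_mult continuous_on_const cs cV)
  qed (simp add: m_def b(3))
  have im: "integrable lebesgue (m t)" for t
    by (rule integrable_continuous_compact_support[OF cm S(1)]) (simp add: m_def b(3))
  \<comment> \<open>Nondegeneracy of the chart function, made uniform by compactness; it allows
    dividing by the squared gradient at the end.\<close>
  obtain c where c: "c > 0" "\<And>x. x \<in> S \<Longrightarrow> c \<le> grad \<rho> x \<bullet> grad \<rho> x"
  proof (cases "S = {}")
    case True
    then show ?thesis using that[of 1] by simp
  next
    case False
    have "continuous_on S (\<lambda>x. grad \<rho> x \<bullet> grad \<rho> x)"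
      by (intro continuous_on_inner continuous_on_subset[OF cV(2) S(2)])
    then obtain y where y: "y \<in> S" "\<And>x. x \<in> S \<Longrightarrow> grad \<rho> y \<bullet> grad \<rho> y \<le> grad \<rho> x \<bullet> grad \<rho> x"
      using continuous_attains_inf[OF S(1) False] by blast
    then have "grad \<rho> y \<bullet> grad \<rho> y > 0"
      using \<rho>(3) S(2) by auto
    then show ?thesis
      using that y(2) by blast
  qed
  define h where "h i x = b x * grad \<rho> x $ i" for i x
  have h: "C1_on UNIV (h i)" and hz: "x \<notin> S \<Longrightarrow> h i x = 0" for i x
  proof -
    show "x \<notin> S \<Longrightarrow> h i x = 0" for x
      by (simp add: h_def b(3))
    then show "C1_on UNIV (h i)"
      unfolding h_def
      by (intro C1_on_zero_extension[OF _ V clS S(2)] C1_on_mult \<rho> C1_on_subset[OF b(1)]) (auto simp: h_def)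
  qed
  \<comment> \<open>The divergence of the field \<open>h\<close>, independent of \<open>t\<close>.
    This is where second derivatives of \<open>\<rho>\<close> enter.\<close>
  define d where "d x = (\<Sum>i\<in>UNIV. grad (h i) x \<bullet> axis i 1)" for x
  have dz: "d x = 0" if "x \<notin> S" for x
    unfolding d_def using grad_eqI[OF GDERIV_0_off_closed[OF clS hz that]] by simp
  have cd: "continuous_on UNIV d"
    unfolding d_def by (intro continuous_on_sum continuous_on_inner continuous_on_const C1_on_continuous h)
  have id: "integrable lebesgue d"
    by (rule integrable_continuous_compact_support[OF cd S(1) dz])
  have bound: "(LINT x|lebesgue. m t x) \<le> (LINT x|lebesgue. \<bar>d x\<bar>) / c" if t: "t > 0" for t
  proof -
    define s where "s x = step (t * - \<rho> x)" for x
    have t\<rho>: "C1_on V (\<lambda>x. t * - \<rho> x)"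
      using C1_on_mult[OF C1_on_const[of V "- t"] \<rho>(1)] by simp
    have s: "C1_on V s"
      unfolding s_def by (rule C1_on_step[OF t\<rho>])
    have gs: "grad s x = - (t * step' (t * - \<rho> x)) *\<^sub>R grad \<rho> x" if "x \<in> V" for x
      unfolding s_def using grad_step[OF t\<rho> that] grad_cmult[OF \<rho>(1) that, of "- t"]
      by (simp add: mult.commute)
    have fz: "s x * h i x = 0" if "x \<notin> S" for i x
      using hz[OF that] by simp
    have f: "C1_on UNIV (\<lambda>x. s x * h i x)" for i
      by (rule C1_on_zero_extension[OF C1_on_mult[OF s C1_on_subset[OF h]] V clS S(2) fz]) auto
    \<comment> \<open>Product rule for a divergence: the gradient of \<open>s\<close> is a negative
      multiple of the gradient of \<open>\<rho>\<close>, which produces the layer weight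
      \<open>m t\<close> times the squared gradient.\<close>
    have "(\<Sum>i\<in>UNIV. grad (\<lambda>x. s x * h i x) x \<bullet> axis i 1) = s x * d x - m t x * (grad \<rho> x \<bullet> grad \<rho> x)"
      (is "?l x = ?r x") for x
    proof (cases "x \<in> S")
      case True
      then have x: "x \<in> V"
        using S(2) by blast
      have "grad (\<lambda>x. s x * h i x) x \<bullet> axis i 1
          = s x * (grad (h i) x \<bullet> axis i 1) - m t x * (grad \<rho> x $ i * grad \<rho> x $ i)" for i
        using grad_mult[OF s C1_on_subset[OF h, of V i] x] gs[OF x]
        by (simp add: inner_add_left inner_axis h_def m_def)
      then have "?l x = (\<Sum>i\<in>UNIV. s x * (grad (h i) x \<bullet> axis i 1) - m t x * (grad \<rho> x $ i * grad \<rho> x $ i))"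
        by simp
      also have "\<dots> = ?r x"
        by (simp add: sum_subtractf sum_distrib_left[symmetric] d_def inner_vec_def)
      finally show ?thesis .
    next
      case False
      have "grad (\<lambda>x. s x * h i x) x = 0" for i
        by (rule grad_eqI[OF GDERIV_0_off_closed[OF clS fz False]])
      then show ?thesis
        using False by (simp add: dz m_def b(3))
    qed
    then have "(LINT x|lebesgue. ?r x) = (LINT x|lebesgue. (\<Sum>i\<in>UNIV. grad (\<lambda>x. s x * h i x) x \<bullet> axis i 1))"
      by simp
    also have "\<dots> = (\<Sum>i\<in>UNIV. LINT x|lebesgue. grad (\<lambda>x. s x * h i x) x \<bullet> axis i 1)"
    proof (rule Bochner_Integration.integral_sum)
      fix i
      show "integrable lebesgue (\<lambda>x. grad (\<lambda>x. s x * h i x) x \<bullet> axis i 1)"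
      proof (rule integrable_continuous_compact_support[OF _ S(1)])
        show "continuous_on UNIV (\<lambda>x. grad (\<lambda>x. s x * h i x) x \<bullet> axis i 1)"
          by (intro continuous_on_inner continuous_on_const C1_on_continuous f)
        show "grad (\<lambda>x. s x * h i x) x \<bullet> axis i 1 = 0" if "x \<notin> S" for x
          using grad_eqI[OF GDERIV_0_off_closed[OF clS fz that]] by simp
      qed
    qed
    also have "\<dots> = 0"
      by (rule sum.neutral) (use integral_grad_compact_support[OF f S(1) fz] in auto)
    finally have 0: "(LINT x|lebesgue. ?r x) = 0" .
    have isd: "integrable lebesgue (\<lambda>x. s x * d x)"
    proof (rule integrable_continuous_compact_support[OF _ S(1)])
      show "continuous_on UNIV (\<lambda>x. s x * d x)"
        by (rule continuous_on_zero_extension[OF _ V clS S(2)])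
          (use dz C1_on_continuous(1)[OF s] cd in \<open>auto intro!: continuous_on_mult intro: continuous_on_subset\<close>)
    qed (simp add: dz)
    have imn: "integrable lebesgue (\<lambda>x. m t x * (grad \<rho> x \<bullet> grad \<rho> x))"
    proof (rule integrable_continuous_compact_support[OF _ S(1)])
      show "continuous_on UNIV (\<lambda>x. m t x * (grad \<rho> x \<bullet> grad \<rho> x))"
        by (rule continuous_on_zero_extension[OF _ V clS S(2)])
          (intro continuous_on_mult continuous_on_inner cV continuous_on_subset[OF cm],
            simp_all add: m_def b(3))
    qed (simp add: m_def b(3))
    \<comment> \<open>The total divergence integrates to 0, so the weighted mass of the layer equals
      the integral of \<open>s x * d x\<close>. Since \<open>s\<close> lies in [0, 1], this is
      bounded by a quantity free of \<open>t\<close>.\<close>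
    have "c * (LINT x|lebesgue. m t x) = (LINT x|lebesgue. c * m t x)"
      by simp
    also have "\<dots> \<le> (LINT x|lebesgue. m t x * (grad \<rho> x \<bullet> grad \<rho> x))"
    proof (rule integral_mono[OF _ imn])
      show "integrable lebesgue (\<lambda>x. c * m t x)"
        using im by simp
      show "c * m t x \<le> m t x * (grad \<rho> x \<bullet> grad \<rho> x)" for x
      proof (cases "x \<in> S")
        case True
        have "0 \<le> m t x"
          using t step'_nonneg b(2) by (simp add: m_def)
        then show ?thesis
          using mult_left_mono[OF c(2)[OF True], of "m t x"] by (simp only: mult.commute[of c])
      qed (simp add: m_def b(3))
    qed
    also have "\<dots> = (LINT x|lebesgue. s x * d x)"
      using 0 isd imn by simp
    also have "\<dots> \<le> (LINT x|lebesgue. \<bar>d x\<bar>)"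
    proof (rule integral_mono[OF isd])
      show "integrable lebesgue (\<lambda>x. \<bar>d x\<bar>)"
        using id by simp
      have "\<bar>s x * d x\<bar> \<le> \<bar>d x\<bar>" for x
        using step_nonneg step_le_1 by (simp add: s_def abs_mult mult_left_le_one_le)
      then show "s x * d x \<le> \<bar>d x\<bar>" for x
        by (rule order_trans[OF abs_ge_self])
    qed
    finally show ?thesis
      using c(1) by (simp add: pos_le_divide_eq mult.commute)
  qed
  show ?thesis
    using that cm bound unfolding m_def by blast
qed

context divergence_field
begin

text \<open>On the layer \<open>\<rho>\<close> is of order 1 / k, so the normal component of
  \<open>G\<close>, which is continuous and vanishes where \<open>\<rho>\<close> does, is uniformly
  small there, while the mass of the layer stays bounded.\<close>

lemma boundary_layer_vanishes:
  fixes \<rho> v :: "real^'n \<Rightarrow> real"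
  assumes V: "open V" and \<rho>: "C1_on V \<rho>" "\<And>i. C1_on V (\<lambda>x. grad \<rho> x $ i)" "\<And>x. x \<in> V \<Longrightarrow> grad \<rho> x \<noteq> 0"
    and flux: "\<And>x. x \<in> V \<Longrightarrow> x \<in> closure \<Omega> \<Longrightarrow> \<rho> x = 0 \<Longrightarrow> G x \<bullet> grad \<rho> x = 0"
    and v: "continuous_on UNIV v" "\<And>x. x \<notin> S \<Longrightarrow> v x = 0" and S: "compact S" "S \<subseteq> V"
  defines "R \<equiv> \<lambda>k x. (v x * (real (Suc k) * step' (real (Suc k) * - \<rho> x))) *\<^sub>R grad \<rho> x"
  shows "continuous_on UNIV (R k)"
    and "integrable (lebesgue_on \<Omega>) (\<lambda>x. G x \<bullet> R k x)"
    and "(\<lambda>k. LINT x|lebesgue_on \<Omega>. G x \<bullet> R k x) \<longlonglongrightarrow> 0"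
proof -
  have clS: "closed S"
    using S by (simp add: compact_imp_closed)
  have cV: "continuous_on V \<rho>" "continuous_on V (grad \<rho>)" "continuous_on V v"
    using C1_on_continuous[OF \<rho>(1)] v(1) by (auto intro: continuous_on_subset)
  show cR: "continuous_on UNIV (R k)" for k
  proof (rule continuous_on_zero_extension[OF _ V clS S(2)])
    have "continuous_on V (\<lambda>x. step' (real (Suc k) * - \<rho> x))"
      by (rule continuous_on_compose2[OF continuous_on_step'[of UNIV]]) (intro continuous_intros cV, simp)
    then show "continuous_on V (R k)"
      unfolding R_def by (intro continuous_on_scaleR continuous_on_mult continuous_on_const cV)
  qed (simp add: R_def v(2))
  show iR: "integrable (lebesgue_on \<Omega>) (\<lambda>x. G x \<bullet> R k x)" for k
    by (intro integrable_continuous continuous_on_inner continuous_field continuous_on_subset[OF cR]) simp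
  \<comment> \<open>The mass bound asks for a nonnegative C1 weight, whereas \<open>v\<close> is
    only continuous and may change sign. The weight \<open>b\<close> is 1 on the support of
    \<open>v\<close> and takes its place.\<close>
  obtain b T where b: "C1_on UNIV b" "compact T" "T \<subseteq> V" "\<And>x. x \<notin> T \<Longrightarrow> b x = 0"
    "\<And>x. x \<in> S \<Longrightarrow> b x = (1::real)" "\<And>x. 0 \<le> b x"
    using C1_urysohn[OF S(1) V S(2)] by metis
  obtain Q where Q: "\<And>t. t > 0 \<Longrightarrow> continuous_on UNIV (\<lambda>x. t * step' (t * - \<rho> x) * b x)"
    "\<And>t. t > 0 \<Longrightarrow> (LINT x|lebesgue. t * step' (t * - \<rho> x) * b x) \<le> Q"
    using boundary_layer_mass_bounded[OF V \<rho> b(1,6,4,2,3)] by blast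
  define m where "m k x = real (Suc k) * step' (real (Suc k) * - \<rho> x) * b x" for k x
  have m0: "0 \<le> m k x" for k x
    unfolding m_def using step'_nonneg b(6) by (intro mult_nonneg_nonneg) auto
  have im: "integrable lebesgue (m k)" for k
    by (rule integrable_continuous_compact_support[OF _ b(2)]) (use Q(1) b(4) in \<open>simp_all add: m_def\<close>)
  have Qm: "(LINT x|lebesgue. m k x) \<le> Q" for k
    unfolding m_def by (rule Q(2)) simp
  have im': "integrable (lebesgue_on \<Omega>) (m k)" for k
    using integrable_mult_indicator[OF domain_sets im[of k]] domain_sets by (simp add: integrable_restrict_space)
  have Qm': "(LINT x|lebesgue_on \<Omega>. m k x) \<le> Q" for k
  proof -
    have "(LINT x|lebesgue_on \<Omega>. m k x) = (LINT x|lebesgue. indicator \<Omega> x * m k x)"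
      using domain_sets by (simp add: integral_restrict_space)
    also have "\<dots> \<le> (LINT x|lebesgue. m k x)"
    proof (rule integral_mono[OF _ im])
      show "integrable lebesgue (\<lambda>x. indicator \<Omega> x * m k x)"
        using integrable_mult_indicator[OF domain_sets im[of k]] by simp
      show "indicator \<Omega> x * m k x \<le> m k x" for x
        using m0[of k x] by (simp add: indicator_def)
    qed
    finally show ?thesis
      using Qm[of k] by linarith
  qed
  have Q0: "0 \<le> Q"
    using order_trans[OF Bochner_Integration.integral_nonneg[OF m0] Qm] .
  have "bounded (v ` S)"
    using S v(1) by (intro compact_imp_bounded compact_continuous_image) (auto intro: continuous_on_subset)
  then obtain M where M: "M > 0" "\<And>x. x \<in> S \<Longrightarrow> \<bar>v x\<bar> \<le> M"
    unfolding bounded_pos by auto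
  show "(\<lambda>k. LINT x|lebesgue_on \<Omega>. G x \<bullet> R k x) \<longlonglongrightarrow> 0"
  proof (rule LIMSEQ_I)
    fix r :: real assume r: "r > 0"
    \<comment> \<open>The summand 1 avoids division by zero when \<open>Q\<close> is 0 and makes the
      final estimate strict.\<close>
    define \<epsilon> where "\<epsilon> = r / (M * (Q + 1))"
    have \<epsilon>: "\<epsilon> > 0"
      using r M(1) Q0 by (simp add: \<epsilon>_def)
    \<comment> \<open>\<open>G\<close> is continuous only up to the boundary, so the compactness
      argument stays inside the closure.\<close>
    define K where "K = S \<inter> closure \<Omega>"
    have K: "compact K" "K \<subseteq> V"
      unfolding K_def using S by (auto intro: compact_Int_closed)
    obtain \<delta> where \<delta>: "\<delta> > 0" "\<And>x. x \<in> K \<Longrightarrow> \<bar>\<rho> x\<bar> < \<delta> \<Longrightarrow> \<bar>G x \<bullet> grad \<rho> x\<bar> < \<epsilon>"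
    proof (rule compact_zero_set_estimate[OF K(1) _ _ _ \<epsilon>])
      show "continuous_on K \<rho>"
        using cV(1) K(2) by (rule continuous_on_subset)
      show "continuous_on K (\<lambda>x. G x \<bullet> grad \<rho> x)"
        using continuous_on_subset[OF continuous_field, of K] continuous_on_subset[OF cV(2) K(2)]
        by (intro continuous_on_inner) (auto simp: K_def)
      show "G x \<bullet> grad \<rho> x = 0" if "x \<in> K" "\<rho> x = 0" for x
        using flux that K(2) by (auto simp: K_def)
    qed blast
    obtain N where N: "2 / \<delta> < real N"
      using reals_Archimedean2 by blast
    have "norm ((LINT x|lebesgue_on \<Omega>. G x \<bullet> R k x) - 0) < r" if k: "k \<ge> N" for k
    proof -
      have pt: "\<bar>G x \<bullet> R k x\<bar> \<le> (\<epsilon> * M) * m k x" if x: "x \<in> \<Omega>" for x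
      proof (cases "x \<in> S \<and> step' (real (Suc k) * - \<rho> x) \<noteq> 0")
        case True
        \<comment> \<open>\<open>step'\<close> lives on the interval (1, 2), hence
          \<open>\<bar>\<rho> x\<bar>\<close> is below 2 / (k + 1), and this is below
          \<open>\<delta>\<close> by the choice of \<open>N\<close>.\<close>
        then have xS: "x \<in> S" and "1 < real (Suc k) * - \<rho> x" "real (Suc k) * - \<rho> x < 2"
          using step'_eq_0[of "real (Suc k) * - \<rho> x"] by (simp_all only: not_less[symmetric]) blast+
        then have "\<bar>real (Suc k) * - \<rho> x\<bar> < 2"
          by linarith
        then have "\<bar>\<rho> x\<bar> * real (Suc k) < 2"
          unfolding abs_mult by (simp add: mult.commute)
        moreover have "2 < \<delta> * real (Suc k)"
        proof -
          have "2 / \<delta> < real (Suc k)"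
            using N k by simp
          then show ?thesis
            using \<delta>(1) by (simp only: pos_divide_less_eq mult.commute)
        qed
        ultimately have "\<bar>\<rho> x\<bar> * real (Suc k) < \<delta> * real (Suc k)"
          by linarith
        then have "\<bar>\<rho> x\<bar> < \<delta>"
          by (simp add: mult_less_cancel_right)
        moreover have "x \<in> K"
          using xS x closure_subset by (auto simp: K_def)
        ultimately have q: "\<bar>G x \<bullet> grad \<rho> x\<bar> \<le> \<epsilon>"
          using \<delta>(2) by force
        define s where "s = real (Suc k) * step' (real (Suc k) * - \<rho> x)"
        have s: "0 \<le> s"
          unfolding s_def using step'_nonneg by simp
        have "\<bar>G x \<bullet> R k x\<bar> = (\<bar>v x\<bar> * \<bar>G x \<bullet> grad \<rho> x\<bar>) * s"
          using s unfolding R_def s_def[symmetric] by (simp add: abs_mult mult_ac)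
        also have "\<dots> \<le> (M * \<epsilon>) * s"
          using q M xS s by (intro mult_right_mono mult_mono) auto
        also have "\<dots> = (\<epsilon> * M) * m k x"
          using b(5)[OF xS] by (simp add: m_def s_def)
        finally show ?thesis .
      next
        case False
        then have "R k x = 0"
          using v(2)[of x] by (auto simp: R_def)
        then show ?thesis
          using m0[of k x] \<epsilon> M(1) by simp
      qed
      have "\<bar>LINT x|lebesgue_on \<Omega>. G x \<bullet> R k x\<bar> \<le> (LINT x|lebesgue_on \<Omega>. \<bar>G x \<bullet> R k x\<bar>)"
        by (rule integral_abs_bound)
      also have "\<dots> \<le> (LINT x|lebesgue_on \<Omega>. (\<epsilon> * M) * m k x)"
        using im' iR pt by (intro integral_mono) auto
      also have "\<dots> = (\<epsilon> * M) * (LINT x|lebesgue_on \<Omega>. m k x)"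
        by simp
      also have "\<dots> \<le> (\<epsilon> * M) * Q"
        using Qm' \<epsilon> M(1) by (intro mult_left_mono) auto
      also have "\<dots> < (\<epsilon> * M) * (Q + 1)"
        using \<epsilon> M(1) by (intro mult_strict_left_mono) auto
      also have "\<dots> = r"
        using M(1) Q0 by (simp add: \<epsilon>_def)
      finally show ?thesis
        by simp
    qed
    then show "\<exists>N. \<forall>k\<ge>N. norm ((LINT x|lebesgue_on \<Omega>. G x \<bullet> R k x) - 0) < r"
      by blast
  qed
qed

text \<open>\<open>- \<rho>\<close> acts as a substitute for the distance to the boundary:
  \<open>step\<close> of its large multiples is a cut-off that rises to 1 inside the domain and
  whose gradient is normal to the level sets of \<open>\<rho>\<close>.\<close>

lemma defect_boundary_chart:
  assumes chart: "boundary_chart \<Omega> V \<rho>"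
    and flux: "\<And>x. x \<in> V \<Longrightarrow> x \<in> closure \<Omega> \<Longrightarrow> \<rho> x = 0 \<Longrightarrow> G x \<bullet> grad \<rho> x = 0"
    and v: "C1_on UNIV v" "\<And>x. x \<notin> S \<Longrightarrow> v x = 0" and S: "compact S" "S \<subseteq> V"
  shows "defect v = 0"
proof -
  have V: "open V" and \<rho>3: "\<And>x. x \<in> V \<Longrightarrow> grad \<rho> x \<noteq> 0" and dom: "\<Omega> \<inter> V = {x \<in> V. \<rho> x < 0}"
    using chart by (auto simp: boundary_chart_def)
  have smooth: "Ck_on k V \<rho>" for k
    using chart by (auto simp: boundary_chart_def smooth_on_def)
  have \<rho>1: "C1_on V \<rho>"
    by (rule Ck_on_1_iff[THEN iffD1, OF smooth])
  \<comment> \<open>Two derivatives of \<open>\<rho>\<close> are extracted from smoothness, since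
    the mass bound differentiates its gradient.\<close>
  have "Ck_on 1 V (\<lambda>x. grad \<rho> x $ i)" for i
    using smooth[of "Suc 1"] unfolding Ck_on.simps(2)[of 1] by blast
  then have \<rho>2: "C1_on V (\<lambda>x. grad \<rho> x $ i)" for i
    by (rule Ck_on_1_iff[THEN iffD1])
  have clS: "closed S"
    using S by (simp add: compact_imp_closed)
  define t where "t k = real (Suc k)" for k
  have t: "t k > 0" for k
    by (simp add: t_def)
  \<comment> \<open>The minus sign is there because the cut-off decreases towards the boundary,
    where \<open>\<rho>\<close> increases.\<close>
  define R where "R k x = - ((v x * (real (Suc k) * step' (real (Suc k) * - \<rho> x))) *\<^sub>R grad \<rho> x)" for k x
  have layer: "integrable (lebesgue_on \<Omega>)
      (\<lambda>x. G x \<bullet> (v x * (real (Suc k) * step' (real (Suc k) * - \<rho> x))) *\<^sub>R grad \<rho> x)" for k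
    by (rule boundary_layer_vanishes(2)[OF V \<rho>1 \<rho>2 \<rho>3 flux C1_on_continuous(1)[OF v(1)] v(2) S])
  have layer_tendsto: "(\<lambda>k. LINT x|lebesgue_on \<Omega>.
      G x \<bullet> (v x * (real (Suc k) * step' (real (Suc k) * - \<rho> x))) *\<^sub>R grad \<rho> x) \<longlonglongrightarrow> 0"
    by (rule boundary_layer_vanishes(3)[OF V \<rho>1 \<rho>2 \<rho>3 flux C1_on_continuous(1)[OF v(1)] v(2) S])
  have t\<rho>: "C1_on V (\<lambda>x. t k * - \<rho> x)" for k
    using C1_on_mult[OF C1_on_const[of V "- t k"] \<rho>1] by simp
  have s: "C1_on V (\<lambda>x. step (t k * - \<rho> x))" for k
    by (rule C1_on_step[OF t\<rho>])
  have gs: "grad (\<lambda>x. step (t k * - \<rho> x)) x = - (t k * step' (t k * - \<rho> x)) *\<^sub>R grad \<rho> x" if "x \<in> V" for k x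
    using grad_step[OF t\<rho> that] grad_cmult[OF \<rho>1 that, of "- t k"] by (simp add: mult.commute)
  have gv: "grad v x = 0" if "x \<notin> S" for x
    by (rule grad_eqI[OF GDERIV_0_off_closed[OF clS v(2) that]])
  show ?thesis
  proof (rule defect_eq_0_if_boundary_layer_vanishes[where R = R and \<psi> = "\<lambda>k x. step (t k * - \<rho> x)"
        and \<eta> = "\<lambda>k x. step (t k * - \<rho> x) * v x"])
    show "continuous_on (closure \<Omega>) v" "continuous_on (closure \<Omega>) (grad v)"
      by (rule C1_on_continuous_closure[OF v(1)]; simp)+
    show "0 \<le> step (t k * - \<rho> x)" "step (t k * - \<rho> x) \<le> 1" for k x
      by (rule step_nonneg step_le_1)+
    show "test_function \<Omega> (\<lambda>x. step (t k * - \<rho> x) * v x)" for k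
    proof (rule test_functionI)
      show "C1_on UNIV (\<lambda>x. step (t k * - \<rho> x) * v x)"
        by (rule C1_on_zero_extension[OF C1_on_mult[OF s C1_on_subset[OF v(1)]] V clS S(2)]) (simp_all add: v(2))
      \<comment> \<open>The rise of \<open>step\<close> starts at 1, not at 0: a closed condition
        that still forces \<open>\<rho> x < 0\<close>. So the support is compact and inside the
        domain.\<close>
      let ?T = "S \<inter> (\<lambda>x. t k * - \<rho> x) -` {1..}"
      have "closedin (top_of_set S) ?T"
        by (intro continuous_closedin_preimage continuous_on_subset[OF C1_on_continuous(1)[OF t\<rho>] S(2)]) simp
      then show "compact ?T"
        by (rule closedin_compact[OF S(1)])
      show "?T \<subseteq> \<Omega>"
      proof
        fix x assume x: "x \<in> ?T"
        then have "0 < t k * - \<rho> x"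
          by auto
        then have "\<rho> x < 0"
          using t[of k] by (simp add: mult_less_0_iff)
        then show "x \<in> \<Omega>"
          using x S(2) dom by blast
      qed
      show "step (t k * - \<rho> x) * v x = 0" if "x \<notin> ?T" for x
        using that v(2)[of x] step_eq_0[of "t k * - \<rho> x"] by (cases "x \<in> S") auto
    qed
    show "step (t k * - \<rho> x) * v x = step (t k * - \<rho> x) * v x" for k x ..
    show "grad (\<lambda>x. step (t k * - \<rho> x) * v x) x = step (t k * - \<rho> x) *\<^sub>R grad v x + R k x" if "x \<in> \<Omega>" for k x
    proof (cases "x \<in> S")
      case True
      then have x: "x \<in> V"
        using S(2) by blast
      show ?thesis
        using grad_mult[OF s C1_on_subset[OF v(1)] x] gs[OF x] by (simp add: R_def t_def)
    next
      case False
      then have "grad (\<lambda>x. step (t k * - \<rho> x) * v x) x = 0"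
        by (intro grad_eqI[OF GDERIV_0_off_closed[OF clS]]) (simp_all add: v(2))
      then show ?thesis
        using False gv v(2) by (simp add: R_def)
    qed
    show "v x = 0 \<and> grad v x = 0 \<or> (\<lambda>k. step (t k * - \<rho> x)) \<longlonglongrightarrow> 1" if "x \<in> \<Omega>" for x
    proof (cases "x \<in> S")
      case True
      then have "\<rho> x < 0"
        using that S(2) dom by blast
      obtain N where N: "2 / - \<rho> x < real N"
        using reals_Archimedean2 by blast
      have "step (t k * - \<rho> x) = 1" if "k \<ge> N" for k
      proof (rule step_eq_1)
        have "2 / - \<rho> x \<le> t k"
          using N that by (simp add: t_def)
        then show "2 \<le> t k * - \<rho> x"
          using \<open>\<rho> x < 0\<close> by (subst (asm) pos_divide_le_eq) auto
      qed
      then have "\<forall>\<^sub>F k in sequentially. step (t k * - \<rho> x) = 1"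
        unfolding eventually_sequentially by blast
      then show ?thesis
        by (simp add: tendsto_eventually)
    qed (simp add: v(2) gv)
    show "integrable (lebesgue_on \<Omega>) (\<lambda>x. G x \<bullet> R k x)" for k
      using layer[of k] unfolding R_def inner_minus_right by (rule Bochner_Integration.integrable_minus)
    show "(\<lambda>k. LINT x|lebesgue_on \<Omega>. G x \<bullet> R k x) \<longlonglongrightarrow> 0"
      using tendsto_minus[OF layer_tendsto] unfolding R_def inner_minus_right Bochner_Integration.integral_minus
      by (simp only: minus_zero)
  qed
qed

text \<open>Near an interior point a function with small support is already a test function; near a
  frontier point a chart gives the vanishing.\<close>

lemma defect_no_flux:
  assumes dom: "smooth_bounded_domain \<Omega>"
    and flux: "\<And>x \<nu>. x \<in> frontier \<Omega> \<Longrightarrow> is_outward_normal \<Omega> x \<nu> \<Longrightarrow> G x \<bullet> \<nu> = 0"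
    and v: "C1_on W v" "open W" "closure \<Omega> \<subseteq> W"
  shows "defect v = 0"
proof (rule defect_eq_0_if_local[OF _ v])
  fix p assume p: "p \<in> closure \<Omega>"
  show "\<exists>r>0. \<forall>w. C1_on UNIV w \<longrightarrow> (\<forall>x. x \<notin> cball p r \<longrightarrow> w x = 0) \<longrightarrow> defect w = 0"
  proof (cases "p \<in> \<Omega>")
    case True
    then obtain r where r: "r > 0" "cball p r \<subseteq> \<Omega>"
      using open_domain open_contains_cball by blast
    then show ?thesis
      using defect_interior[OF _ compact_cball r(2)] by blast
  next
    case False
    then have "p \<in> frontier \<Omega>"
      using p open_domain by (simp add: frontier_def interior_open)
    then obtain V \<rho> where V: "p \<in> V" "boundary_chart \<Omega> V \<rho>"
      using dom unfolding smooth_bounded_domain_def by blast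
    then have "open V"
      by (simp add: boundary_chart_def)
    then obtain r where r: "r > 0" "cball p r \<subseteq> V"
      using V(1) open_contains_cball by blast
    \<comment> \<open>A zero of \<open>\<rho>\<close> in the closure lies outside the open domain,
      hence on the frontier, and the normalised gradient of this very chart is one of the normals
      covered by \<open>flux\<close>.\<close>
    have "G x \<bullet> grad \<rho> x = 0" if x: "x \<in> V" "x \<in> closure \<Omega>" "\<rho> x = 0" for x
    proof -
      have "x \<notin> \<Omega>"
      proof
        assume "x \<in> \<Omega>"
        then have "x \<in> \<Omega> \<inter> V"
          using x(1) by blast
        then have "\<rho> x < 0"
          using V(2) unfolding boundary_chart_def by blast
        then show False
          using x(3) by simp
      qed
      then have "x \<in> frontier \<Omega>"
        using x(2) open_domain by (simp add: frontier_def interior_open)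
      moreover have "is_outward_normal \<Omega> x (grad \<rho> x /\<^sub>R norm (grad \<rho> x))"
        using x(1) V(2) unfolding is_outward_normal_def by blast
      ultimately have "G x \<bullet> (grad \<rho> x /\<^sub>R norm (grad \<rho> x)) = 0"
        by (rule flux)
      moreover have "grad \<rho> x \<noteq> 0"
        using x(1) V(2) by (auto simp: boundary_chart_def)
      ultimately show ?thesis
        by simp
    qed
    then have "defect w = 0" if "C1_on UNIV w" "\<forall>x. x \<notin> cball p r \<longrightarrow> w x = 0" for w
      using that by (intro defect_boundary_chart[OF V(2) _ _ _ compact_cball r(2)]) auto
    then show ?thesis
      using r(1) by blast
  qed
qed

end

section \<open>Periodic cells\<close>

lemma GDERIV_translation:
  assumes "GDERIV w (x + c) :> D" and "\<And>z. w (z + c) = w z"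
  shows "GDERIV w x :> D"
proof -
  have "((\<lambda>z. z + c) has_derivative (\<lambda>h. h)) (at x)"
    by (auto intro!: derivative_eq_intros)
  then have "((\<lambda>z. w (z + c)) has_derivative (\<lambda>h. h \<bullet> D)) (at x)"
    using assms(1) unfolding gderiv_def by (rule has_derivative_compose)
  then show ?thesis
    unfolding gderiv_def assms(2) .
qed

lemma grad_translation:
  assumes "C1_on UNIV w" and "\<And>z. w (z + c) = w z"
  shows "grad w (x + c) = grad w x"
  by (rule grad_eqI[OF GDERIV_translation[OF C1_on_GDERIV[OF assms(1)] assms(2)], symmetric]) auto

lemma period_int_multiple:
  fixes w :: "'a::real_vector \<Rightarrow> 'b"
  assumes "\<And>z. w (z + c) = w z"
  shows "w (z + of_int n *\<^sub>R c) = w z"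
proof (induction n arbitrary: z rule: int_induct[where k = 0])
  case (step1 n)
  have "w (z + of_int (n + 1) *\<^sub>R c) = w ((z + of_int n *\<^sub>R c) + c)"
    by (simp add: algebra_simps)
  then show ?case
    using assms step1 by simp
next
  case (step2 n)
  have "w (z + of_int (n - 1) *\<^sub>R c) = w ((z + of_int (n - 1) *\<^sub>R c) + c)"
    using assms by simp
  also have "(z + of_int (n - 1) *\<^sub>R c) + c = z + of_int n *\<^sub>R c"
    by (simp add: algebra_simps)
  finally show ?case
    using step2 by simp
qed simp

lemma period_sum:
  fixes w :: "'a::real_vector \<Rightarrow> 'b"
  assumes "finite I" and "\<And>i z. i \<in> I \<Longrightarrow> w (z + c i) = w z"
  shows "w (z + (\<Sum>i\<in>I. c i)) = w z"
  using assms
proof (induction I arbitrary: z)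
  case (insert i I)
  have "w (z + (\<Sum>i\<in>insert i I. c i)) = w ((z + c i) + (\<Sum>i\<in>I. c i))"
    using insert.hyps by (simp add: add.assoc)
  also have "\<dots> = w (z + c i)"
    using insert by blast
  also have "\<dots> = w z"
    using insert.prems by blast
  finally show ?case .
qed simp

text \<open>Regularity is given near the closed cell only; a lattice translation carries any point
  into the cell, and the regularity back to the point.\<close>

lemma periodic_imp_C1_on_UNIV:
  fixes w :: "real^'n \<Rightarrow> real"
  assumes ab: "\<And>i. a $ i < b $ i" and per: "periodic a b w"
    and w: "C1_on W w" "open W" "cbox a b \<subseteq> W"
  shows "C1_on UNIV w"
proof -
  have at: "w differentiable (at x) \<and> isCont (grad w) x" for x
  proof -
    \<comment> \<open>Subtracting the integer part of the position measured in periods leaves an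
      offset between 0 and one period in every coordinate.\<close>
    define n where "n i = - \<lfloor>(x $ i - a $ i) / (b $ i - a $ i)\<rfloor>" for i
    define c where "c = (\<Sum>i\<in>UNIV. of_int (n i) *\<^sub>R ((b $ i - a $ i) *\<^sub>R axis i (1::real)))"
    have c: "w (z + c) = w z" for z
      unfolding c_def
      by (rule period_sum, simp, rule period_int_multiple) (use per in \<open>simp add: periodic_def\<close>)
    have ci: "c $ i = of_int (n i) * (b $ i - a $ i)" for i
      unfolding c_def by (simp add: axis_def if_distrib sum.delta cong: if_cong)
    have "x + c \<in> cbox a b"
      unfolding mem_box_cart
    proof
      fix i
      define r where "r = (x $ i - a $ i) / (b $ i - a $ i)"
      have x: "x $ i = a $ i + r * (b $ i - a $ i)"
        using ab[of i] by (simp add: r_def)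
      have "(x + c) $ i = a $ i + (r - of_int \<lfloor>r\<rfloor>) * (b $ i - a $ i)"
        using x by (simp add: ci n_def r_def[symmetric] algebra_simps)
      moreover have "0 \<le> (r - of_int \<lfloor>r\<rfloor>) * (b $ i - a $ i)"
        using ab[of i] by (intro mult_nonneg_nonneg) auto
      moreover have "(r - of_int \<lfloor>r\<rfloor>) * (b $ i - a $ i) \<le> 1 * (b $ i - a $ i)"
        using ab[of i] by (intro mult_right_mono) linarith+
      ultimately show "a $ i \<le> (x + c) $ i \<and> (x + c) $ i \<le> b $ i"
        unfolding mult_1 by linarith
    qed
    then have xW: "x + c \<in> W"
      using w(3) by blast
    define V where "V = (\<lambda>z. z + c) -` W"
    have "open V"
      unfolding V_def by (intro open_vimage w continuous_intros)
    have g: "GDERIV w z :> grad w (z + c)" if "z \<in> V" for z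
      using that by (intro GDERIV_translation[OF C1_on_GDERIV[OF w(1)] c]) (simp add: V_def)
    have "continuous_on V (\<lambda>z. grad w (z + c))"
      by (rule continuous_on_compose2[OF C1_on_continuous(2)[OF w(1)]])
        (auto simp: V_def intro: continuous_intros)
    with g have "C1_on V w"
      by (rule C1_onI(1))
    then show ?thesis
      using \<open>open V\<close> xW unfolding C1_on_def V_def by (simp add: continuous_on_eq_continuous_at)
  qed
  then show ?thesis
    unfolding C1_on_def by (simp add: continuous_at_imp_continuous_on)
qed

section \<open>Cut-off functions of a rectangular cell\<close>

lemma grad_prod:
  assumes "finite F" "\<And>j. j \<in> F \<Longrightarrow> C1_on V (f j)" "x \<in> V"
  shows "grad (\<lambda>x. \<Prod>j\<in>F. f j x) x = (\<Sum>j\<in>F. (\<Prod>l\<in>F - {j}. f l x) *\<^sub>R grad (f j) x)"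
  using assms(1,2)
proof (induction F rule: finite_induct)
  case empty
  then show ?case by simp
next
  case (insert i F)
  have "grad (\<lambda>x. \<Prod>j\<in>insert i F. f j x) x = grad (\<lambda>x. f i x * (\<Prod>j\<in>F. f j x)) x"
    using insert.hyps by simp
  also have "\<dots> = f i x *\<^sub>R grad (\<lambda>x. \<Prod>j\<in>F. f j x) x + (\<Prod>j\<in>F. f j x) *\<^sub>R grad (f i) x"
    using insert by (intro grad_mult[of V] C1_on_prod assms(3)) auto
  also have "grad (\<lambda>x. \<Prod>j\<in>F. f j x) x = (\<Sum>j\<in>F. (\<Prod>l\<in>F - {j}. f l x) *\<^sub>R grad (f j) x)"
    using insert by simp
  also have "f i x *\<^sub>R \<dots> = (\<Sum>j\<in>F. (\<Prod>l\<in>insert i F - {j}. f l x) *\<^sub>R grad (f j) x)"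
    unfolding scaleR_sum_right
  proof (rule sum.cong)
    fix j assume "j \<in> F"
    then have "insert i F - {j} = insert i (F - {j})" "i \<notin> F - {j}"
      using insert.hyps by auto
    then show "f i x *\<^sub>R ((\<Prod>l\<in>F - {j}. f l x) *\<^sub>R grad (f j) x)
        = (\<Prod>l\<in>insert i F - {j}. f l x) *\<^sub>R grad (f j) x"
      using insert.hyps by simp
  qed simp
  also have "\<dots> + (\<Prod>j\<in>F. f j x) *\<^sub>R grad (f i) x
      = (\<Sum>j\<in>insert i F. (\<Prod>l\<in>insert i F - {j}. f l x) *\<^sub>R grad (f j) x)"
    using insert.hyps by (simp add: add.commute)
  finally show ?case .
qed

text \<open>The offset \<open>3\<close> makes the two flanks of \<open>edge\<close> translates of each other.\<close>

definition edge :: "real \<Rightarrow> real \<Rightarrow> real \<Rightarrow> real \<Rightarrow> real" where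
  "edge t \<alpha> \<beta> s = step (t * (s - \<alpha>)) - step (t * (s - \<beta>) + 3)"

definition box_cutoff :: "real \<Rightarrow> real^'n \<Rightarrow> real^'n \<Rightarrow> real^'n \<Rightarrow> real" where
  "box_cutoff t a b x = (\<Prod>j\<in>UNIV. edge t (a $ j) (b $ j) (x $ j))"

text \<open>The rising flank ends where \<open>t * (s - \<alpha>)\<close> is 2 and the falling one
  begins where \<open>t * (s - \<beta>)\<close> is - 2. A scaled length of at least 4 keeps them
  apart, so at every point one of the two steps is already constant.\<close>

lemma edge_cases:
  assumes "4 \<le> t * (\<beta> - \<alpha>)"
  shows "edge t \<alpha> \<beta> s = step (t * (s - \<alpha>)) \<and> t * (s - \<beta>) \<le> - 2
    \<or> edge t \<alpha> \<beta> s = 1 - step (t * (s - \<beta>) + 3) \<and> 2 \<le> t * (s - \<alpha>)"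
proof (cases "t * (s - \<beta>) \<le> - 2")
  case True
  then show ?thesis
    by (simp add: edge_def step_eq_0)
next
  case False
  have "t * (s - \<alpha>) = t * (s - \<beta>) + t * (\<beta> - \<alpha>)"
    by (simp add: algebra_simps)
  then have "2 \<le> t * (s - \<alpha>)"
    using False assms by linarith
  then show ?thesis
    by (simp add: edge_def step_eq_1)
qed

lemma edge_nonneg: "4 \<le> t * (\<beta> - \<alpha>) \<Longrightarrow> 0 \<le> edge t \<alpha> \<beta> s"
  and edge_le_1: "4 \<le> t * (\<beta> - \<alpha>) \<Longrightarrow> edge t \<alpha> \<beta> s \<le> 1"
  using edge_cases[of t \<beta> \<alpha> s] step_nonneg step_le_1 by auto

lemma edge_eq_0:
  assumes "4 \<le> t * (\<beta> - \<alpha>)" "t * (s - \<alpha>) < 1 \<or> - 1 < t * (s - \<beta>)"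
  shows "edge t \<alpha> \<beta> s = 0"
  using edge_cases[OF assms(1), of s] assms(2) step_eq_0[of "t * (s - \<alpha>)"] step_eq_1[of "t * (s - \<beta>) + 3"]
  by fastforce

lemma edge_eq_1: "2 \<le> t * (s - \<alpha>) \<Longrightarrow> t * (s - \<beta>) \<le> - 2 \<Longrightarrow> edge t \<alpha> \<beta> s = 1"
  by (simp add: edge_def step_eq_0 step_eq_1)

definition edge' :: "real \<Rightarrow> real \<Rightarrow> real \<Rightarrow> real \<Rightarrow> real" where
  "edge' t \<alpha> \<beta> s = t * step' (t * (s - \<alpha>)) - t * step' (t * (s - \<beta>) + 3)"

lemma DERIV_edge: "(edge t \<alpha> \<beta> has_real_derivative edge' t \<alpha> \<beta> s) (at s)"
proof -
  have 1: "((\<lambda>s. t * (s - \<alpha>)) has_real_derivative t) (at s)"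
    by (auto intro!: derivative_eq_intros)
  have 2: "((\<lambda>s. t * (s - \<beta>) + 3) has_real_derivative t) (at s)"
    by (auto intro!: derivative_eq_intros)
  show ?thesis
    using DERIV_diff[OF DERIV_chain'[where g = step, OF 1 DERIV_step] DERIV_chain'[where g = step, OF 2 DERIV_step]]
    unfolding edge_def[abs_def] edge'_def by (simp only: mult.commute)
qed

lemma continuous_on_edge': "continuous_on V (edge' t \<alpha> \<beta>)"
  unfolding edge'_def[abs_def]
  by (intro continuous_on_diff continuous_on_mult continuous_on_const
      continuous_on_compose2[OF continuous_on_step'[of UNIV]])
    (auto intro!: continuous_intros)

lemma C1_on_edge: "C1_on V (\<lambda>x::real^'n. edge t \<alpha> \<beta> (x $ j))"
  by (rule C1_on_compose[OF C1_on_component DERIV_edge continuous_on_edge'])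

lemma grad_edge: "grad (\<lambda>x::real^'n. edge t \<alpha> \<beta> (x $ j)) x = edge' t \<alpha> \<beta> (x $ j) *\<^sub>R axis j 1"
  using grad_compose[OF C1_on_component[of UNIV j] UNIV_I DERIV_edge] by simp

lemma C1_on_box_cutoff: "C1_on V (box_cutoff t a b)"
  unfolding box_cutoff_def[abs_def] by (intro C1_on_prod C1_on_edge) simp

lemma grad_box_cutoff:
  "grad (box_cutoff t a b) x $ i
     = edge' t (a $ i) (b $ i) (x $ i) * (\<Prod>j\<in>UNIV - {i}. edge t (a $ j) (b $ j) (x $ j))"
proof -
  have "grad (box_cutoff t a b) x
      = (\<Sum>j\<in>UNIV. (\<Prod>l\<in>UNIV - {j}. edge t (a $ l) (b $ l) (x $ l)) *\<^sub>R (edge' t (a $ j) (b $ j) (x $ j) *\<^sub>R axis j 1))"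
    unfolding box_cutoff_def[abs_def]
    using grad_prod[of UNIV UNIV "\<lambda>j x. edge t (a $ j) (b $ j) (x $ j)" x, OF finite C1_on_edge UNIV_I]
    by (simp only: grad_edge)
  then show ?thesis
    by (simp add: axis_def if_distrib sum.delta cong: if_cong)
qed

lemma box_cutoff_nonneg: "(\<And>j. 4 \<le> t * (b $ j - a $ j)) \<Longrightarrow> 0 \<le> box_cutoff t a b x"
  unfolding box_cutoff_def by (intro prod_nonneg ballI edge_nonneg)

lemma box_cutoff_le_1: "(\<And>j. 4 \<le> t * (b $ j - a $ j)) \<Longrightarrow> box_cutoff t a b x \<le> 1"
  unfolding box_cutoff_def by (intro prod_le_1) (auto intro: edge_nonneg edge_le_1)

lemma box_cutoff_compact_support:
  fixes a b :: "real^'n"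
  assumes t: "t > 0" "\<And>j. 4 \<le> t * (b $ j - a $ j)"
  obtains S where "compact S" "S \<subseteq> box a b" "\<And>x. x \<notin> S \<Longrightarrow> box_cutoff t a b x = 0"
proof
  \<comment> \<open>An edge factor is 0 within distance 1 / t of either of its faces.\<close>
  let ?S = "cbox (\<chi> j. a $ j + 1 / t) (\<chi> j. b $ j - 1 / t)"
  show "compact ?S"
    by (rule compact_cbox)
  show "?S \<subseteq> box a b"
  proof
    fix x assume x: "x \<in> ?S"
    have "a $ i < x $ i \<and> x $ i < b $ i" for i
    proof -
      have "a $ i + 1 / t \<le> x $ i" "x $ i \<le> b $ i - 1 / t" "1 / t > 0"
        using x t(1) by (auto simp: mem_box_cart)
      then show ?thesis by linarith
    qed
    then show "x \<in> box a b"
      by (simp add: mem_box_cart)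
  qed
  fix x :: "real^'n" assume "x \<notin> ?S"
  then obtain i where "x $ i < a $ i + 1 / t \<or> b $ i - 1 / t < x $ i"
    by (auto simp: mem_box_cart not_le)
  then have "t * (x $ i - a $ i) < 1 \<or> - 1 < t * (x $ i - b $ i)"
    using t(1) by (auto simp: field_simps)
  then have "edge t (a $ i) (b $ i) (x $ i) = 0"
    by (rule edge_eq_0[OF t(2)])
  then show "box_cutoff t a b x = 0"
    unfolding box_cutoff_def by (intro prod_zero) auto
qed

text \<open>Only the part of the i-th partial derivative that comes from the rising flank at the
  lower face; the falling flank is a translate of it with opposite sign.\<close>

definition box_layer :: "real \<Rightarrow> real^'n \<Rightarrow> real^'n \<Rightarrow> 'n \<Rightarrow> real^'n \<Rightarrow> real" where
  "box_layer t a b i x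
     = t * step' (t * (x $ i - a $ i)) * (\<Prod>j\<in>UNIV - {i}. edge t (a $ j) (b $ j) (x $ j))"

text \<open>The layer of the cut-off at one face is moved onto the layer at the opposite face. For
  \<open>F x = x $ i\<close> this computes the mass of the layer.\<close>

lemma box_cutoff_layer:
  fixes a b :: "real^'n" and i :: 'n
  assumes t: "t > 0" "\<And>j. 4 \<le> t * (b $ j - a $ j)"
  defines "e \<equiv> (b $ i - a $ i - 3 / t) *\<^sub>R axis i 1"
    and "m \<equiv> box_layer t a b i"
  shows "\<And>x. 0 \<le> m x"
    and "\<And>x. m x \<noteq> 0 \<Longrightarrow> x \<in> cbox a b"
    and "continuous_on UNIV m" and "integrable lebesgue m"
    and "\<And>F :: real^'n \<Rightarrow> real. continuous_on UNIV F \<Longrightarrow>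
      (LINT x|lebesgue. F x * grad (box_cutoff t a b) x $ i) = (LINT x|lebesgue. (F x - F (x + e)) * m x)"
    and "(LINT x|lebesgue. m x) \<le> measure lebesgue (box a b) * 4 / (b $ i - a $ i)"
proof -
  define P where "P x = (\<Prod>j\<in>UNIV - {i}. edge t (a $ j) (b $ j) (x $ j))" for x :: "real^'n"
  have m: "m x = t * step' (t * (x $ i - a $ i)) * P x" for x
    by (simp add: m_def box_layer_def P_def)
  have P0: "0 \<le> P x" for x
    unfolding P_def by (intro prod_nonneg ballI edge_nonneg t)
  show m0: "0 \<le> m x" for x
    unfolding m using t(1) P0 step'_nonneg by (intro mult_nonneg_nonneg) auto
  show ms: "x \<in> cbox a b" if "m x \<noteq> 0" for x
    unfolding mem_box_cart
  proof
    fix j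
    show "a $ j \<le> x $ j \<and> x $ j \<le> b $ j"
    proof (cases "j = i")
      case True
      have "step' (t * (x $ i - a $ i)) \<noteq> 0"
        using that by (auto simp: m)
      then have "1 < t * (x $ i - a $ i)" "t * (x $ i - a $ i) < 2"
        using step'_eq_0[of "t * (x $ i - a $ i)"] by force+
      then have "t * 0 < t * (x $ i - a $ i)" "t * (x $ i - a $ i) < t * (b $ i - a $ i)"
        using t(2)[of i] by linarith+
      then have "0 < x $ i - a $ i" "x $ i - a $ i < b $ i - a $ i"
        using t(1) by (simp_all only: mult_less_cancel_left_pos)
      then show ?thesis
        using True by simp
    next
      case False
      have "P x \<noteq> 0"
        using that by (auto simp: m)
      then have "edge t (a $ j) (b $ j) (x $ j) \<noteq> 0"
        using False unfolding P_def by (simp add: prod_zero_iff)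
      then have "1 \<le> t * (x $ j - a $ j)" "t * (x $ j - b $ j) \<le> - 1"
        using edge_eq_0[OF t(2)[of j], of "x $ j"] by force+
      then have "t * 0 < t * (x $ j - a $ j)" "t * (x $ j - b $ j) < t * 0"
        by simp_all
      then have "0 < x $ j - a $ j" "x $ j - b $ j < 0"
        using t(1) by (simp_all only: mult_less_cancel_left_pos)
      then show ?thesis
        by simp
    qed
  qed
  then have mz: "m x = 0" if "x \<notin> cbox a b" for x
    using that by blast
  have cP: "continuous_on UNIV P"
    unfolding P_def by (intro continuous_on_prod C1_on_continuous(1)[OF C1_on_edge])
  have cst: "continuous_on UNIV (\<lambda>x::real^'n. step' (t * (x $ i - a $ i)))"
    by (rule continuous_on_compose2[OF continuous_on_step'[of UNIV]]) (auto intro!: continuous_intros)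
  show cm: "continuous_on UNIV m"
    unfolding m[abs_def] by (intro continuous_on_mult continuous_on_const cP cst)
  show im: "integrable lebesgue m"
    by (rule integrable_continuous_compact_support[OF cm compact_cbox mz])
  \<comment> \<open>The shift \<open>e\<close> points along coordinate \<open>i\<close>, the one
    left out of the product.\<close>
  have Pe: "P (x - e) = P x" for x
    unfolding P_def e_def by (rule prod.cong) (auto simp: axis_def)
  have grad: "grad (box_cutoff t a b) x $ i = m x - m (x - e)" for x
  proof -
    \<comment> \<open>Here the offset 3 in \<open>edge\<close> pays off: shifting by one period less
      \<open>3 / t\<close> maps one flank exactly onto the other.\<close>
    have "t * ((x - e) $ i - a $ i) = t * (x $ i - b $ i) + 3"
      using t(1) by (simp add: e_def axis_def field_simps)
    then show ?thesis
      unfolding grad_box_cutoff m Pe edge'_def P_def[symmetric] by (simp only: left_diff_distrib)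
  qed
  show shift: "(LINT x|lebesgue. F x * grad (box_cutoff t a b) x $ i) = (LINT x|lebesgue. (F x - F (x + e)) * m x)"
    if F: "continuous_on UNIV F" for F :: "real^'n \<Rightarrow> real"
  proof -
    have cFe: "continuous_on UNIV (\<lambda>x. F (x + e))" and cme: "continuous_on UNIV (\<lambda>x. m (x - e))"
      by (auto intro!: continuous_on_compose2[OF F] continuous_on_compose2[OF cm] continuous_intros)
    have i1: "integrable lebesgue (\<lambda>x. F x * m x)"
      by (rule integrable_continuous_compact_support[OF _ compact_cbox[of a b]])
        (auto intro: continuous_on_mult F cm simp: mz)
    have i2: "integrable lebesgue (\<lambda>x. F (x + e) * m x)"
      by (rule integrable_continuous_compact_support[OF _ compact_cbox[of a b]])
        (auto intro: continuous_on_mult cFe cm simp: mz)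
    have c3: "continuous_on UNIV (\<lambda>x. F x * m (x - e))"
      by (intro continuous_on_mult F cme)
    have i3: "integrable lebesgue (\<lambda>x. F x * m (x - e))"
    proof (rule integrable_continuous_compact_support[OF c3])
      show "compact ((+) e ` cbox a b)"
        by (rule compact_translation[OF compact_cbox])
      show "F x * m (x - e) = 0" if "x \<notin> (+) e ` cbox a b" for x
      proof -
        have "x - e \<notin> cbox a b"
          using that image_eqI[of x "(+) e" "x - e" "cbox a b"] by auto
        then show ?thesis
          by (simp add: mz)
      qed
    qed
    have "(LINT x|lebesgue. F x * grad (box_cutoff t a b) x $ i)
        = (LINT x|lebesgue. F x * m x - F x * m (x - e))"
      by (simp only: grad right_diff_distrib)
    also have "\<dots> = (LINT x|lebesgue. F x * m x) - (LINT x|lebesgue. F x * m (x - e))"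
      by (rule Bochner_Integration.integral_diff[OF i1 i3])
    also have "(LINT x|lebesgue. F x * m (x - e)) = (LINT x|lebesgue. F (x + e) * m x)"
      using lebesgue_integral_translation[OF c3, of e] by simp
    also have "(LINT x|lebesgue. F x * m x) - \<dots> = (LINT x|lebesgue. F x * m x - F (x + e) * m x)"
      by (rule Bochner_Integration.integral_diff[OF i1 i2, symmetric])
    finally show ?thesis
      by (simp only: left_diff_distrib)
  qed
  \<comment> \<open>The length of the shift. From \<open>4 / t \<le> b $ i - a $ i\<close> it
    retains at least a quarter of the period, whence the constant 4 in the mass bound.\<close>
  define L where "L = b $ i - a $ i - 3 / t"
  have L: "(b $ i - a $ i) / 4 \<le> L" and ab: "0 < b $ i - a $ i"
  proof -
    have *: "4 / t \<le> b $ i - a $ i"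
      using t(2)[of i] t(1) by (simp add: pos_divide_le_eq mult.commute)
    then show "(b $ i - a $ i) / 4 \<le> L"
      by (simp add: L_def)
    show "0 < b $ i - a $ i"
      using t(1) by (intro less_le_trans[OF _ *]) simp
  qed
  obtain S where S: "compact S" "S \<subseteq> box a b" "\<And>x. x \<notin> S \<Longrightarrow> box_cutoff t a b x = 0"
    using box_cutoff_compact_support[OF t] by blast
  have cc: "continuous_on UNIV (box_cutoff t a b)" "continuous_on UNIV (grad (box_cutoff t a b))"
    by (rule C1_on_continuous[OF C1_on_box_cutoff])+
  have i\<psi>: "integrable lebesgue (box_cutoff t a b)"
    by (rule integrable_continuous_compact_support[OF cc(1) S(1,3)])
  have gz: "grad (box_cutoff t a b) x = 0" if "x \<notin> S" for x
    by (rule grad_eqI[OF GDERIV_0_off_closed[OF compact_imp_closed[OF S(1)] S(3) that]])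
  have ig: "integrable lebesgue (\<lambda>x. x $ i * grad (box_cutoff t a b) x $ i)"
  proof (rule integrable_continuous_compact_support[OF _ S(1)])
    show "continuous_on UNIV (\<lambda>x. x $ i * grad (box_cutoff t a b) x $ i)"
      by (intro continuous_on_mult continuous_on_component cc continuous_on_id)
  qed (simp add: gz)
  \<comment> \<open>The i-th derivative of \<open>x $ i\<close> times the cut-off integrates to 0.
    By the shift formula its first part is \<open>- L\<close> times the mass of the layer, so
    \<open>L\<close> times the mass is the integral of the cut-off, at most the volume of the
    cell.\<close>
  have "0 = (LINT x|lebesgue. grad (\<lambda>x. x $ i * box_cutoff t a b x) x \<bullet> axis i 1)"
  proof (rule integral_grad_compact_support[OF _ S(1), symmetric])
    show "C1_on UNIV (\<lambda>x. x $ i * box_cutoff t a b x)"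
      by (intro C1_on_mult C1_on_component C1_on_box_cutoff)
  qed (simp add: S(3))
  also have "\<dots> = (LINT x|lebesgue. x $ i * grad (box_cutoff t a b) x $ i + box_cutoff t a b x)"
    using grad_mult[OF C1_on_component[of UNIV i] C1_on_box_cutoff[of UNIV t a b] UNIV_I]
    by (simp add: inner_add_left inner_axis)
  also have "\<dots> = (LINT x|lebesgue. x $ i * grad (box_cutoff t a b) x $ i) + (LINT x|lebesgue. box_cutoff t a b x)"
    by (rule Bochner_Integration.integral_add[OF ig i\<psi>])
  also have "(LINT x|lebesgue. x $ i * grad (box_cutoff t a b) x $ i) = (LINT x|lebesgue. (x $ i - (x + e) $ i) * m x)"
    by (rule shift) (intro continuous_on_component continuous_on_id)
  also have "\<dots> = - L * (LINT x|lebesgue. m x)"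
    by (simp add: e_def axis_def L_def)
  finally have "L * (LINT x|lebesgue. m x) = (LINT x|lebesgue. box_cutoff t a b x)"
    by linarith
  also have "\<dots> \<le> (LINT x|lebesgue. indicator (box a b) x)"
  proof (rule integral_mono[OF i\<psi>])
    show "integrable lebesgue (indicator (box a b) :: _ \<Rightarrow> real)"
      by (simp add: integrable_indicator_iff emeasure_lborel_box_finite[simplified])
    show "box_cutoff t a b x \<le> indicator (box a b) x" for x
    proof (cases "x \<in> box a b")
      case False
      then have "x \<notin> S"
        using S(2) by blast
      then show ?thesis
        using S(3) by simp
    qed (simp add: box_cutoff_le_1[OF t(2)])
  qed
  finally have "L * (LINT x|lebesgue. m x) \<le> measure lebesgue (box a b)"
    by simp
  moreover have "(b $ i - a $ i) / 4 * (LINT x|lebesgue. m x) \<le> L * (LINT x|lebesgue. m x)"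
    using L m0 by (intro mult_right_mono Bochner_Integration.integral_nonneg)
  ultimately show "(LINT x|lebesgue. m x) \<le> measure lebesgue (box a b) * 4 / (b $ i - a $ i)"
    using ab by (simp add: field_simps)
qed

text \<open>The shift between opposite layers misses a full period by \<open>3 / t k\<close>. For
  periodic \<open>F\<close> the difference across the cell is thus one over a distance tending to 0,
  small by uniform continuity and weighted with a bounded mass.\<close>

lemma box_cutoff_periodic_tendsto_0:
  fixes a b :: "real^'n" and F :: "real^'n \<Rightarrow> real"
  assumes t: "\<And>k. t k > 0" "\<And>k j. 4 \<le> t k * (b $ j - a $ j)" "filterlim t at_top sequentially"
    and F: "continuous_on UNIV F" "periodic a b F"
  shows "(\<lambda>k. LINT x|lebesgue. F x * grad (box_cutoff (t k) a b) x $ i) \<longlonglongrightarrow> 0"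
proof (rule LIMSEQ_I)
  fix r :: real assume r: "r > 0"
  define Q where "Q = measure lebesgue (box a b) * 4 / (b $ i - a $ i)"
  have ab: "a $ j < b $ j" for j
  proof -
    have "0 < t 0 * (b $ j - a $ j)"
      using t(2)[of 0 j] by linarith
    then show ?thesis
      using t(1)[of 0] by (simp add: zero_less_mult_iff)
  qed
  have Q0: "0 \<le> Q"
    unfolding Q_def using ab[of i] by (intro divide_nonneg_nonneg) auto
  define \<epsilon> where "\<epsilon> = r / (Q + 1)"
  have \<epsilon>: "\<epsilon> > 0"
    using r Q0 by (simp add: \<epsilon>_def)
  \<comment> \<open>The cell prolonged by one period downwards in each coordinate, so that the
    points moved back by \<open>3 / t k\<close> remain in it.\<close>
  define K where "K = cbox (a - (b - a)) b"
  have "uniformly_continuous_on K F"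
    unfolding K_def by (rule compact_uniformly_continuous[OF continuous_on_subset[OF F(1)]]) auto
  then obtain \<delta> where \<delta>: "\<delta> > 0" "\<And>x y. x \<in> K \<Longrightarrow> y \<in> K \<Longrightarrow> dist y x < \<delta> \<Longrightarrow> dist (F y) (F x) < \<epsilon>"
    using \<epsilon> unfolding uniformly_continuous_on_def by metis
  have "\<forall>\<^sub>F k in sequentially. 3 / \<delta> < t k"
    using t(3) by (auto simp: filterlim_at_top_dense)
  then obtain N where N: "\<And>k. k \<ge> N \<Longrightarrow> 3 / \<delta> < t k"
    unfolding eventually_sequentially by blast
  have "norm ((LINT x|lebesgue. F x * grad (box_cutoff (t k) a b) x $ i) - 0) < r" if k: "k \<ge> N" for k
  proof -
    define e :: "real^'n" where "e = (b $ i - a $ i - 3 / t k) *\<^sub>R axis i 1"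
    define m where "m = box_layer (t k) a b i"
    note layer = box_cutoff_layer[OF t(1)[of k] t(2)[of k], where i = i, folded e_def m_def]
    have cFe: "continuous_on UNIV (\<lambda>x. F (x + e))"
      by (auto intro!: continuous_on_compose2[OF F(1)] continuous_intros)
    have pt: "\<bar>(F x - F (x + e)) * m x\<bar> \<le> \<epsilon> * m x" for x
    proof (cases "m x = 0")
      case False
      then have x: "x \<in> cbox a b"
        by (rule layer(2))
      \<comment> \<open>The point \<open>x + e\<close> reduced by one period.\<close>
      define y where "y = x - (3 / t k) *\<^sub>R axis i (1::real)"
      have "x + e = y + (b $ i - a $ i) *\<^sub>R axis i 1"
        by (simp add: e_def y_def algebra_simps)
      then have Fy: "F (x + e) = F y"
        using F(2) by (simp add: periodic_def)
      have tk: "0 < 3 / t k" "3 / t k \<le> b $ i - a $ i"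
      proof -
        show "0 < 3 / t k"
          using t(1) by simp
        have "3 \<le> (b $ i - a $ i) * t k"
          using t(2)[of k i] by (simp add: mult.commute)
        then show "3 / t k \<le> b $ i - a $ i"
          using t(1)[of k] by (simp add: pos_divide_le_eq)
      qed
      have "x \<in> K"
        unfolding K_def mem_box_cart
      proof
        fix j
        show "(a - (b - a)) $ j \<le> x $ j \<and> x $ j \<le> b $ j"
          using x ab[of j] unfolding mem_box_cart by (auto dest: spec[of _ j])
      qed
      moreover have "y \<in> K"
        unfolding K_def mem_box_cart
      proof
        fix j
        have "a $ j \<le> x $ j" "x $ j \<le> b $ j"
          using x by (simp_all add: mem_box_cart)
        moreover have "y $ j = x $ j - (if j = i then 3 / t k else 0)" "(a - (b - a)) $ j = a $ j - (b $ j - a $ j)"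
          by (simp_all add: y_def axis_def)
        moreover have "0 \<le> (if j = i then 3 / t k else 0)" "(if j = i then 3 / t k else 0) \<le> b $ j - a $ j"
          using tk ab[of j] by auto
        ultimately show "(a - (b - a)) $ j \<le> y $ j \<and> y $ j \<le> b $ j"
          by linarith
      qed
      moreover have "dist y x < \<delta>"
      proof -
        have "3 / t k < \<delta>"
          using N[OF k] \<delta>(1) t(1)[of k] by (simp add: field_simps)
        then show ?thesis
          using tk by (simp add: y_def dist_norm)
      qed
      ultimately have "dist (F y) (F x) < \<epsilon>"
        by (rule \<delta>(2))
      then have "\<bar>F x - F (x + e)\<bar> \<le> \<epsilon>"
        by (simp add: Fy dist_real_def abs_minus_commute)
      then show ?thesis
        using layer(1)[of x] by (simp add: abs_mult mult_right_mono)
    qed simp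
    have int: "integrable lebesgue (\<lambda>x. (F x - F (x + e)) * m x)"
    proof (rule integrable_continuous_compact_support[OF _ compact_cbox[of a b]])
      show "continuous_on UNIV (\<lambda>x. (F x - F (x + e)) * m x)"
        by (intro continuous_on_mult continuous_on_diff F cFe layer(3))
      show "(F x - F (x + e)) * m x = 0" if "x \<notin> cbox a b" for x
        using that layer(2)[of x] by auto
    qed
    have "\<bar>LINT x|lebesgue. F x * grad (box_cutoff (t k) a b) x $ i\<bar> = \<bar>LINT x|lebesgue. (F x - F (x + e)) * m x\<bar>"
      by (simp only: layer(5)[OF F(1)])
    also have "\<dots> \<le> (LINT x|lebesgue. \<bar>(F x - F (x + e)) * m x\<bar>)"
      by (rule integral_abs_bound)
    also have "\<dots> \<le> (LINT x|lebesgue. \<epsilon> * m x)"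
      using pt int layer(4) by (intro integral_mono integrable_abs integrable_mult_right) auto
    also have "\<dots> = \<epsilon> * (LINT x|lebesgue. m x)"
      by simp
    also have "\<dots> \<le> \<epsilon> * Q"
      unfolding Q_def using layer(6) \<epsilon> by (intro mult_left_mono) auto
    also have "\<dots> < \<epsilon> * (Q + 1)"
      using \<epsilon> by simp
    also have "\<dots> = r"
      using Q0 by (simp add: \<epsilon>_def)
    finally show ?thesis
      by simp
  qed
  then show "\<exists>N. \<forall>k\<ge>N. norm ((LINT x|lebesgue. F x * grad (box_cutoff (t k) a b) x $ i) - 0) < r"
    by blast
qed

context divergence_field
begin

text \<open>The layer term splits into one integral per coordinate, each with the periodic factor
  \<open>F i\<close>, the product of \<open>v\<close> and a component of \<open>G\<close>.\<close>

lemma defect_periodic: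
  assumes \<Omega>: "\<Omega> = box a b" and ab: "\<And>i. a $ i < b $ i"
    and G: "continuous_on UNIV G" "\<And>i. periodic a b (\<lambda>x. G x $ i)"
    and v: "C1_on UNIV v" "periodic a b v"
  shows "defect v = 0"
proof -
  \<comment> \<open>The sum dominates every single \<open>4 / (b $ j - a $ j)\<close>, so the flanks
    are separated in all coordinates for every \<open>k\<close>; the 1 ensures positivity.\<close>
  define T where "T = 1 + (\<Sum>j\<in>UNIV. 4 / (b $ j - a $ j))"
  define t where "t k = T + real k" for k
  have Tj: "4 / (b $ j - a $ j) \<le> T" for j
  proof -
    have "4 / (b $ j - a $ j) \<le> (\<Sum>j\<in>UNIV. 4 / (b $ j - a $ j))"
      using ab by (intro member_le_sum) (auto simp: less_imp_le)
    then show ?thesis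
      by (simp add: T_def)
  qed
  have t: "t k > 0" "4 \<le> t k * (b $ j - a $ j)" for k j
  proof -
    have "0 \<le> (\<Sum>j\<in>UNIV. 4 / (b $ j - a $ j))"
      using ab by (intro sum_nonneg) (simp add: less_imp_le)
    then show "t k > 0"
      by (simp add: t_def T_def)
    have "4 / (b $ j - a $ j) \<le> t k"
      using Tj[of j] by (simp add: t_def)
    then show "4 \<le> t k * (b $ j - a $ j)"
      using ab[of j] by (simp add: pos_divide_le_eq)
  qed
  have t_lim: "filterlim t at_top sequentially"
    unfolding t_def by (rule filterlim_tendsto_add_at_top[OF tendsto_const filterlim_real_sequentially])
  define \<psi> where "\<psi> k = box_cutoff (t k) a b" for k
  have C1: "C1_on V (\<psi> k)" for V k
    unfolding \<psi>_def by (rule C1_on_box_cutoff)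
  have supp: "\<exists>S. compact S \<and> S \<subseteq> \<Omega> \<and> (\<forall>x. x \<notin> S \<longrightarrow> \<psi> k x = 0)" for k
    unfolding \<psi>_def \<Omega> using box_cutoff_compact_support[OF t(1)[of k] t(2)[of k]] by metis
  have gz: "grad (\<psi> k) x = 0" if x: "x \<notin> \<Omega>" for k x
  proof -
    obtain S where S: "compact S" "S \<subseteq> \<Omega>" "\<And>x. x \<notin> S \<Longrightarrow> \<psi> k x = 0"
      using supp by blast
    have "x \<notin> S"
      using S(2) x by blast
    then show ?thesis
      by (intro grad_eqI[OF GDERIV_0_off_closed[OF compact_imp_closed[OF S(1)] S(3)]])
  qed
  define F where "F i x = v x * G x $ i" for i x
  have F: "continuous_on UNIV (F i)" "periodic a b (F i)" for i
  proof -
    show "continuous_on UNIV (F i)"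
      unfolding F_def by (intro continuous_on_mult continuous_on_component C1_on_continuous[OF v(1)] G(1))
    show "periodic a b (F i)"
      using G(2)[of i] v(2) by (simp add: F_def periodic_def)
  qed
  have pt: "G x \<bullet> (v x *\<^sub>R grad (\<psi> k) x) = (\<Sum>i\<in>UNIV. F i x * grad (\<psi> k) x $ i)" for k x
    by (simp add: inner_vec_def F_def sum_distrib_left mult_ac)
  have cF: "continuous_on UNIV (\<lambda>x. F i x * grad (\<psi> k) x $ i)" for i k
    by (intro continuous_on_mult continuous_on_component F C1_on_continuous[OF C1])
  have iF: "integrable lebesgue (\<lambda>x. F i x * grad (\<psi> k) x $ i)" for i k
    by (rule integrable_continuous_compact_support[OF cF compact_closure_domain])
      (metis closure_subset gz mult_zero_right subsetD zero_index)
  show ?thesis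
  proof (rule defect_eq_0_if_boundary_layer_vanishes[where \<psi> = \<psi> and \<eta> = "\<lambda>k x. \<psi> k x * v x"
        and R = "\<lambda>k x. v x *\<^sub>R grad (\<psi> k) x"])
    show "continuous_on (closure \<Omega>) v" "continuous_on (closure \<Omega>) (grad v)"
      by (rule C1_on_continuous_closure[OF v(1)]; simp)+
    show "test_function \<Omega> (\<lambda>x. \<psi> k x * v x)" for k
    proof -
      obtain S where "compact S" "S \<subseteq> \<Omega>" "\<And>x. x \<notin> S \<Longrightarrow> \<psi> k x = 0"
        using supp by blast
      then show ?thesis
        by (intro test_functionI[of _ S] C1_on_mult C1 v(1)) auto
    qed
    show "grad (\<lambda>x. \<psi> k x * v x) x = \<psi> k x *\<^sub>R grad v x + v x *\<^sub>R grad (\<psi> k) x" for k x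
      by (rule grad_mult[OF C1 v(1) UNIV_I])
    show "0 \<le> \<psi> k x" "\<psi> k x \<le> 1" for k x
      unfolding \<psi>_def by (rule box_cutoff_nonneg[OF t(2)], rule box_cutoff_le_1[OF t(2)])
    show "v x = 0 \<and> grad v x = 0 \<or> (\<lambda>k. \<psi> k x) \<longlonglongrightarrow> 1" if x: "x \<in> \<Omega>" for x
    proof (rule disjI2)
      have x': "a $ j < x $ j" "x $ j < b $ j" for j
        using x by (auto simp: \<Omega> mem_box_cart)
      have "\<forall>\<^sub>F k in sequentially. \<forall>j. edge (t k) (a $ j) (b $ j) (x $ j) = 1"
      proof (rule eventually_all_finite)
        fix j
        have "\<forall>\<^sub>F k in sequentially. 2 / (x $ j - a $ j) < t k" "\<forall>\<^sub>F k in sequentially. 2 / (b $ j - x $ j) < t k"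
          using t_lim by (auto simp: filterlim_at_top_dense)
        then show "\<forall>\<^sub>F k in sequentially. edge (t k) (a $ j) (b $ j) (x $ j) = 1"
        proof eventually_elim
          case (elim k)
          have "2 < t k * (x $ j - a $ j)" "2 < t k * (b $ j - x $ j)"
            using elim x'[of j] by (simp_all add: pos_divide_less_eq)
          then show ?case
            by (intro edge_eq_1) (simp_all add: right_diff_distrib)
        qed
      qed
      then have "\<forall>\<^sub>F k in sequentially. \<psi> k x = 1"
        by eventually_elim (simp add: \<psi>_def box_cutoff_def)
      then show "(\<lambda>k. \<psi> k x) \<longlonglongrightarrow> 1"
        by (rule tendsto_eventually)
    qed
    show "integrable (lebesgue_on \<Omega>) (\<lambda>x. G x \<bullet> (v x *\<^sub>R grad (\<psi> k) x))" for k
      by (intro integrable_continuous continuous_on_inner continuous_field continuous_on_scaleR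
          C1_on_continuous_closure[OF v(1)] C1_on_continuous_closure[OF C1[of UNIV]]) simp_all
    have "(LINT x|lebesgue_on \<Omega>. G x \<bullet> (v x *\<^sub>R grad (\<psi> k) x)) = (\<Sum>i\<in>UNIV. LINT x|lebesgue. F i x * grad (\<psi> k) x $ i)" for k
    proof -
      have "(LINT x|lebesgue_on \<Omega>. G x \<bullet> (v x *\<^sub>R grad (\<psi> k) x))
          = (LINT x|lebesgue. indicator \<Omega> x *\<^sub>R (\<Sum>i\<in>UNIV. F i x * grad (\<psi> k) x $ i))"
        unfolding pt using domain_sets by (intro integral_restrict_space) simp
      also have "(\<lambda>x. indicator \<Omega> x *\<^sub>R (\<Sum>i\<in>UNIV. F i x * grad (\<psi> k) x $ i)) = (\<lambda>x. \<Sum>i\<in>UNIV. F i x * grad (\<psi> k) x $ i)"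
        using gz by (auto simp: indicator_def fun_eq_iff)
      finally show ?thesis
        using iF by (simp add: Bochner_Integration.integral_sum)
    qed
    moreover have "(\<lambda>k. \<Sum>i\<in>UNIV. LINT x|lebesgue. F i x * grad (\<psi> k) x $ i) \<longlonglongrightarrow> (\<Sum>i\<in>(UNIV::'n set). 0)"
      unfolding \<psi>_def by (intro tendsto_sum box_cutoff_periodic_tendsto_0 t t_lim F)
    ultimately show "(\<lambda>k. LINT x|lebesgue_on \<Omega>. G x \<bullet> (v x *\<^sub>R grad (\<psi> k) x)) \<longlonglongrightarrow> 0"
      by simp
  qed simp
qed

end

section \<open>Green's identity\<close>

text \<open>On a set of finite measure, \<open>1 + (v x)\<^sup>2\<close> is an integrable
  majorant.\<close>

lemma square_integrable_imp_integrable: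
  assumes "finite_measure (lebesgue_on \<Omega>)" "square_integrable \<Omega> v"
  shows "integrable (lebesgue_on \<Omega>) v"
proof (rule Bochner_Integration.integrable_bound)
  interpret finite_measure "lebesgue_on \<Omega>"
    by (rule assms)
  show "integrable (lebesgue_on \<Omega>) (\<lambda>x. 1 + (v x)\<^sup>2)"
    using assms(2) by (auto simp: square_integrable_def)
  show "v \<in> borel_measurable (lebesgue_on \<Omega>)"
    using assms(2) by (simp add: square_integrable_def)
  have "\<bar>s\<bar> \<le> 1 + s\<^sup>2" for s :: real
    using zero_le_power2[of "\<bar>s\<bar> - 1"] zero_le_power2[of s] by (simp add: power2_diff)
  then show "AE x in lebesgue_on \<Omega>. norm (v x) \<le> norm (1 + (v x)\<^sup>2)"
    by (intro AE_I2) (simp add: order_trans[OF _ abs_ge_self])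
qed

text \<open>Lebesgue measure is complete, so measurability of \<open>h\<close> is a conclusion. This
  matters for functions known only up to null sets, such as \<open>laplacian\<close>, and for the
  dissipation density.\<close>

lemma integrable_lebesgue_on_cong_AE:
  fixes f h :: "'a::euclidean_space \<Rightarrow> real"
  assumes \<Omega>: "\<Omega> \<in> sets lebesgue" and f: "integrable (lebesgue_on \<Omega>) f"
    and AE: "AE x in lebesgue_on \<Omega>. f x = h x"
  shows "integrable (lebesgue_on \<Omega>) h"
    and "integral\<^sup>L (lebesgue_on \<Omega>) h = integral\<^sup>L (lebesgue_on \<Omega>) f"
proof -
  have "AE x in lebesgue. x \<in> \<Omega> \<longrightarrow> f x = h x"
    using AE \<Omega> by (subst (asm) AE_restrict_space_iff) auto
  then have "AE x in lebesgue. indicator \<Omega> x *\<^sub>R f x = indicator \<Omega> x *\<^sub>R h x"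
    by eventually_elim (simp add: indicator_def)
  moreover have "(\<lambda>x. indicator \<Omega> x *\<^sub>R f x) \<in> borel_measurable lebesgue"
    using borel_measurable_integrable[OF f] \<Omega> by (simp add: borel_measurable_restrict_space_iff)
  ultimately have "(\<lambda>x. indicator \<Omega> x *\<^sub>R h x) \<in> borel_measurable lebesgue"
    by (rule borel_measurable_AE[rotated])
  then have h: "h \<in> borel_measurable (lebesgue_on \<Omega>)"
    using \<Omega> by (simp add: borel_measurable_restrict_space_iff)
  show "integrable (lebesgue_on \<Omega>) h"
    by (rule integrable_cong_AE_imp[OF f h AE])
  show "integral\<^sup>L (lebesgue_on \<Omega>) h = integral\<^sup>L (lebesgue_on \<Omega>) f"
    by (rule integral_cong_AE[OF h borel_measurable_integrable[OF f] AE[THEN AE_symmetric]])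
qed

lemma domain_with_bc_open_bounded:
  assumes "domain_with_bc \<Omega> \<V>"
  shows "open \<Omega>" and "bounded \<Omega>"
  using assms by (auto simp: domain_with_bc_def smooth_bounded_domain_def open_box)

lemma C1_up_to_boundary_iff: "C1_up_to_boundary \<Omega> v \<longleftrightarrow> (\<exists>W. open W \<and> closure \<Omega> \<subseteq> W \<and> C1_on W v)"
  unfolding C1_up_to_boundary_def Ck_on_1_iff ..

lemma divergence_field_grad:
  assumes "open \<Omega>" "bounded \<Omega>" "C1_up_to_boundary \<Omega> w" "is_weak_div \<Omega> (grad w) g" "square_integrable \<Omega> g"
  shows "divergence_field \<Omega> (grad w) g"
proof
  have "finite_measure (lebesgue_on \<Omega>)"
    using fmeasurableD2[OF lmeasurable_open[OF assms(2,1)]] assms(1)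
    by (intro finite_measureI) (simp add: emeasure_restrict_space borel_open sets_completionI_sets)
  then show "integrable (lebesgue_on \<Omega>) g"
    using assms(5) by (rule square_integrable_imp_integrable)
  show "continuous_on (closure \<Omega>) (grad w)"
    using assms(3) C1_on_continuous(2) continuous_on_subset unfolding C1_up_to_boundary_iff by blast
qed (use assms in auto)

text \<open>In the periodic case \<open>w\<close> and \<open>v\<close> are first upgraded to C1
  functions on the whole space; then the field \<open>grad w\<close> inherits the periodicity of
  \<open>w\<close>.\<close>

lemma defect_boundary_conditions:
  assumes bc: "domain_with_bc \<Omega> {w, v}" and w: "C1_up_to_boundary \<Omega> w" and v: "C1_up_to_boundary \<Omega> v"
    and df: "divergence_field \<Omega> (grad w) g"
  shows "divergence_field.defect \<Omega> (grad w) g v = 0"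
proof -
  interpret divergence_field \<Omega> "grad w" g
    by (rule df)
  obtain W where W: "open W" "closure \<Omega> \<subseteq> W" "C1_on W w"
    using w unfolding C1_up_to_boundary_iff by blast
  obtain V where V: "open V" "closure \<Omega> \<subseteq> V" "C1_on V v"
    using v unfolding C1_up_to_boundary_iff by blast
  from bc consider
      (periodic) a b where "\<forall>i. a $ i < b $ i" "\<Omega> = box a b" "periodic a b w" "periodic a b v"
    | (no_flux) "smooth_bounded_domain \<Omega>" "no_flux \<Omega> w"
    unfolding domain_with_bc_def by auto
  then show ?thesis
  proof cases
    case periodic
    have "box a b \<noteq> {}"
      using periodic(1) by (simp add: box_ne_empty Basis_vec_def inner_axis)
    then have cl: "closure \<Omega> = cbox a b"
      using periodic(2) by (simp add: closure_box)
    have w1: "C1_on UNIV w" and v1: "C1_on UNIV v"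
      using periodic periodic_imp_C1_on_UNIV[of a b w W] periodic_imp_C1_on_UNIV[of a b v V] W V cl by auto
    have "periodic a b (\<lambda>x. grad w x $ i)" for i
      using periodic(3) grad_translation[OF w1] unfolding periodic_def by metis
    then show ?thesis
      using periodic(1,2,4) w1 v1 by (intro defect_periodic C1_on_continuous) auto
  next
    case no_flux
    then show ?thesis
      using V by (intro defect_no_flux[of V]) (auto simp: no_flux_def)
  qed
qed

text \<open>Everything is done for the square-integrable representative \<open>g\<close> of the
  divergence, and carried over to \<open>laplacian\<close> by almost everywhere equality.\<close>

lemma Green_identity:
  assumes bc: "domain_with_bc \<Omega> {w, v}" and w: "regular \<Omega> w" and v: "C1_up_to_boundary \<Omega> v"
  shows "integrable (lebesgue_on \<Omega>) (\<lambda>x. laplacian \<Omega> w x * v x)"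
    and "integrable (lebesgue_on \<Omega>) (\<lambda>x. grad w x \<bullet> grad v x)"
    and "(LINT x|lebesgue_on \<Omega>. grad w x \<bullet> grad v x + laplacian \<Omega> w x * v x) = 0"
proof -
  note open_bounded = domain_with_bc_open_bounded[OF bc]
  obtain g where g: "is_weak_div \<Omega> (grad w) g" "square_integrable \<Omega> g" and w1: "C1_up_to_boundary \<Omega> w"
    using w unfolding regular_def by blast
  interpret divergence_field \<Omega> "grad w" g
    by (rule divergence_field_grad[OF open_bounded w1 g])
  obtain V where V: "open V" "closure \<Omega> \<subseteq> V" "C1_on V v"
    using v unfolding C1_up_to_boundary_iff by blast
  note cv = C1_on_continuous_closure[OF V(3,2)]
  show int: "integrable (lebesgue_on \<Omega>) (\<lambda>x. grad w x \<bullet> grad v x)"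
    by (rule integrable_defect(1)[OF cv])
  have AE: "AE x in lebesgue_on \<Omega>. laplacian \<Omega> w x = g x"
    unfolding laplacian_def by (rule weak_div_AE_eq[OF open_domain g(1)])
  have "AE x in lebesgue_on \<Omega>. g x * v x = laplacian \<Omega> w x * v x"
    using AE by eventually_elim simp
  then show "integrable (lebesgue_on \<Omega>) (\<lambda>x. laplacian \<Omega> w x * v x)"
    by (rule integrable_lebesgue_on_cong_AE(1)[OF domain_sets integrable_defect(2)[OF cv]])
  have "AE x in lebesgue_on \<Omega>. grad w x \<bullet> grad v x + g x * v x = grad w x \<bullet> grad v x + laplacian \<Omega> w x * v x"
    using AE by eventually_elim simp
  then have "(LINT x|lebesgue_on \<Omega>. grad w x \<bullet> grad v x + laplacian \<Omega> w x * v x) = defect v"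
    unfolding defect_def
    by (rule integrable_lebesgue_on_cong_AE(2)[OF domain_sets integrable_defect(3)[OF cv]])
  also have "\<dots> = 0"
    by (rule defect_boundary_conditions[OF bc w1 v divergence_field_axioms])
  finally show "(LINT x|lebesgue_on \<Omega>. grad w x \<bullet> grad v x + laplacian \<Omega> w x * v x) = 0" .
qed

section \<open>Square integrability, and linear combinations of the unknowns\<close>

lemma integrable_square_integrable_mult:
  assumes "square_integrable \<Omega> u" "square_integrable \<Omega> v"
  shows "integrable (lebesgue_on \<Omega>) (\<lambda>x. u x * v x)"
proof (rule Bochner_Integration.integrable_bound)
  show "integrable (lebesgue_on \<Omega>) (\<lambda>x. (u x)\<^sup>2 + (v x)\<^sup>2)"
    using assms by (simp add: square_integrable_def)
  show "(\<lambda>x. u x * v x) \<in> borel_measurable (lebesgue_on \<Omega>)"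
    using assms by (intro borel_measurable_times) (simp_all add: square_integrable_def)
  have "\<bar>s * t\<bar> \<le> s\<^sup>2 + t\<^sup>2" for s t :: real
  proof -
    have "0 \<le> (\<bar>s\<bar> - \<bar>t\<bar>)\<^sup>2" "0 \<le> \<bar>s * t\<bar>"
      by simp_all
    moreover have "(\<bar>s\<bar> - \<bar>t\<bar>)\<^sup>2 = s\<^sup>2 + t\<^sup>2 - 2 * \<bar>s * t\<bar>"
      by (simp add: power2_diff abs_mult)
    ultimately show ?thesis
      by linarith
  qed
  then show "AE x in lebesgue_on \<Omega>. norm (u x * v x) \<le> norm ((u x)\<^sup>2 + (v x)\<^sup>2)"
    by (intro AE_I2) (simp add: order_trans[OF _ abs_ge_self])
qed

lemma square_integrable_linear:
  assumes "square_integrable \<Omega> u" "square_integrable \<Omega> v"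
  shows "square_integrable \<Omega> (\<lambda>x. c * u x + d * v x)"
proof -
  have "(c * u x + d * v x)\<^sup>2 = c\<^sup>2 * (u x)\<^sup>2 + (2 * c * d) * (u x * v x) + d\<^sup>2 * (v x)\<^sup>2" for x
    by (simp add: power2_eq_square algebra_simps)
  moreover have "integrable (lebesgue_on \<Omega>) (\<lambda>x. c\<^sup>2 * (u x)\<^sup>2 + (2 * c * d) * (u x * v x) + d\<^sup>2 * (v x)\<^sup>2)"
    using assms integrable_square_integrable_mult[OF assms]
    by (intro Bochner_Integration.integrable_add integrable_mult_right) (simp_all add: square_integrable_def)
  moreover have "(\<lambda>x. c * u x + d * v x) \<in> borel_measurable (lebesgue_on \<Omega>)"
    using assms by (intro borel_measurable_add borel_measurable_times) (simp_all add: square_integrable_def)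
  ultimately show ?thesis
    by (simp add: square_integrable_def)
qed

lemma C1_up_to_boundary_linear:
  assumes "C1_up_to_boundary \<Omega> u" "C1_up_to_boundary \<Omega> v"
  shows "C1_up_to_boundary \<Omega> (\<lambda>x. c * u x + d * v x)"
    and "\<And>x. x \<in> closure \<Omega> \<Longrightarrow> grad (\<lambda>x. c * u x + d * v x) x = c *\<^sub>R grad u x + d *\<^sub>R grad v x"
proof -
  obtain U where U: "open U" "closure \<Omega> \<subseteq> U" "C1_on U u"
    using assms(1) unfolding C1_up_to_boundary_iff by blast
  obtain V where V: "open V" "closure \<Omega> \<subseteq> V" "C1_on V v"
    using assms(2) unfolding C1_up_to_boundary_iff by blast
  have u: "C1_on (U \<inter> V) u" and v: "C1_on (U \<inter> V) v"
    using U V C1_on_subset by blast+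
  have cu: "C1_on (U \<inter> V) (\<lambda>x. c * u x)" and dv: "C1_on (U \<inter> V) (\<lambda>x. d * v x)"
    by (intro C1_on_mult C1_on_const u v)+
  show "C1_up_to_boundary \<Omega> (\<lambda>x. c * u x + d * v x)"
    unfolding C1_up_to_boundary_iff using C1_on_add[OF cu dv] U V by blast
  show "grad (\<lambda>x. c * u x + d * v x) x = c *\<^sub>R grad u x + d *\<^sub>R grad v x" if "x \<in> closure \<Omega>" for x
  proof -
    have x: "x \<in> U \<inter> V"
      using that U V by blast
    show ?thesis
      by (simp only: grad_add[OF cu dv x] grad_cmult[OF u x] grad_cmult[OF v x])
  qed
qed

lemma C1_up_to_boundary_continuous:
  assumes "C1_up_to_boundary \<Omega> v"
  shows "continuous_on (closure \<Omega>) v" and "continuous_on (closure \<Omega>) (grad v)"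
  using assms C1_on_continuous continuous_on_subset unfolding C1_up_to_boundary_iff by blast+

text \<open>The cell and the kind of condition are chosen once for the whole set of functions.
  Inserting the combination into that set, rather than treating it alone, guarantees that it shares
  them with the other members.\<close>

lemma domain_with_bc_linear:
  assumes bc: "domain_with_bc \<Omega> \<V>" and \<V>: "u \<in> \<V>" "v \<in> \<V>"
    and C1: "C1_up_to_boundary \<Omega> u" "C1_up_to_boundary \<Omega> v"
  shows "domain_with_bc \<Omega> (insert (\<lambda>x. c * u x + d * v x) \<V>)"
proof -
  have p: "periodic a b (\<lambda>x. c * u x + d * v x)" if "\<forall>v\<in>\<V>. periodic a b v" for a b
    using that[rule_format, OF \<V>(1)] that[rule_format, OF \<V>(2)] by (simp add: periodic_def)
  have n: "no_flux \<Omega> (\<lambda>x. c * u x + d * v x)" if "\<forall>v\<in>\<V>. no_flux \<Omega> v"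
    using that[rule_format, OF \<V>(1)] that[rule_format, OF \<V>(2)] C1_up_to_boundary_linear(2)[OF C1, of _ c d]
    by (simp add: no_flux_def inner_add_left frontier_def)
  show ?thesis
    using bc p n unfolding domain_with_bc_def by blast
qed

lemma domain_with_bc_mono: "domain_with_bc \<Omega> \<V> \<Longrightarrow> \<W> \<subseteq> \<V> \<Longrightarrow> domain_with_bc \<Omega> \<W>"
  unfolding domain_with_bc_def by blast

lemma locally_integrable_continuous:
  fixes f :: "real^'n \<Rightarrow> 'b::euclidean_space"
  assumes "continuous_on \<Omega> f"
  shows "locally_integrable \<Omega> f"
  unfolding locally_integrable_def
proof (intro allI impI)
  fix C assume "compact C \<and> C \<subseteq> \<Omega>"
  then have "integrable lborel (\<lambda>x. indicator C x *\<^sub>R f x)"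
    using assms by (intro borel_integrable_compact) (auto intro: continuous_on_subset)
  then show "set_integrable lebesgue C f"
    unfolding set_integrable_def using integrable_completion borel_measurable_integrable by blast
qed

text \<open>The same combination of the two weak divergences works; the two locale interpretations
  provide the integrability needed to split the integrals.\<close>

lemma regular_linear:
  assumes \<Omega>: "open \<Omega>" "bounded \<Omega>" and u: "regular \<Omega> u" and v: "regular \<Omega> v"
  shows "regular \<Omega> (\<lambda>x. c * u x + d * v x)"
proof -
  let ?w = "\<lambda>x. c * u x + d * v x"
  obtain f where f: "is_weak_div \<Omega> (grad u) f" "square_integrable \<Omega> f" and u1: "C1_up_to_boundary \<Omega> u"
    using u unfolding regular_def by blast
  obtain g where g: "is_weak_div \<Omega> (grad v) g" "square_integrable \<Omega> g" and v1: "C1_up_to_boundary \<Omega> v"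
    using v unfolding regular_def by blast
  interpret u: divergence_field \<Omega> "grad u" f
    by (rule divergence_field_grad[OF \<Omega> u1 f])
  interpret v: divergence_field \<Omega> "grad v" g
    by (rule divergence_field_grad[OF \<Omega> v1 g])
  have w1: "C1_up_to_boundary \<Omega> ?w"
    by (rule C1_up_to_boundary_linear(1)[OF u1 v1])
  have "is_weak_div \<Omega> (grad ?w) (\<lambda>x. c * f x + d * g x)"
    unfolding is_weak_div_def
  proof (intro conjI allI impI)
    show "locally_integrable \<Omega> (grad ?w)"
      by (rule locally_integrable_continuous[OF continuous_on_subset[OF C1_up_to_boundary_continuous(2)[OF w1] closure_subset]])
    show "locally_integrable \<Omega> (\<lambda>x. c * f x + d * g x)"
      using f(1) g(1) unfolding is_weak_div_def locally_integrable_def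
      by (intro allI impI set_integral_add set_integrable_mult_right) blast+
    fix \<psi> assume \<psi>: "test_function \<Omega> \<psi>"
    then have \<psi>1: "C1_on UNIV \<psi>"
      unfolding test_function_def Ck_on_1_iff by blast
    note iu = u.integrable_defect(1,2)[OF u.C1_on_continuous_closure[OF \<psi>1 subset_UNIV]]
      and iv = v.integrable_defect(1,2)[OF v.C1_on_continuous_closure[OF \<psi>1 subset_UNIV]]
    have "(LINT x|lebesgue_on \<Omega>. grad ?w x \<bullet> grad \<psi> x)
        = (LINT x|lebesgue_on \<Omega>. c * (grad u x \<bullet> grad \<psi> x) + d * (grad v x \<bullet> grad \<psi> x))"
    proof (rule Bochner_Integration.integral_cong)
      fix x assume "x \<in> space (lebesgue_on \<Omega>)"
      then have "x \<in> closure \<Omega>"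
        using closure_subset by auto
      then show "grad ?w x \<bullet> grad \<psi> x = c * (grad u x \<bullet> grad \<psi> x) + d * (grad v x \<bullet> grad \<psi> x)"
        by (simp add: C1_up_to_boundary_linear(2)[OF u1 v1] inner_add_left)
    qed simp
    also have "\<dots> = c * (LINT x|lebesgue_on \<Omega>. grad u x \<bullet> grad \<psi> x) + d * (LINT x|lebesgue_on \<Omega>. grad v x \<bullet> grad \<psi> x)"
      using iu iv by simp
    also have "\<dots> = - (c * (LINT x|lebesgue_on \<Omega>. f x * \<psi> x) + d * (LINT x|lebesgue_on \<Omega>. g x * \<psi> x))"
      using f(1) g(1) \<psi> unfolding is_weak_div_def by (simp add: algebra_simps)
    also have "c * (LINT x|lebesgue_on \<Omega>. f x * \<psi> x) + d * (LINT x|lebesgue_on \<Omega>. g x * \<psi> x)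
        = (LINT x|lebesgue_on \<Omega>. c * (f x * \<psi> x) + d * (g x * \<psi> x))"
      using iu iv by simp
    also have "\<dots> = (LINT x|lebesgue_on \<Omega>. (c * f x + d * g x) * \<psi> x)"
      by (simp add: algebra_simps)
    finally show "(LINT x|lebesgue_on \<Omega>. grad ?w x \<bullet> grad \<psi> x) = - (LINT x|lebesgue_on \<Omega>. (c * f x + d * g x) * \<psi> x)" .
  qed
  then show ?thesis
    unfolding regular_def using w1 square_integrable_linear[OF f(2) g(2)] by blast
qed

lemma (in divergence_field) square_integrable_continuous:
  assumes "continuous_on (closure \<Omega>) v"
  shows "square_integrable \<Omega> v"
  unfolding square_integrable_def
  by (intro conjI continuous_measurable integrable_continuous continuous_on_power assms)

lemma L2_norm_square: "(L2_norm \<Omega> v)\<^sup>2 = (LINT x|lebesgue_on \<Omega>. (norm (v x))\<^sup>2)"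
  unfolding L2_norm_def by (rule real_sqrt_pow2) (simp add: Bochner_Integration.integral_nonneg)

section \<open>Energy stability\<close>

text \<open>The G-stability of the two-step BDF formula; the square that is dropped is its numerical
  dissipation.\<close>

lemma bdf2_G_stability:
  fixes x y z :: real
  shows "x\<^sup>2 + (2 * x - y)\<^sup>2 - (y\<^sup>2 + (2 * y - z)\<^sup>2) \<le> 2 * (x * (3 * x - 4 * y + z))"
proof -
  have "2 * (x * (3 * x - 4 * y + z)) = x\<^sup>2 + (2 * x - y)\<^sup>2 - (y\<^sup>2 + (2 * y - z)\<^sup>2) + (x - 2 * y + z)\<^sup>2"
    by (simp add: power2_eq_square algebra_simps)
  then show ?thesis
    by simp
qed

text \<open>In the increments p = x - y and q = y - z the right-hand side is (p - q) times (3 p -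
  q), which exceeds the left by 2 |p - q|^2. The inner product version serves both the values and
  the gradients of the phase field.\<close>

lemma bdf2_increment_stability:
  fixes x y z :: "'a::real_inner"
  shows "(norm (x - y))\<^sup>2 - (norm (y - z))\<^sup>2 \<le> (x - 2 *\<^sub>R y + z) \<bullet> (3 *\<^sub>R x - 4 *\<^sub>R y + z)"
proof -
  have e: "x - 2 *\<^sub>R y + z = (x - y) - (y - z)" "3 *\<^sub>R x - 4 *\<^sub>R y + z = 3 *\<^sub>R (x - y) - (y - z)"
  proof -
    have "3 *\<^sub>R x - 4 *\<^sub>R y = 3 *\<^sub>R x - (3 *\<^sub>R y + y)" "2 *\<^sub>R y = y + y"
      using scaleR_add_left[of 3 1 y] scaleR_add_left[of 1 1 y] by simp_all
    then show "x - 2 *\<^sub>R y + z = (x - y) - (y - z)" "3 *\<^sub>R x - 4 *\<^sub>R y + z = 3 *\<^sub>R (x - y) - (y - z)"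
      by (simp_all add: scaleR_diff_right)
  qed
  have "(p - q) \<bullet> (3 *\<^sub>R p - q) = (norm p)\<^sup>2 - (norm q)\<^sup>2 + 2 * (norm (p - q))\<^sup>2" for p q :: 'a
    by (simp add: power2_norm_eq_inner inner_diff_left inner_diff_right inner_commute algebra_simps)
  then show ?thesis
    unfolding e by simp
qed

theorem theorem3p2:
  fixes \<Omega> :: "(real^'n) set"
    and \<phi> U u :: "nat \<Rightarrow> real^'n \<Rightarrow> real"
    and \<phi>s Zs :: "real^'n \<Rightarrow> real"
    and \<tau> p :: "real \<Rightarrow> real"
    and \<kappa> :: "real^'n \<Rightarrow> real"
    and \<epsilon> lam K D S\<^sub>1 S\<^sub>2 B dt :: real
    and n :: nat
  assumes dim: "CARD('n) = 2 \<or> CARD('n) = 3"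
    and params: "\<epsilon> > 0" "lam > 0" "K > 0" "D > 0" "S\<^sub>1 > 0" "S\<^sub>2 > 0"
    and time_step: "dt > 0"
    and n: "n \<ge> 1"
    and mobility: "\<And>s. \<tau> s > 0"
    and p_diff: "\<And>s. p differentiable (at s)"
    and kappa_diff: "\<And>q. q \<noteq> 0 \<Longrightarrow> \<kappa> differentiable (at q)"
    and bc: "domain_with_bc \<Omega> {\<phi> (n-1), \<phi> n, \<phi> (n+1), u (n-1), u n, u (n+1)}"
    and regular: "\<And>v. v \<in> {\<phi> (n-1), \<phi> n, \<phi> (n+1), u (n-1), u n, u (n+1)} \<Longrightarrow> regular \<Omega> v"
    and U_L2: "\<And>k. k \<in> {n-1, n, n+1} \<Longrightarrow> square_integrable \<Omega> (U k)"
    and phi_star: "\<phi>s = (\<lambda>x. 2 * \<phi> n x - \<phi> (n-1) x)"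
    and flux_div: "\<exists>g. is_weak_div \<Omega> (anisotropic_flux \<kappa> \<phi>s) g"
    and radicand_pos: "\<And>x. x \<in> \<Omega> \<Longrightarrow> radicand \<kappa> \<epsilon> B \<phi>s x > 0"
    and Z_star: "Zs = Z \<Omega> \<kappa> \<epsilon> B \<phi>s"
    and phase_eq: "AE x in lebesgue_on \<Omega>.
        \<tau> (\<phi>s x) * ((3 * \<phi> (n+1) x - 4 * \<phi> n x + \<phi> (n-1) x) / (2 * dt))
        + S\<^sub>1 / \<epsilon>\<^sup>2 * (\<phi> (n+1) x - 2 * \<phi> n x + \<phi> (n-1) x)
        - S\<^sub>2 * laplacian \<Omega> (\<lambda>y. \<phi> (n+1) y - 2 * \<phi> n y + \<phi> (n-1) y) x
        = - Zs x * U (n+1) x - lam / \<epsilon> * deriv p (\<phi>s x) * u (n+1) x"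
    and U_eq: "AE x in lebesgue_on \<Omega>.
        3 * U (n+1) x - 4 * U n x + U (n-1) x
        = 1/2 * Zs x * (3 * \<phi> (n+1) x - 4 * \<phi> n x + \<phi> (n-1) x)"
    and heat_eq: "AE x in lebesgue_on \<Omega>.
        (3 * u (n+1) x - 4 * u n x + u (n-1) x) / (2 * dt) - D * laplacian \<Omega> (u (n+1)) x
        = K * deriv p (\<phi>s x) * ((3 * \<phi> (n+1) x - 4 * \<phi> n x + \<phi> (n-1) x) / (2 * dt))"
  shows "1 / dt * (E_bdf2 \<Omega> \<epsilon> lam K S\<^sub>1 S\<^sub>2 (\<phi> (n+1)) (\<phi> n) (U (n+1)) (U n) (u (n+1)) (u n)
            - E_bdf2 \<Omega> \<epsilon> lam K S\<^sub>1 S\<^sub>2 (\<phi> n) (\<phi> (n-1)) (U n) (U (n-1)) (u n) (u (n-1)))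
         \<le> - (L2_norm \<Omega> (\<lambda>x. sqrt (\<tau> (\<phi>s x))
                * ((3 * \<phi> (n+1) x - 4 * \<phi> n x + \<phi> (n-1) x) / (2 * dt))))\<^sup>2
            - lam * D / (\<epsilon> * K) * (L2_norm \<Omega> (grad (u (n+1))))\<^sup>2
       \<and> - (L2_norm \<Omega> (\<lambda>x. sqrt (\<tau> (\<phi>s x))
                * ((3 * \<phi> (n+1) x - 4 * \<phi> n x + \<phi> (n-1) x) / (2 * dt))))\<^sup>2
            - lam * D / (\<epsilon> * K) * (L2_norm \<Omega> (grad (u (n+1))))\<^sup>2
         \<le> 0"
proof -
  define \<phi>1 \<phi>0 \<phi>m where "\<phi>1 = \<phi> (n+1)" and "\<phi>0 = \<phi> n" and "\<phi>m = \<phi> (n-1)"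
  define U1 U0 Um where "U1 = U (n+1)" and "U0 = U n" and "Um = U (n-1)"
  define u1 u0 um where "u1 = u (n+1)" and "u0 = u n" and "um = u (n-1)"
  note defs = \<phi>1_def \<phi>0_def \<phi>m_def U1_def U0_def Um_def u1_def u0_def um_def
  define w where "w x = \<phi>1 x - 2 * \<phi>0 x + \<phi>m x" for x
  define d where "d x = 3 * \<phi>1 x - 4 * \<phi>0 x + \<phi>m x" for x
  note \<Omega> = domain_with_bc_open_bounded[OF bc]
  have bc': "domain_with_bc \<Omega> {\<phi>m, \<phi>0, \<phi>1, um, u0, u1}"
    using bc by (simp only: defs)
  have reg: "regular \<Omega> \<phi>m" "regular \<Omega> \<phi>0" "regular \<Omega> \<phi>1" "regular \<Omega> um" "regular \<Omega> u0" "regular \<Omega> u1"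
    unfolding defs by (simp_all add: regular)
  then have C1: "C1_up_to_boundary \<Omega> \<phi>m" "C1_up_to_boundary \<Omega> \<phi>0" "C1_up_to_boundary \<Omega> \<phi>1"
    "C1_up_to_boundary \<Omega> um" "C1_up_to_boundary \<Omega> u0" "C1_up_to_boundary \<Omega> u1"
    by (simp_all add: regular_def)

  \<comment> \<open>Coefficients equal to 1 are spelled out so that the lemmas about
    \<open>c * u x + d * v x\<close> unify, first with the inner and then with the outer
    sum.\<close>
  have w_eq: "w = (\<lambda>x. 1 * (1 * \<phi>1 x + (- 2) * \<phi>0 x) + 1 * \<phi>m x)"
    by (simp add: w_def fun_eq_iff)
  have d_eq: "d = (\<lambda>x. 1 * (3 * \<phi>1 x + (- 4) * \<phi>0 x) + 1 * \<phi>m x)"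
    by (simp add: d_def fun_eq_iff)
  note C1_part = C1_up_to_boundary_linear[OF C1(3,2)]
  have w_C1: "C1_up_to_boundary \<Omega> w" and d_C1: "C1_up_to_boundary \<Omega> d"
    unfolding w_eq d_eq by (intro C1_up_to_boundary_linear(1) C1)+
  have gw: "grad w x = grad \<phi>1 x - 2 *\<^sub>R grad \<phi>0 x + grad \<phi>m x"
    and gd: "grad d x = 3 *\<^sub>R grad \<phi>1 x - 4 *\<^sub>R grad \<phi>0 x + grad \<phi>m x" if "x \<in> closure \<Omega>" for x
    unfolding w_eq d_eq C1_up_to_boundary_linear(2)[OF C1_part(1) C1(1) that] C1_part(2)[OF that] by simp_all
  have w_reg: "regular \<Omega> w"
    unfolding w_eq by (intro regular_linear \<Omega> reg)
  \<comment> \<open>Partial sums are inserted next to the old members, so that each application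
    finds both of its arguments in the set and the cell never changes.\<close>
  have bc_wd: "domain_with_bc \<Omega> {w, d}"
  proof -
    let ?V = "{\<phi>m, \<phi>0, \<phi>1, um, u0, u1}"
    let ?V1 = "insert (\<lambda>x. 1 * \<phi>1 x + (- 2) * \<phi>0 x) ?V"
    have 1: "domain_with_bc \<Omega> ?V1"
      by (rule domain_with_bc_linear[OF bc' _ _ C1(3,2)]) simp_all
    have 2: "domain_with_bc \<Omega> (insert w ?V1)"
      unfolding w_eq by (rule domain_with_bc_linear[OF 1 _ _ C1_part(1) C1(1)]) simp_all
    let ?V2 = "insert (\<lambda>x. 3 * \<phi>1 x + (- 4) * \<phi>0 x) (insert w ?V1)"
    have 3: "domain_with_bc \<Omega> ?V2"
      by (rule domain_with_bc_linear[OF 2 _ _ C1(3,2)]) simp_all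
    have "domain_with_bc \<Omega> (insert d ?V2)"
      unfolding d_eq by (rule domain_with_bc_linear[OF 3 _ _ C1_part(1) C1(1)]) simp_all
    then show ?thesis
      by (rule domain_with_bc_mono) simp
  qed
  have bc_uu: "domain_with_bc \<Omega> {u1, u1}"
    by (rule domain_with_bc_mono[OF bc']) simp
  note Green_w = Green_identity[OF bc_wd w_reg d_C1]
    and Green_u = Green_identity[OF bc_uu reg(6) C1(6)]

  obtain gw' where gw': "is_weak_div \<Omega> (grad w) gw'" "square_integrable \<Omega> gw'"
    using w_reg unfolding regular_def by blast
  \<comment> \<open>Besides the field itself, this gives integrability on the domain of functions
    that are continuous up to the boundary.\<close>
  interpret divergence_field \<Omega> "grad w" gw'
    by (rule divergence_field_grad[OF \<Omega> w_C1 gw'])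
  have sq: "square_integrable \<Omega> v" if "C1_up_to_boundary \<Omega> v" for v
    by (rule square_integrable_continuous[OF C1_up_to_boundary_continuous(1)[OF that]])
  have sqU: "square_integrable \<Omega> U1" "square_integrable \<Omega> U0" "square_integrable \<Omega> Um"
    unfolding defs by (simp_all add: U_L2)
  have sqd: "square_integrable \<Omega> (\<lambda>x. 2 * f x - g x)" "square_integrable \<Omega> (\<lambda>x. f x - g x)"
    if "square_integrable \<Omega> f" "square_integrable \<Omega> g" for f g
    using square_integrable_linear[OF that, of 2 "- 1"] square_integrable_linear[OF that, of 1 "- 1"] by simp_all
  have sq3: "square_integrable \<Omega> (\<lambda>x. 3 * f x - 4 * g x + h x)"
    if "square_integrable \<Omega> f" "square_integrable \<Omega> g" "square_integrable \<Omega> h" for f g h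
    using square_integrable_linear[OF square_integrable_linear[OF that(1,2), of 3 "- 4"] that(3), of 1 1] by simp
  have int2: "integrable (lebesgue_on \<Omega>) (\<lambda>x. (f x)\<^sup>2)" if "square_integrable \<Omega> f" for f
    using that by (simp add: square_integrable_def)
  have intg: "integrable (lebesgue_on \<Omega>) (\<lambda>x. (norm (grad f x - grad g x))\<^sup>2)"
    if "C1_up_to_boundary \<Omega> f" "C1_up_to_boundary \<Omega> g" for f g
    using that by (intro integrable_continuous continuous_on_power continuous_on_norm continuous_on_diff
        C1_up_to_boundary_continuous)

  \<comment> \<open>The energy as a density, so that the law can be proved pointwise and integrated
    once at the end.\<close>
  define e where "e U1 U0 u1 u0 \<phi>1 \<phi>0 x = ((U1 x)\<^sup>2 + (2 * U1 x - U0 x)\<^sup>2) / 2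
      + lam / (2 * \<epsilon> * K) * (((u1 x)\<^sup>2 + (2 * u1 x - u0 x)\<^sup>2) / 2)
      + S\<^sub>1 / \<epsilon>\<^sup>2 * ((\<phi>1 x - \<phi>0 x)\<^sup>2 / 2)
      + S\<^sub>2 * ((norm (grad \<phi>1 x - grad \<phi>0 x))\<^sup>2 / 2)" for U1 U0 u1 u0 \<phi>1 \<phi>0 :: "real^'n \<Rightarrow> real" and x
  have energy: "integrable (lebesgue_on \<Omega>) (e U1 U0 u1 u0 \<phi>1 \<phi>0)"
      "E_bdf2 \<Omega> \<epsilon> lam K S\<^sub>1 S\<^sub>2 \<phi>1 \<phi>0 U1 U0 u1 u0 = (LINT x|lebesgue_on \<Omega>. e U1 U0 u1 u0 \<phi>1 \<phi>0 x)"
    if U: "square_integrable \<Omega> U1" "square_integrable \<Omega> U0"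
      and u: "C1_up_to_boundary \<Omega> u1" "C1_up_to_boundary \<Omega> u0"
      and \<phi>: "C1_up_to_boundary \<Omega> \<phi>1" "C1_up_to_boundary \<Omega> \<phi>0" for U1 U0 u1 u0 \<phi>1 \<phi>0
  proof -
    note i = int2[OF U(1)] int2[OF sqd(1)[OF U]] int2[OF sq[OF u(1)]] int2[OF sqd(1)[OF sq[OF u(1)] sq[OF u(2)]]]
      int2[OF sqd(2)[OF sq[OF \<phi>(1)] sq[OF \<phi>(2)]]] intg[OF \<phi>]
    show "integrable (lebesgue_on \<Omega>) (e U1 U0 u1 u0 \<phi>1 \<phi>0)"
      unfolding e_def using i by simp
    show "E_bdf2 \<Omega> \<epsilon> lam K S\<^sub>1 S\<^sub>2 \<phi>1 \<phi>0 U1 U0 u1 u0 = (LINT x|lebesgue_on \<Omega>. e U1 U0 u1 u0 \<phi>1 \<phi>0 x)"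
      unfolding e_def E_bdf2_def L2_norm_square using i by simp
  qed
  note e1 = energy[OF sqU(1,2) C1(6,5) C1(3,2)] and e0 = energy[OF sqU(2,3) C1(5,4) C1(2,1)]

  define NU where "NU x = U1 x * (3 * U1 x - 4 * U0 x + Um x)" for x
  define Nu where "Nu x = u1 x * (3 * u1 x - 4 * u0 x + um x)" for x
  \<comment> \<open>The dissipation density. Since \<open>\<tau>\<close> is an arbitrary positive
    function, its integrability is not evident and has to come from \<open>B\<close>.\<close>
  define A where "A x = \<tau> (\<phi>s x) * (d x / (2 * dt))\<^sup>2" for x
  \<comment> \<open>What the tested phase equation becomes when the other two equations have
    replaced the couplings: only integrable products are left. From here on the name shadows the
    constant in the radicand.\<close>
  define B where "B x = - (S\<^sub>1 / \<epsilon>\<^sup>2 / (2 * dt)) * (w x * d x) + S\<^sub>2 / (2 * dt) * (laplacian \<Omega> w x * d x)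
      - 1 / dt * NU x - lam / (\<epsilon> * K) / (2 * dt) * Nu x + lam * D / (\<epsilon> * K) * (laplacian \<Omega> u1 x * u1 x)" for x
  have "integrable (lebesgue_on \<Omega>) NU" "integrable (lebesgue_on \<Omega>) Nu" "integrable (lebesgue_on \<Omega>) (\<lambda>x. w x * d x)"
    unfolding NU_def Nu_def
    by (intro integrable_square_integrable_mult sq3 sqU sq C1 w_C1 d_C1)+
  then have iB: "integrable (lebesgue_on \<Omega>) B"
    unfolding B_def using Green_w(1) Green_u(1)
    by (intro Bochner_Integration.integrable_add Bochner_Integration.integrable_diff integrable_mult_right)
  have "laplacian \<Omega> (\<lambda>y. \<phi>1 y - 2 * \<phi>0 y + \<phi>m y) = laplacian \<Omega> w"
    by (simp add: w_def[abs_def])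
  note phase = phase_eq[folded defs, unfolded this]
  have AE: "AE x in lebesgue_on \<Omega>. B x = A x"
    using phase U_eq[folded defs] heat_eq[folded defs]
  proof eventually_elim
    case (elim x)
    define q where "q = d x / (2 * dt)"
    define vU where "vU = 3 * U1 x - 4 * U0 x + Um x"
    define vu where "vu = 3 * u1 x - 4 * u0 x + um x"
    define p' where "p' = deriv p (\<phi>s x)"
    have d: "d x = 2 * dt * q"
      using time_step by (simp add: q_def)
    have 1: "\<tau> (\<phi>s x) * q + S\<^sub>1 / \<epsilon>\<^sup>2 * w x - S\<^sub>2 * laplacian \<Omega> w x = - Zs x * U1 x - lam / \<epsilon> * p' * u1 x"
      using elim(1) by (simp only: q_def w_def d_def p'_def)
    \<comment> \<open>The factor 1/2 of the equation for U cancels the 2 of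
      \<open>2 * dt\<close>.\<close>
    have 2: "vU = Zs x * dt * q"
      using elim(2) d by (simp add: vU_def d_def)
    have 3: "K * p' * q = vu / (2 * dt) - D * laplacian \<Omega> u1 x"
      using elim(3) by (simp add: q_def vu_def d_def p'_def)
    have "A x = (\<tau> (\<phi>s x) * q) * q"
      by (simp add: A_def q_def power2_eq_square)
    also have "\<tau> (\<phi>s x) * q = - Zs x * U1 x - lam / \<epsilon> * p' * u1 x - S\<^sub>1 / \<epsilon>\<^sup>2 * w x + S\<^sub>2 * laplacian \<Omega> w x"
      using 1 by linarith
    \<comment> \<open>Extending by \<open>K\<close> turns the thermal coupling into a multiple of
      \<open>K * p' * q\<close>, the right-hand side of the heat equation.\<close>
    also have "\<dots> * q = - (U1 x * (Zs x * q)) - lam / (\<epsilon> * K) * u1 x * (K * p' * q)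
        - S\<^sub>1 / \<epsilon>\<^sup>2 * w x * q + S\<^sub>2 * laplacian \<Omega> w x * q"
      using params by (simp add: field_simps)
    also have "Zs x * q = vU / dt"
      using 2 time_step by simp
    also have "- (U1 x * (vU / dt)) - lam / (\<epsilon> * K) * u1 x * (K * p' * q)
        - S\<^sub>1 / \<epsilon>\<^sup>2 * w x * q + S\<^sub>2 * laplacian \<Omega> w x * q = B x"
      unfolding 3 B_def NU_def Nu_def vU_def[symmetric] vu_def[symmetric] d
      using params time_step by (simp add: field_simps)
    finally show ?case
      by (rule sym)
  qed
  note A = integrable_lebesgue_on_cong_AE[OF domain_sets iB AE]

  \<comment> \<open>Both Green identities, with the weights that the Laplacians carry in
    \<open>B\<close>. A function of integral 0 that trades the Laplacians for gradients inside a
    pointwise estimate.\<close>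
  define r where "r x = S\<^sub>2 / (2 * dt) * (grad w x \<bullet> grad d x + laplacian \<Omega> w x * d x)
      + lam * D / (\<epsilon> * K) * (grad u1 x \<bullet> grad u1 x + laplacian \<Omega> u1 x * u1 x)" for x
  have ir: "integrable (lebesgue_on \<Omega>) r" and r0: "(LINT x|lebesgue_on \<Omega>. r x) = 0"
  proof -
    note i = Bochner_Integration.integrable_add[OF Green_w(2,1)] Bochner_Integration.integrable_add[OF Green_u(2,1)]
    show "integrable (lebesgue_on \<Omega>) r"
      unfolding r_def by (intro Bochner_Integration.integrable_add integrable_mult_right i)
    have "(LINT x|lebesgue_on \<Omega>. r x)
        = S\<^sub>2 / (2 * dt) * (LINT x|lebesgue_on \<Omega>. grad w x \<bullet> grad d x + laplacian \<Omega> w x * d x)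
          + lam * D / (\<epsilon> * K) * (LINT x|lebesgue_on \<Omega>. grad u1 x \<bullet> grad u1 x + laplacian \<Omega> u1 x * u1 x)"
      unfolding r_def
      by (subst Bochner_Integration.integral_add[OF integrable_mult_right[OF i(1)] integrable_mult_right[OF i(2)]])
        (simp only: integral_mult_right_zero)
    then show "(LINT x|lebesgue_on \<Omega>. r x) = 0"
      unfolding Green_w(3) Green_u(3) by simp
  qed

  define e1x where "e1x = e U1 U0 u1 u0 \<phi>1 \<phi>0"
  define e0x where "e0x = e U0 Um u0 um \<phi>0 \<phi>m"
  have pt: "1 / dt * (e1x x - e0x x) + B x + lam * D / (\<epsilon> * K) * (grad u1 x \<bullet> grad u1 x) \<le> r x"
    if x: "x \<in> \<Omega>" for x
  proof -
    have cl: "x \<in> closure \<Omega>"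
      using x closure_subset by blast
    have 1: "1 / (2 * dt) * ((U1 x)\<^sup>2 + (2 * U1 x - U0 x)\<^sup>2 - ((U0 x)\<^sup>2 + (2 * U0 x - Um x)\<^sup>2)) \<le> 1 / (2 * dt) * (2 * NU x)"
      unfolding NU_def using time_step by (intro mult_left_mono bdf2_G_stability) simp
    have 2: "lam / (2 * \<epsilon> * K) / (2 * dt) * ((u1 x)\<^sup>2 + (2 * u1 x - u0 x)\<^sup>2 - ((u0 x)\<^sup>2 + (2 * u0 x - um x)\<^sup>2))
        \<le> lam / (2 * \<epsilon> * K) / (2 * dt) * (2 * Nu x)"
      unfolding Nu_def using params time_step by (intro mult_left_mono bdf2_G_stability) simp
    have 3: "S\<^sub>1 / \<epsilon>\<^sup>2 / (2 * dt) * ((\<phi>1 x - \<phi>0 x)\<^sup>2 - (\<phi>0 x - \<phi>m x)\<^sup>2) \<le> S\<^sub>1 / \<epsilon>\<^sup>2 / (2 * dt) * (w x * d x)"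
      using params time_step bdf2_increment_stability[of "\<phi>1 x" "\<phi>0 x" "\<phi>m x"]
      by (intro mult_left_mono) (simp_all add: w_def d_def)
    have 4: "S\<^sub>2 / (2 * dt) * ((norm (grad \<phi>1 x - grad \<phi>0 x))\<^sup>2 - (norm (grad \<phi>0 x - grad \<phi>m x))\<^sup>2)
        \<le> S\<^sub>2 / (2 * dt) * (grad w x \<bullet> grad d x)"
      unfolding gw[OF cl] gd[OF cl] using params time_step by (intro mult_left_mono bdf2_increment_stability) simp
    have "1 / dt * (e1x x - e0x x)
        = 1 / (2 * dt) * ((U1 x)\<^sup>2 + (2 * U1 x - U0 x)\<^sup>2 - ((U0 x)\<^sup>2 + (2 * U0 x - Um x)\<^sup>2))
          + lam / (2 * \<epsilon> * K) / (2 * dt) * ((u1 x)\<^sup>2 + (2 * u1 x - u0 x)\<^sup>2 - ((u0 x)\<^sup>2 + (2 * u0 x - um x)\<^sup>2))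
          + S\<^sub>1 / \<epsilon>\<^sup>2 / (2 * dt) * ((\<phi>1 x - \<phi>0 x)\<^sup>2 - (\<phi>0 x - \<phi>m x)\<^sup>2)
          + S\<^sub>2 / (2 * dt) * ((norm (grad \<phi>1 x - grad \<phi>0 x))\<^sup>2 - (norm (grad \<phi>0 x - grad \<phi>m x))\<^sup>2)"
    proof -
      \<comment> \<open>Letters in place of the squared terms keep \<open>field_simps\<close> from
        expanding them.\<close>
      have "1 / dt * ((a / 2 + k * (b / 2) + s * (f / 2) + S\<^sub>2 * (h / 2)) - (a' / 2 + k * (b' / 2) + s * (f' / 2) + S\<^sub>2 * (h' / 2)))
          = 1 / (2 * dt) * (a - a') + k / (2 * dt) * (b - b') + s / (2 * dt) * (f - f') + S\<^sub>2 / (2 * dt) * (h - h')"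
        for a b f h a' b' f' h' k s
        using time_step by (simp add: field_simps)
      then show ?thesis
        unfolding e1x_def e0x_def e_def .
    qed
    \<comment> \<open>Both Laplacians cancel between \<open>r\<close> and \<open>B\<close>, and so
      does the squared gradient of \<open>u1\<close>. What is left are exactly the four upper
      bounds.\<close>
    moreover have "r x - B x - lam * D / (\<epsilon> * K) * (grad u1 x \<bullet> grad u1 x)
        = S\<^sub>2 / (2 * dt) * (grad w x \<bullet> grad d x) + S\<^sub>1 / \<epsilon>\<^sup>2 / (2 * dt) * (w x * d x)
          + 1 / (2 * dt) * (2 * NU x) + lam / (2 * \<epsilon> * K) / (2 * dt) * (2 * Nu x)"
      unfolding r_def B_def using params time_step by (simp add: field_simps)
    ultimately show ?thesis
      using 1 2 3 4 by linarith
  qed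
  have iu: "integrable (lebesgue_on \<Omega>) (\<lambda>x. grad u1 x \<bullet> grad u1 x)"
    by (rule Green_u(2))
  have "(LINT x|lebesgue_on \<Omega>. 1 / dt * (e1x x - e0x x) + B x + lam * D / (\<epsilon> * K) * (grad u1 x \<bullet> grad u1 x))
      \<le> (LINT x|lebesgue_on \<Omega>. r x)"
    using e1(1) e0(1) iB iu ir pt unfolding e1x_def[symmetric] e0x_def[symmetric]
    by (intro integral_mono Bochner_Integration.integrable_add Bochner_Integration.integrable_diff integrable_mult_right) simp_all
  also have "(LINT x|lebesgue_on \<Omega>. 1 / dt * (e1x x - e0x x) + B x + lam * D / (\<epsilon> * K) * (grad u1 x \<bullet> grad u1 x))
      = 1 / dt * ((LINT x|lebesgue_on \<Omega>. e1x x) - (LINT x|lebesgue_on \<Omega>. e0x x)) + (LINT x|lebesgue_on \<Omega>. B x)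
        + lam * D / (\<epsilon> * K) * (LINT x|lebesgue_on \<Omega>. grad u1 x \<bullet> grad u1 x)"
    using e1(1) e0(1) iB iu unfolding e1x_def[symmetric] e0x_def[symmetric] by simp
  finally have law: "1 / dt * (E_bdf2 \<Omega> \<epsilon> lam K S\<^sub>1 S\<^sub>2 \<phi>1 \<phi>0 U1 U0 u1 u0 - E_bdf2 \<Omega> \<epsilon> lam K S\<^sub>1 S\<^sub>2 \<phi>0 \<phi>m U0 Um u0 um)
      \<le> - (LINT x|lebesgue_on \<Omega>. A x) - lam * D / (\<epsilon> * K) * (LINT x|lebesgue_on \<Omega>. grad u1 x \<bullet> grad u1 x)"
    unfolding r0 e1(2) e0(2) A(2) e1x_def[symmetric] e0x_def[symmetric] by linarith
  \<comment> \<open>Positivity of the mobility lets its square root be squared back.\<close>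
  have "A x = (norm (sqrt (\<tau> (\<phi>s x)) * (d x / (2 * dt))))\<^sup>2" for x
    by (simp only: A_def real_norm_def power2_abs power_mult_distrib real_sqrt_pow2[OF less_imp_le[OF mobility]])
  then have LA: "(L2_norm \<Omega> (\<lambda>x. sqrt (\<tau> (\<phi>s x)) * (d x / (2 * dt))))\<^sup>2 = (LINT x|lebesgue_on \<Omega>. A x)"
    unfolding L2_norm_square by simp
  have Lu: "(L2_norm \<Omega> (grad u1))\<^sup>2 = (LINT x|lebesgue_on \<Omega>. grad u1 x \<bullet> grad u1 x)"
    unfolding L2_norm_square power2_norm_eq_inner ..
  have "0 \<le> lam * D / (\<epsilon> * K) * (L2_norm \<Omega> (grad u1))\<^sup>2"
    "0 \<le> (L2_norm \<Omega> (\<lambda>x. sqrt (\<tau> (\<phi>s x)) * (d x / (2 * dt))))\<^sup>2"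
    using params by simp_all
  then show ?thesis
    using law unfolding LA[symmetric] Lu[symmetric] d_def unfolding defs by linarith
qed

end
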